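(* Let $n\ge1$ be an integer with $n\ne2$, let $E>0$ and $0<\delta_0<1$. Let $P=P_h:=-h^2\Delta+V-E$, $h>0$, where, using polar coordinates $(r,\omega)\in(0,\infty)\times\mathbb S^{n-1}$, the real-valued potential $V=V_h(r,\omega)$ and its distributional derivative $\partial_rV$ are in $L^\infty((0,\infty)\times\mathbb S^{n-1})$, and $V\le(1+r)^{-\delta_0}$, $\partial_rV\le(1+r)^{-1-\delta_0}$. Let $\delta\in(0,\delta_0)$, and put $w(r):=1-(1+r)^{-\delta}$ and $m(r):=(1+r^2)^{(1+\delta)/4}$. Suppose that $h_0>0$, $R_0>0$ and $\varphi=\varphi(r)\in C^\infty([0,\infty))$ (real-valued) are such that $\varphi'\ge0$, $\operatorname{supp}\varphi'=[0,R_0]$, and $$\partial_r\left(w(r)\left(E-V_h(r,\omega)+\varphi'(r)^2-h\varphi''(r)\right)\right)\ge \tfrac14 E\,w'(r)$$ for all $h\in(0,h_0]$, $r>0$, $\omega\in\mathbb S^{n-1}$. Then there is $C>0$ such that $$\left\|m^{-1}e^{\varphi/h}v\right\|^2_{L^2(\mathbb R^n)}\le\frac{C}{h^2}\left\|m\,e^{\varphi/h}(P-i\varepsilon)v\right\|^2_{L^2(\mathbb R^n)}+\frac{C\varepsilon}{h}\left\|e^{\varphi/h}v\right\|^2_{L^2(\mathbb R^n)}$$ for all $v\in C_0^\infty(\mathbb R^n)$, $\varepsilon\ge0$, and $h\in(0,h_0]$.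
   Context: $\Delta\le0$ is the Laplacian on $\mathbb R^n$. Polar coordinates are $r=|x|$, $\omega=x/|x|$; for $n=1$, $\mathbb S^0=\{\pm1\}$. The potential $V=V_h$ may depend on the semiclassical parameter $h$. Functions of $r$ such as $m$ and $\varphi$ are regarded as radial functions on $\mathbb R^n$ and act by multiplication. Derivatives $\partial_r$ of expressions involving $V$ are distributional, and inequalities between $L^\infty$ functions are understood almost everywhere.
   Formalization: The formal statement additionally assumes that |V_h| is bounded uniformly in h for h in (0,h_0]; with V_h in L^∞ only for each separate h, no h-independent C exists in general (e.g. V_h = 0 for r<2 dropping to -M_h for r>2, M_h→∞, n=3). *)

theory Defs
  imports "HOL-Analysis.Analysis"
begin

section \<open>Smooth functions and the Laplacian\<close>

definition dir_deriv ::
    "'a::euclidean_space \<Rightarrow> ('a \<Rightarrow> 'b::real_normed_vector) \<Rightarrow> 'a \<Rightarrow> 'b" where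
  "dir_deriv u f x = frechet_derivative f (at x) u"

primrec Ck :: "nat \<Rightarrow> ('a::euclidean_space \<Rightarrow> 'b::real_normed_vector) \<Rightarrow> bool" where
  "Ck 0 f \<longleftrightarrow> continuous_on UNIV f"
| "Ck (Suc k) f \<longleftrightarrow> (\<forall>x. f differentiable (at x)) \<and> (\<forall>u. Ck k (dir_deriv u f))"

definition smooth :: "('a::euclidean_space \<Rightarrow> 'b::real_normed_vector) \<Rightarrow> bool" where
  "smooth f \<longleftrightarrow> (\<forall>k. Ck k f)"

definition supp :: "('a::euclidean_space \<Rightarrow> 'b::real_normed_vector) \<Rightarrow> 'a set" where
  "supp f = closure {x. f x \<noteq> 0}"

definition Cc_infinity :: "('a::euclidean_space \<Rightarrow> 'b::real_normed_vector) set" where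
  "Cc_infinity = {f. smooth f \<and> compact (supp f)}"

definition laplacian :: "('a::euclidean_space \<Rightarrow> 'b::real_normed_vector) \<Rightarrow> 'a \<Rightarrow> 'b" where
  "laplacian f x = (\<Sum>b\<in>Basis. dir_deriv b (dir_deriv b f) x)"

text \<open>Derivative on the closed half-line \<open>[0,\<infinity>)\<close>, one-sided at \<open>0\<close>. Values of \<open>f\<close> at
  negative arguments play no role.\<close>

definition hl_deriv :: "(real \<Rightarrow> real) \<Rightarrow> real \<Rightarrow> real" where
  "hl_deriv f r = vector_derivative f (at r within {0..})"

definition hl_smooth :: "(real \<Rightarrow> real) \<Rightarrow> bool" where
  "hl_smooth f \<longleftrightarrow> (\<forall>k. (hl_deriv ^^ k) f differentiable_on {0..})"


section \<open>Polar coordinates\<close>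

text \<open>The surface measure on the unit sphere, as a cone measure:
  \<open>\<sigma>(A) = n \<cdot> |{x. 0 < |x| < 1, x/|x| \<in> A}|\<close>, where \<open>sgn x = x/|x|\<close>. For \<open>n = 1\<close> this is the
  counting measure on \<open>{-1, 1}\<close>.\<close>

definition sphere_measure :: "'a::euclidean_space measure" where
  "sphere_measure = scale_measure (of_nat DIM('a))
     (distr (restrict_space lborel (ball 0 1 - {0})) (restrict_space borel (sphere 0 1)) sgn)"

text \<open>The measure \<open>dr d\<omega>\<close> (without the Jacobian \<open>r^(n-1)\<close>) on \<open>(0,\<infinity>) \<times> S\<^sup>n\<^sup>-\<^sup>1\<close>.\<close>

definition polar_measure :: "(real \<times> 'a::euclidean_space) measure" where
  "polar_measure = restrict_space lborel {0<..} \<Otimes>\<^sub>M sphere_measure"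

lemma sgn_measurable_sphere:
  "sgn \<in> restrict_space lborel (ball (0::'a::euclidean_space) 1 - {0})
     \<rightarrow>\<^sub>M restrict_space borel (sphere 0 1)"
proof -
  have "sgn = (\<lambda>x::'a. inverse (norm x) *\<^sub>R x)"
    by (simp add: fun_eq_iff sgn_div_norm)
  then have "sgn \<in> borel_measurable (restrict_space lborel (ball (0::'a) 1 - {0}))"
    by (intro measurable_restrict_space1) simp
  then show ?thesis
    by (intro measurable_restrict_space2) (auto simp: space_restrict_space norm_sgn)
qed

lemma space_polar_measure:
  "space (polar_measure :: (real \<times> 'a::euclidean_space) measure) = {0<..} \<times> sphere 0 1"
  by (simp add: polar_measure_def sphere_measure_def space_pair_measure space_scale_measure
      space_restrict_space)

lemma emeasure_sphere_measure:
  assumes "A \<in> sets borel" "A \<subseteq> sphere (0::'a::euclidean_space) 1"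
  shows "emeasure sphere_measure A =
    of_nat DIM('a) * emeasure lborel {x. 0 < norm x \<and> norm x < 1 \<and> sgn x \<in> A}"
proof -
  have "A \<in> sets (restrict_space borel (sphere (0::'a) 1))"
    using assms by (auto simp: sets_restrict_space_iff)
  moreover have "sgn -` A \<inter> (ball (0::'a) 1 - {0}) = {x. 0 < norm x \<and> norm x < 1 \<and> sgn x \<in> A}"
    by auto
  moreover have "{x. 0 < norm x \<and> norm x < 1 \<and> sgn x \<in> A} \<subseteq> ball (0::'a) 1 - {0}"
    by auto
  ultimately show ?thesis
    unfolding sphere_measure_def
    by (simp add: emeasure_distr[OF sgn_measurable_sphere] space_restrict_space
        emeasure_restrict_space)
qed

definition Linfty :: "'a measure \<Rightarrow> ('a \<Rightarrow> real) set" where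
  "Linfty M = {f. f \<in> borel_measurable M \<and> (\<exists>B. AE x in M. \<bar>f x\<bar> \<le> B)}"

text \<open>\<open>g\<close> is the distributional derivative \<open>\<partial>\<^sub>r f\<close> on \<open>(0,\<infinity>) \<times> S\<^sup>n\<^sup>-\<^sup>1\<close>, and both \<open>f\<close> and \<open>g\<close> are in
  \<open>L\<^sup>\<infinity>\<close>. Polar coordinates identify \<open>(0,\<infinity>) \<times> S\<^sup>n\<^sup>-\<^sup>1\<close> with \<open>\<real>\<^sup>n - {0}\<close>, so the test functions are
  \<open>(r, \<omega>) \<mapsto> \<psi> (r \<omega>)\<close> with \<open>\<psi>\<close> smooth and compactly supported in \<open>\<real>\<^sup>n - {0}\<close>.\<close>

definition has_radial_derivative ::
    "(real \<times> 'a::euclidean_space \<Rightarrow> real) \<Rightarrow> (real \<times> 'a \<Rightarrow> real) \<Rightarrow> bool" where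
  "has_radial_derivative f g \<longleftrightarrow>
     f \<in> Linfty polar_measure \<and> g \<in> Linfty polar_measure \<and>
     (\<forall>\<psi> :: 'a \<Rightarrow> real. \<psi> \<in> Cc_infinity \<and> 0 \<notin> supp \<psi> \<longrightarrow>
        (\<integral>(r, \<omega>). f (r, \<omega>) * deriv (\<lambda>s. \<psi> (s *\<^sub>R \<omega>)) r \<partial>polar_measure) =
        - (\<integral>(r, \<omega>). g (r, \<omega>) * \<psi> (r *\<^sub>R \<omega>) \<partial>polar_measure))"


section \<open>The operator, the weights and the norm\<close>

text \<open>\<open>P\<^sub>h = -h\<^sup>2 \<Delta> + V\<^sub>h - E\<close>, with the potential \<open>U = V\<^sub>h\<close> given in polar coordinates.\<close>

definition P_op ::
    "(real \<times> 'a::euclidean_space \<Rightarrow> real) \<Rightarrow> real \<Rightarrow> real \<Rightarrow> ('a \<Rightarrow> complex) \<Rightarrow> 'a \<Rightarrow> complex" where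
  "P_op U E h v x =
     - of_real (h\<^sup>2) * laplacian v x + of_real (U (norm x, sgn x) - E) * v x"

definition w_wt :: "real \<Rightarrow> real \<Rightarrow> real" where
  "w_wt \<delta> r = 1 - (1 + r) powr (- \<delta>)"

definition m_wt :: "real \<Rightarrow> real \<Rightarrow> real" where
  "m_wt \<delta> r = (1 + r\<^sup>2) powr ((1 + \<delta>) / 4)"

definition L2_norm :: "('a::euclidean_space \<Rightarrow> complex) \<Rightarrow> real" where
  "L2_norm f = sqrt (\<integral>x. (cmod (f x))\<^sup>2 \<partial>lborel)"

end

theory Submission
  imports Defs "HOL-Computational_Algebra.Polynomial" "HOL-Real_Asymp.Real_Asymp"
begin

text \<open>
  Put \<open>g = e^(\<phi>/h) v\<close>, \<open>f = e^(\<phi>/h) (P - i \<epsilon>) v\<close> and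
  \<open>D g = r^(-(n - 1)/2) \<partial>\<^sub>r (r^((n - 1)/2) g)\<close>. Away from the origin
  \<open>f = - h\<^sup>2 \<Delta>g + 2 h \<phi>' D g - q g - i \<epsilon> g\<close> with \<open>q = E - V + \<phi>'\<^sup>2 - h \<phi>''\<close>. Pair \<open>f\<close> with
  \<open>2 w D g\<close>. The Laplacian contributes \<open>h\<^sup>2 w' |D g|\<^sup>2\<close> plus \<open>2 w / r - w' \<ge> 0\<close> times the angular energy
  and the Hardy term \<open>(n - 1) (n - 3) / (4 r\<^sup>2) |g|\<^sup>2\<close>, which is nonnegative because \<open>n \<noteq> 2\<close>; the first
  order term is nonnegative because \<open>\<phi>' \<ge> 0\<close>; and \<open>- 2 w q D g \<cdot> g\<close> contributes
  \<open>\<partial>\<^sub>r (w q) |g|\<^sup>2 \<ge> E w' |g|\<^sup>2 / 4\<close>. Hence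
  \<open>h\<^sup>2 \<integral> w' |D g|\<^sup>2 + E / 4 \<integral> w' |g|\<^sup>2 \<le> 2 \<integral> w |f| |D g| + 2 \<epsilon> \<integral> w |g| |D g|\<close>,
  and Young's inequality with \<open>w' \<sim> m\<^sup>-\<^sup>2\<close> removes the \<open>f\<close> term. If \<open>\<epsilon> \<le> h\<close>, the \<open>\<epsilon>\<close> term is handled by
  the elementary bound of \<open>h\<^sup>2 \<integral> |D g|\<^sup>2\<close> by \<open>\<integral> |f|\<^sup>2 + |g|\<^sup>2\<close>; if \<open>\<epsilon> > h\<close>, the claim is trivial since
  \<open>m \<ge> 1\<close>. The angular integration by parts is done with Cartesian vector fields, so polar coordinates
  only enter through the weak derivative of \<open>w q\<close>.
\<close>

section \<open>Smooth functions on open sets\<close>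

text \<open>Nothing forces phi'(0) = 0, so the weight e^(phi/h) may have a kink at the origin. Hence
  g is smooth only on \<open>- {0}\<close>, and for n > 1 both D g and the Laplacian of g may grow
  like 1/|x|. Every integration by parts must therefore justify crossing the origin. In the
  multiplier argument this is done by cutoffs vanishing near 0: their gradients are at most 6/|x|,
  and the fields they meet are small because w(r) <= delta r, which also removes the boundary term
  in dimension 1. The energy bound has no such factor w; it is run on v, which is smooth, with the
  locally Lipschitz weight e^(2 phi/h). The weak derivative of w q can be tested only with functions
  supported off the origin, and against a measure without Jacobian. The test function is therefore a
  cutoff times r^(n-1) |g|^2, and r^(1-n) d_r (r^(n-1) |g|^2) = 2 g . D g. The constant must not
  depend on h. It is built from E, delta, h0, a bound for phi' and a bound for |V_h| common to all h
  in (0, h0].\<close>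

primrec Ck_on :: "nat \<Rightarrow> 'a set \<Rightarrow> ('a::euclidean_space \<Rightarrow> 'b::real_normed_vector) \<Rightarrow> bool" where
  "Ck_on 0 S f \<longleftrightarrow> continuous_on S f"
| "Ck_on (Suc k) S f \<longleftrightarrow> (\<forall>x\<in>S. f differentiable (at x)) \<and> (\<forall>u. Ck_on k S (dir_deriv u f))"

text \<open>Derivatives in \<open>Ck_on\<close> are taken \<open>at x\<close>, not within S, so the
  notion is meant for open S. The set that matters is \<open>- {0}\<close>, where radial functions
  are smooth; at the origin itself a function may then be arbitrary.\<close>

definition smooth_on :: "'a set \<Rightarrow> ('a::euclidean_space \<Rightarrow> 'b::real_normed_vector) \<Rightarrow> bool" where
  "smooth_on S f \<longleftrightarrow> (\<forall>k. Ck_on k S f)"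

lemma Ck_eq_Ck_on_UNIV: "Ck k f \<longleftrightarrow> Ck_on k UNIV f"
  by (induction k arbitrary: f) auto

lemma smooth_eq_smooth_on_UNIV: "smooth f \<longleftrightarrow> smooth_on UNIV f"
  by (simp add: smooth_def smooth_on_def Ck_eq_Ck_on_UNIV)

lemma differentiable_at_imp_continuous_on:
  "(\<And>x. x \<in> S \<Longrightarrow> f differentiable (at x)) \<Longrightarrow> continuous_on S f"
  by (simp add: continuous_at_imp_continuous_on differentiable_imp_continuous_within)

lemma Ck_on_imp_continuous_on: "Ck_on k S f \<Longrightarrow> continuous_on S f"
  by (cases k) (simp_all add: differentiable_at_imp_continuous_on)

lemma Ck_on_SucD: "Ck_on (Suc k) S f \<Longrightarrow> Ck_on k S f"
proof (induction k arbitrary: f)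
  case 0
  then show ?case using Ck_on_imp_continuous_on[of "Suc 0" S f] by simp
next
  case (Suc k)
  then show ?case by simp
qed

lemma Ck_on_subset: "Ck_on k S f \<Longrightarrow> T \<subseteq> S \<Longrightarrow> Ck_on k T f"
  by (induction k arbitrary: f) (auto intro: continuous_on_subset)

text \<open>Smoothness is local. This glues a function known to be smooth off the origin to one that
  vanishes near it.\<close>

lemma Ck_on_Un:
  assumes "open S" "open T" "Ck_on k S f" "Ck_on k T f"
  shows "Ck_on k (S \<union> T) f"
  using assms(3,4)
proof (induction k arbitrary: f)
  case 0
  then show ?case using continuous_on_open_Un[OF assms(1,2), of f] by simp
next
  case (Suc k)
  then show ?case by (simp add: ball_Un)
qed

lemma has_derivative_cong_open:
  assumes "open S" "x \<in> S" "\<And>y. y \<in> S \<Longrightarrow> f y = g y"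
  shows "(f has_derivative D) (at x) \<longleftrightarrow> (g has_derivative D) (at x)"
  using has_derivative_transform_within_open[of f D x UNIV S g, OF _ assms]
    has_derivative_transform_within_open[of g D x UNIV S f, OF _ assms(1,2)] assms(3)
  by (intro iffI) simp_all

lemma dir_deriv_cong:
  assumes "open S" "x \<in> S" "\<And>y. y \<in> S \<Longrightarrow> f y = g y"
  shows "dir_deriv u f x = dir_deriv u g x"
  unfolding dir_deriv_def frechet_derivative_def
  using has_derivative_cong_open[OF assms] by simp

lemma Ck_on_cong:
  assumes "open S" "\<And>x. x \<in> S \<Longrightarrow> f x = g x"
  shows "Ck_on k S f \<longleftrightarrow> Ck_on k S g"
  using assms(2)
proof (induction k arbitrary: f g)
  case 0
  then show ?case by (auto intro: continuous_on_cong)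
next
  case (Suc k)
  have "f differentiable (at x) \<longleftrightarrow> g differentiable (at x)" if "x \<in> S" for x
    unfolding differentiable_def using has_derivative_cong_open[OF \<open>open S\<close> that Suc.prems] by simp
  moreover have "Ck_on k S (dir_deriv u f) \<longleftrightarrow> Ck_on k S (dir_deriv u g)" for u
    by (rule Suc.IH) (rule dir_deriv_cong[OF \<open>open S\<close> _ Suc.prems])
  ultimately show ?case by auto
qed

section \<open>Rules for directional derivatives\<close>

lemma dir_deriv_eqI: "(f has_derivative D) (at x) \<Longrightarrow> dir_deriv u f x = D u"
  by (metis dir_deriv_def frechet_derivative_at)

lemma has_derivative_dir_deriv:
  "f differentiable (at x) \<Longrightarrow> (f has_derivative (\<lambda>u. dir_deriv u f x)) (at x)"
  unfolding dir_deriv_def by (simp add: frechet_derivative_works)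

lemma differentiableI: "(f has_derivative D) F \<Longrightarrow> f differentiable F"
  unfolding differentiable_def by blast

lemma linear_dir_deriv: "f differentiable (at x) \<Longrightarrow> linear (\<lambda>u. dir_deriv u f x)"
  using has_derivative_dir_deriv has_derivative_linear by blast

lemma dir_deriv_sum_Basis:
  assumes "f differentiable (at x)"
  shows "dir_deriv u f x = (\<Sum>b\<in>Basis. (u \<bullet> b) *\<^sub>R dir_deriv b f x)"
proof -
  interpret linear "\<lambda>u. dir_deriv u f x" by (rule linear_dir_deriv[OF assms])
  have "dir_deriv u f x = dir_deriv (\<Sum>b\<in>Basis. (u \<bullet> b) *\<^sub>R b) f x"
    by (simp add: euclidean_representation)
  also have "\<dots> = (\<Sum>b\<in>Basis. (u \<bullet> b) *\<^sub>R dir_deriv b f x)"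
    by (simp add: sum scale)
  finally show ?thesis .
qed

lemma dir_deriv_const [simp]: "dir_deriv u (\<lambda>_. c) x = 0"
  by (rule dir_deriv_eqI[where D = "\<lambda>_. 0"]) auto

lemma dir_deriv_bounded_linear:
  assumes "bounded_linear L" "f differentiable (at x)"
  shows "dir_deriv u (\<lambda>x. L (f x)) x = L (dir_deriv u f x)"
  by (rule dir_deriv_eqI)
    (rule bounded_linear.has_derivative[OF assms(1) has_derivative_dir_deriv[OF assms(2)]])

lemma dir_deriv_add:
  "f differentiable (at x) \<Longrightarrow> g differentiable (at x) \<Longrightarrow>
    dir_deriv u (\<lambda>x. f x + g x) x = dir_deriv u f x + dir_deriv u g x"
  by (rule dir_deriv_eqI) (intro has_derivative_add has_derivative_dir_deriv)

lemma dir_deriv_sum: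
  "(\<And>i. i \<in> I \<Longrightarrow> f i differentiable (at x)) \<Longrightarrow>
    dir_deriv u (\<lambda>x. \<Sum>i\<in>I. f i x) x = (\<Sum>i\<in>I. dir_deriv u (f i) x)"
  by (rule dir_deriv_eqI) (intro has_derivative_sum has_derivative_dir_deriv, auto)

lemma dir_deriv_bilinear:
  assumes "bounded_bilinear p" "f differentiable (at x)" "g differentiable (at x)"
  shows "dir_deriv u (\<lambda>x. p (f x) (g x)) x = p (f x) (dir_deriv u g x) + p (dir_deriv u f x) (g x)"
  by (rule dir_deriv_eqI)
    (rule bounded_bilinear.FDERIV[OF assms(1) has_derivative_dir_deriv[OF assms(2)]
      has_derivative_dir_deriv[OF assms(3)]])

lemmas dir_deriv_mult = dir_deriv_bilinear[OF bounded_bilinear_mult]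
lemmas dir_deriv_scaleR = dir_deriv_bilinear[OF bounded_bilinear_scaleR]
lemmas dir_deriv_inner = dir_deriv_bilinear[OF bounded_bilinear_inner]

lemma dir_deriv_compose:
  fixes f :: "'a::euclidean_space \<Rightarrow> real"
  assumes "f differentiable (at x)" "(h has_vector_derivative h') (at (f x))"
  shows "dir_deriv u (\<lambda>x. h (f x)) x = dir_deriv u f x *\<^sub>R h'"
proof (rule dir_deriv_eqI)
  show "((\<lambda>x. h (f x)) has_derivative (\<lambda>u. dir_deriv u f x *\<^sub>R h')) (at x)"
    using has_derivative_compose[OF has_derivative_dir_deriv[OF assms(1)]
        assms(2)[unfolded has_vector_derivative_def]] .
qed

section \<open>Stability of C^k under linear maps, products and composition\<close>

lemma Ck_on_const [simp]: "Ck_on k S (\<lambda>_::'a::euclidean_space. c)"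
proof (induction k arbitrary: c)
  case (Suc k)
  have "dir_deriv u (\<lambda>_::'a. c) = (\<lambda>_. 0)" for u by auto
  with Suc show ?case by simp
qed simp

lemma Ck_on_bounded_linear:
  assumes "open S" "bounded_linear L"
  shows "Ck_on k S f \<Longrightarrow> Ck_on k S (\<lambda>x. L (f x))"
proof (induction k arbitrary: f)
  case 0
  then show ?case using bounded_linear.continuous_on[OF assms(2)] by auto
next
  case (Suc k)
  have "(\<lambda>x. L (f x)) differentiable (at x)" if "x \<in> S" for x
    using bounded_linear.has_derivative[OF assms(2) has_derivative_dir_deriv[of f x]] Suc.prems that
    by (auto intro: differentiableI)
  moreover have "Ck_on k S (dir_deriv u (\<lambda>x. L (f x)))" for u
  proof -
    have "Ck_on k S (\<lambda>x. L (dir_deriv u f x))"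
      using Suc by auto
    then show ?thesis
      using Suc.prems by (subst Ck_on_cong[OF \<open>open S\<close>]) (auto simp: dir_deriv_bounded_linear[OF assms(2)])
  qed
  ultimately show ?case by auto
qed

lemma Ck_on_add:
  assumes "open S"
  shows "Ck_on k S f \<Longrightarrow> Ck_on k S g \<Longrightarrow> Ck_on k S (\<lambda>x. f x + g x)"
proof (induction k arbitrary: f g)
  case 0
  then show ?case by (auto intro: continuous_intros)
next
  case (Suc k)
  have "Ck_on k S (dir_deriv u (\<lambda>x. f x + g x))" for u
  proof -
    have "Ck_on k S (\<lambda>x. dir_deriv u f x + dir_deriv u g x)"
      using Suc by auto
    then show ?thesis
      using Suc.prems by (subst Ck_on_cong[OF \<open>open S\<close>]) (auto simp: dir_deriv_add)
  qed
  then show ?case using Suc.prems by auto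
qed

lemma Ck_on_bilinear:
  assumes "open S" "bounded_bilinear p"
  shows "Ck_on k S f \<Longrightarrow> Ck_on k S g \<Longrightarrow> Ck_on k S (\<lambda>x. p (f x) (g x))"
proof (induction k arbitrary: f g)
  case 0
  then show ?case using bounded_bilinear.continuous_on[OF assms(2)] by auto
next
  case (Suc k)
  have "(\<lambda>x. p (f x) (g x)) differentiable (at x)" if "x \<in> S" for x
    using bounded_bilinear.FDERIV[OF assms(2) has_derivative_dir_deriv[of f x]
        has_derivative_dir_deriv[of g x]] Suc.prems that by (auto intro: differentiableI)
  moreover have "Ck_on k S (dir_deriv u (\<lambda>x. p (f x) (g x)))" for u
  proof -
    have "Ck_on k S (\<lambda>x. p (f x) (dir_deriv u g x) + p (dir_deriv u f x) (g x))"
      using Suc Ck_on_SucD[OF Suc.prems(1)] Ck_on_SucD[OF Suc.prems(2)]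
      by (intro Ck_on_add[OF \<open>open S\<close>] Suc.IH) auto
    then show ?thesis
      using Suc.prems by (subst Ck_on_cong[OF \<open>open S\<close>]) (auto simp: dir_deriv_bilinear[OF assms(2)])
  qed
  ultimately show ?case by auto
qed

lemma dir_deriv_real: "dir_deriv u (h :: real \<Rightarrow> 'b::real_normed_vector) t = u *\<^sub>R dir_deriv 1 h t"
  if "h differentiable (at t)"
  using linear_scale[OF linear_dir_deriv[OF that], of u 1] by simp

lemma has_vector_derivative_dir_deriv:
  "(h :: real \<Rightarrow> 'b::real_normed_vector) differentiable (at t) \<Longrightarrow>
    (h has_vector_derivative dir_deriv 1 h t) (at t)"
  unfolding has_vector_derivative_def
  by (rule has_derivative_eq_rhs[OF has_derivative_dir_deriv]) (auto intro: dir_deriv_real)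

text \<open>The derivative of the composition is
  \<open>dir_deriv u f x *\<^sub>R dir_deriv 1 h (f x)\<close>, whose second factor is again a
  composition with the same f. The induction therefore varies h and keeps f fixed; a real-valued f
  keeps the chain rule a product.\<close>

lemma Ck_on_compose:
  fixes f :: "'a::euclidean_space \<Rightarrow> real"
  assumes "open S" "open T" "f ` S \<subseteq> T"
  shows "Ck_on k S f \<Longrightarrow> Ck_on k T h \<Longrightarrow> Ck_on k S (\<lambda>x. h (f x))"
proof (induction k arbitrary: h)
  case 0
  then show ?case using continuous_on_compose2[of T h S f] assms by auto
next
  case (Suc k)
  have hd: "(h has_vector_derivative dir_deriv 1 h (f x)) (at (f x))" if "x \<in> S" for x
    using Suc.prems that assms(3) by (intro has_vector_derivative_dir_deriv) auto
  have "(\<lambda>x. h (f x)) differentiable (at x)" if "x \<in> S" for x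
    using has_derivative_compose[OF has_derivative_dir_deriv[of f x]
        hd[OF that, unfolded has_vector_derivative_def]] Suc.prems that by (auto intro: differentiableI)
  moreover have "Ck_on k S (dir_deriv u (\<lambda>x. h (f x)))" for u
  proof -
    have "Ck_on k S (\<lambda>x. dir_deriv u f x *\<^sub>R dir_deriv 1 h (f x))"
      using Suc Ck_on_SucD[OF Suc.prems(1)]
      by (intro Ck_on_bilinear[OF \<open>open S\<close> bounded_bilinear_scaleR] Suc.IH) auto
    then show ?thesis
      using Suc.prems by (subst Ck_on_cong[OF \<open>open S\<close>]) (auto intro!: dir_deriv_compose hd)
  qed
  ultimately show ?case by auto
qed

text \<open>If each member of a sequence is the derivative of the one before, differentiation only
  shifts the index. This covers exp, real powers, the flat functions and the iterated half-line
  derivatives without a separate induction for each.\<close>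

lemma Ck_on_real_sequence:
  fixes F :: "nat \<Rightarrow> real \<Rightarrow> 'b::real_normed_vector"
  assumes "open S" "\<And>j t. t \<in> S \<Longrightarrow> (F j has_vector_derivative F (Suc j) t) (at t)"
  shows "Ck_on k S (F j)"
proof (induction k arbitrary: j)
  case 0
  have "F j differentiable (at t)" if "t \<in> S" for t
    using assms(2)[OF that, of j] by (auto simp: has_vector_derivative_def differentiable_def)
  then show ?case
    by (simp add: differentiable_at_imp_continuous_on)
next
  case (Suc k)
  have "F j differentiable (at t)" if "t \<in> S" for t
    using assms(2)[OF that, of j] by (auto simp: has_vector_derivative_def differentiable_def)
  moreover have "Ck_on k S (dir_deriv u (F j))" for u
  proof -
    have "dir_deriv u (F j) t = u *\<^sub>R F (Suc j) t" if "t \<in> S" for t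
      using assms(2)[OF that, of j] unfolding has_vector_derivative_def by (rule dir_deriv_eqI)
    moreover have "Ck_on k S (\<lambda>t. u *\<^sub>R F (Suc j) t)"
      by (rule Ck_on_bounded_linear[OF \<open>open S\<close> bounded_linear_scaleR_right Suc])
    ultimately show ?thesis
      by (subst Ck_on_cong[OF \<open>open S\<close>]) auto
  qed
  ultimately show ?case by auto
qed

section \<open>Closure properties of smooth functions\<close>

named_theorems smooth_intros

lemma smooth_on_differentiable: "smooth_on S f \<Longrightarrow> x \<in> S \<Longrightarrow> f differentiable (at x)"
  unfolding smooth_on_def by (drule spec[of _ "Suc 0"]) simp

lemma smooth_on_continuous_on: "smooth_on S f \<Longrightarrow> continuous_on S f"
  unfolding smooth_on_def by (drule spec[of _ 0]) simp

lemma smooth_on_dir_deriv [smooth_intros]: "smooth_on S f \<Longrightarrow> smooth_on S (dir_deriv u f)"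
  unfolding smooth_on_def
proof
  fix k assume "\<forall>k. Ck_on k S f"
  then have "Ck_on (Suc k) S f" ..
  then show "Ck_on k S (dir_deriv u f)" by simp
qed

lemma smooth_on_subset: "smooth_on S f \<Longrightarrow> T \<subseteq> S \<Longrightarrow> smooth_on T f"
  unfolding smooth_on_def by (simp add: Ck_on_subset[of _ S f T])

lemma smooth_on_cong:
  "open S \<Longrightarrow> (\<And>x. x \<in> S \<Longrightarrow> f x = g x) \<Longrightarrow> smooth_on S f \<longleftrightarrow> smooth_on S g"
  unfolding smooth_on_def by (simp add: Ck_on_cong[of S f g])

lemma smooth_on_Un:
  "open S \<Longrightarrow> open T \<Longrightarrow> smooth_on S f \<Longrightarrow> smooth_on T f \<Longrightarrow> smooth_on (S \<union> T) f"
  unfolding smooth_on_def by (simp add: Ck_on_Un)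

lemma smooth_on_const [smooth_intros]: "smooth_on S (\<lambda>_. c)"
  unfolding smooth_on_def by simp

lemma smooth_on_bounded_linear:
  "open S \<Longrightarrow> bounded_linear L \<Longrightarrow> smooth_on S f \<Longrightarrow> smooth_on S (\<lambda>x. L (f x))"
  unfolding smooth_on_def by (simp add: Ck_on_bounded_linear[of S L])

lemma smooth_on_add [smooth_intros]:
  "open S \<Longrightarrow> smooth_on S f \<Longrightarrow> smooth_on S g \<Longrightarrow> smooth_on S (\<lambda>x. f x + g x)"
  unfolding smooth_on_def by (simp add: Ck_on_add)

lemma smooth_on_minus [smooth_intros]:
  "open S \<Longrightarrow> smooth_on S f \<Longrightarrow> smooth_on S (\<lambda>x. - f x)"
  by (rule smooth_on_bounded_linear[OF _ bounded_linear_minus[OF bounded_linear_ident]])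

lemma smooth_on_diff [smooth_intros]:
  "open S \<Longrightarrow> smooth_on S f \<Longrightarrow> smooth_on S g \<Longrightarrow> smooth_on S (\<lambda>x. f x - g x)"
  using smooth_on_add[of S f "\<lambda>x. - g x"] smooth_on_minus[of S g] by simp

lemma smooth_on_mult [smooth_intros]:
  fixes f g :: "'a::euclidean_space \<Rightarrow> 'b::real_normed_algebra"
  shows "open S \<Longrightarrow> smooth_on S f \<Longrightarrow> smooth_on S g \<Longrightarrow> smooth_on S (\<lambda>x. f x * g x)"
  unfolding smooth_on_def by (simp add: Ck_on_bilinear[OF _ bounded_bilinear_mult])

lemma smooth_on_scaleR [smooth_intros]:
  "open S \<Longrightarrow> smooth_on S f \<Longrightarrow> smooth_on S g \<Longrightarrow> smooth_on S (\<lambda>x. f x *\<^sub>R g x)"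
  unfolding smooth_on_def by (simp add: Ck_on_bilinear[OF _ bounded_bilinear_scaleR])

lemma smooth_on_inner [smooth_intros]:
  "open S \<Longrightarrow> smooth_on S f \<Longrightarrow> smooth_on S g \<Longrightarrow> smooth_on S (\<lambda>x. f x \<bullet> g x)"
  unfolding smooth_on_def by (simp add: Ck_on_bilinear[OF _ bounded_bilinear_inner])

lemma smooth_on_sum [smooth_intros]:
  assumes "open S" "\<And>i. i \<in> I \<Longrightarrow> smooth_on S (f i)"
  shows "smooth_on S (\<lambda>x. \<Sum>i\<in>I. f i x)"
  using assms(2) by (induction I rule: infinite_finite_induct) (auto intro!: smooth_on_const smooth_on_add assms(1))

lemma smooth_on_compose:
  fixes f :: "'a::euclidean_space \<Rightarrow> real"
  shows "open S \<Longrightarrow> open T \<Longrightarrow> f ` S \<subseteq> T \<Longrightarrow> smooth_on S f \<Longrightarrow> smooth_on T h \<Longrightarrow>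
    smooth_on S (\<lambda>x. h (f x))"
  unfolding smooth_on_def by (simp add: Ck_on_compose[of S T f])

lemma smooth_on_ident [smooth_intros]: "smooth_on S (\<lambda>x. x)"
proof -
  have "Ck_on k S (\<lambda>x. x)" for k
  proof (cases k)
    case (Suc j)
    have "dir_deriv u (\<lambda>x::'a. x) = (\<lambda>_. u)" for u
      by (rule ext, rule dir_deriv_eqI) (rule has_derivative_ident)
    with Suc show ?thesis by simp
  qed auto
  then show ?thesis unfolding smooth_on_def by simp
qed

lemma smooth_on_real_sequence:
  fixes F :: "nat \<Rightarrow> real \<Rightarrow> 'b::real_normed_vector"
  assumes "open S" "\<And>j t. t \<in> S \<Longrightarrow> (F j has_vector_derivative F (Suc j) t) (at t)"
  shows "smooth_on S (F j)"
  unfolding smooth_on_def by (intro allI Ck_on_real_sequence[of S F] assms)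

lemma smooth_on_exp: "smooth_on S (exp :: real \<Rightarrow> real)"
proof (rule smooth_on_subset)
  show "smooth_on UNIV (exp :: real \<Rightarrow> real)"
    using smooth_on_real_sequence[of UNIV "\<lambda>j. exp :: real \<Rightarrow> real"]
    by (auto simp flip: has_real_derivative_iff_has_vector_derivative intro: DERIV_exp)
qed simp

lemma smooth_on_powr: "smooth_on {0<..} (\<lambda>t::real. t powr c)"
proof -
  \<comment> \<open>The j-th derivative of t^c, with its falling factorial coefficient.\<close>
  define F where "F = (\<lambda>j t. (\<Prod>i<j. c - real i) * t powr (c - real j))"
  have "(F j has_vector_derivative F (Suc j) t) (at t)" if "t \<in> {0<..}" for j t
    unfolding F_def has_real_derivative_iff_has_vector_derivative[symmetric]
    using that by (auto intro!: derivative_eq_intros simp: algebra_simps)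
  from smooth_on_real_sequence[of "{0<..}" F 0, OF _ this]
  show ?thesis by (simp add: F_def)
qed

lemma smooth_on_norm_compose:
  fixes h :: "real \<Rightarrow> 'b::real_normed_vector"
  assumes "smooth_on {0<..} h"
  shows "smooth_on (- {0}) (\<lambda>x::'a::euclidean_space. h (norm x))"
proof -
  \<comment> \<open>The norm is the square root of the polynomial x . x, which is positive off the
    origin.\<close>
  have "smooth_on (- {0}) (\<lambda>x::'a. (x \<bullet> x) powr (1/2))"
    by (rule smooth_on_compose[OF _ open_greaterThan _ _ smooth_on_powr]) (auto intro!: smooth_intros)
  then have "smooth_on (- {0}) (\<lambda>x::'a. norm x)"
    by (simp add: norm_eq_sqrt_inner powr_half_sqrt)
  then show ?thesis
    using smooth_on_compose[OF _ open_greaterThan _ _ assms, of "- {0}" "norm :: 'a \<Rightarrow> real"]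
    by (simp add: image_subset_iff open_Compl)
qed

lemma dir_deriv_norm_compose:
  assumes "x \<noteq> (0::'a::euclidean_space)" "(h has_vector_derivative h') (at (norm x))"
  shows "dir_deriv u (\<lambda>x. h (norm x)) x = ((x \<bullet> u) / norm x) *\<^sub>R h'"
proof -
  have n: "(norm has_derivative (\<lambda>u. u \<bullet> sgn x)) (at x)"
    using assms(1) by (rule has_derivative_norm)
  then have "dir_deriv u norm x = (x \<bullet> u) / norm x"
    by (simp add: dir_deriv_eqI sgn_div_norm inner_commute divide_inverse)
  then show ?thesis
    using dir_deriv_compose[of norm x h h' u] n assms(2) by (auto simp: differentiable_def)
qed

section \<open>Restriction to lines and symmetry of second derivatives\<close>

lemma line_has_vector_derivative:
  assumes "f differentiable (at (x + s *\<^sub>R b))"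
  shows "((\<lambda>s. f (x + s *\<^sub>R b)) has_vector_derivative dir_deriv b f (x + s *\<^sub>R b)) (at s)"
proof -
  have "((\<lambda>s. x + s *\<^sub>R b) has_derivative (\<lambda>t. t *\<^sub>R b)) (at s)"
    by (auto intro!: derivative_eq_intros)
  from has_derivative_compose[OF this has_derivative_dir_deriv[OF assms]]
  show ?thesis
    unfolding has_vector_derivative_def
    by (rule has_derivative_eq_rhs)
      (auto simp: linear_scale[OF linear_dir_deriv[OF assms]])
qed

text \<open>Both orders of differentiation come from the same second difference of \<open>f\<close> along \<open>a\<close> and \<open>b\<close>,
  which is \<open>s\<^sup>2\<close> times either mixed derivative at some nearby point.\<close>

lemma dir_deriv_second_difference:
  fixes f :: "'a::euclidean_space \<Rightarrow> real"
  assumes f: "\<And>y. y \<in> ball x d \<Longrightarrow> f differentiable (at y)"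
    "\<And>y. y \<in> ball x d \<Longrightarrow> dir_deriv a f differentiable (at y)"
    and s: "0 < s" "s * (norm a + norm b) < d"
  shows "\<exists>y\<in>cball x (s * (norm a + norm b)).
    f (x + s *\<^sub>R a + s *\<^sub>R b) - f (x + s *\<^sub>R a) - f (x + s *\<^sub>R b) + f x = s\<^sup>2 * dir_deriv b (dir_deriv a f) y"
proof -
  have near: "x + p *\<^sub>R a + q *\<^sub>R b \<in> cball x (s * (norm a + norm b))"
    if "0 \<le> p" "p \<le> s" "0 \<le> q" "q \<le> s" for p q
  proof -
    have "norm (p *\<^sub>R a + q *\<^sub>R b) \<le> p * norm a + q * norm b"
      using norm_triangle_ineq[of "p *\<^sub>R a" "q *\<^sub>R b"] that by simp
    also have "\<dots> \<le> s * norm a + s * norm b"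
      using that by (intro add_mono mult_right_mono) auto
    finally show ?thesis
      by (simp add: dist_norm norm_minus_commute algebra_simps)
  qed
  then have near': "x + p *\<^sub>R a + q *\<^sub>R b \<in> ball x d" if "0 \<le> p" "p \<le> s" "0 \<le> q" "q \<le> s" for p q
    using s that by (fastforce simp: dist_norm)
  define F where "F = (\<lambda>p. f (x + s *\<^sub>R b + p *\<^sub>R a) - f (x + p *\<^sub>R a))"
  have F': "(F has_real_derivative (dir_deriv a f (x + s *\<^sub>R b + p *\<^sub>R a) - dir_deriv a f (x + p *\<^sub>R a))) (at p)"
    if "0 \<le> p" "p \<le> s" for p
    unfolding F_def has_real_derivative_iff_has_vector_derivative
    using near'[of p s] near'[of p 0] that s
    by (intro has_vector_derivative_diff line_has_vector_derivative f) (auto simp: algebra_simps)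
  \<comment> \<open>F is the increment of f along b as a function of the position p along a. The
    mean value theorem is applied to it in p, and then in q to the derivative of f along a.\<close>
  obtain p where p: "0 < p" "p < s"
    "F s - F 0 = (s - 0) * (dir_deriv a f (x + s *\<^sub>R b + p *\<^sub>R a) - dir_deriv a f (x + p *\<^sub>R a))"
    using MVT2[OF \<open>0 < s\<close> F'] by blast
  have G': "((\<lambda>q. dir_deriv a f (x + p *\<^sub>R a + q *\<^sub>R b)) has_real_derivative
      dir_deriv b (dir_deriv a f) (x + p *\<^sub>R a + q *\<^sub>R b)) (at q)" if "0 \<le> q" "q \<le> s" for q
    unfolding has_real_derivative_iff_has_vector_derivative
    using near'[of p q] that s p by (intro line_has_vector_derivative f) auto
  obtain q where q: "0 < q" "q < s"
    "dir_deriv a f (x + p *\<^sub>R a + s *\<^sub>R b) - dir_deriv a f (x + p *\<^sub>R a + 0 *\<^sub>R b) =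
      (s - 0) * dir_deriv b (dir_deriv a f) (x + p *\<^sub>R a + q *\<^sub>R b)"
    using MVT2[OF \<open>0 < s\<close> G'] by blast
  have "F s - F 0 = s\<^sup>2 * dir_deriv b (dir_deriv a f) (x + p *\<^sub>R a + q *\<^sub>R b)"
    using p(3) q(3) by (simp add: algebra_simps power2_eq_square)
  moreover have "F s - F 0 = f (x + s *\<^sub>R a + s *\<^sub>R b) - f (x + s *\<^sub>R a) - f (x + s *\<^sub>R b) + f x"
    by (simp add: F_def algebra_simps)
  ultimately show ?thesis
    using near[of p q] p q by force
qed

lemma dir_deriv_commute_real:
  fixes f :: "'a::euclidean_space \<Rightarrow> real"
  assumes "open S" "smooth_on S f" "x \<in> S"
  shows "dir_deriv a (dir_deriv b f) x = dir_deriv b (dir_deriv a f) x"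
proof -
  obtain d where d: "d > 0" "ball x d \<subseteq> S"
    using assms openE by blast
  \<comment> \<open>The summand 1 keeps L positive when a = b = 0, and the index
    \<open>Suc (Suc k)\<close> makes the factor strictly less than 1, as the strict bound in the
    second difference requires.\<close>
  define L where "L = norm a + norm b + 1"
  define s where "s = (\<lambda>k. d / L * inverse (real (Suc (Suc k))))"
  have L: "L > 0" "norm a + norm b \<le> L" by (auto simp: L_def add_nonneg_pos)
  have s: "s k > 0" "s k * (norm a + norm b) < d" for k
  proof -
    show "s k > 0" using d L by (simp add: s_def)
    then have "s k * (norm a + norm b) \<le> s k * L" using L by simp
    also have "\<dots> = d * inverse (real (Suc (Suc k)))" using L by (simp add: s_def)
    also have "\<dots> < d * 1" using d by (intro mult_strict_left_mono) (auto simp: field_simps)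
    finally show "s k * (norm a + norm b) < d" by simp
  qed
  have s0: "s \<longlonglongrightarrow> d / L * 0"
    unfolding s_def
    by (rule tendsto_mult[OF tendsto_const LIMSEQ_Suc[OF LIMSEQ_inverse_real_of_nat]])
  have diff: "f differentiable (at y)" "dir_deriv u f differentiable (at y)" if "y \<in> ball x d" for y u
    using that d assms by (auto intro!: smooth_on_differentiable[of S] smooth_intros)
  \<comment> \<open>Stated for any pair with the same norm sum, so that it serves both (a, b) and
    (b, a); the second difference on the left is symmetric in the two directions.\<close>
  have "\<exists>y. \<forall>k. y k \<in> cball x (s k * (norm u + norm v)) \<and>
      f (x + s k *\<^sub>R u + s k *\<^sub>R v) - f (x + s k *\<^sub>R u) - f (x + s k *\<^sub>R v) + f x
       = (s k)\<^sup>2 * dir_deriv v (dir_deriv u f) (y k)" if "norm u + norm v = norm a + norm b" for u v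
  proof (intro choice allI)
    fix k
    show "\<exists>y. y \<in> cball x (s k * (norm u + norm v)) \<and>
        f (x + s k *\<^sub>R u + s k *\<^sub>R v) - f (x + s k *\<^sub>R u) - f (x + s k *\<^sub>R v) + f x
         = (s k)\<^sup>2 * dir_deriv v (dir_deriv u f) y"
      using dir_deriv_second_difference[of x d f u "s k" v, OF diff(1) diff(2)] s[of k] that
      unfolding Bex_def by auto
  qed
  note * = this
  from *[of a b, OF refl] obtain y where y: "y k \<in> cball x (s k * (norm a + norm b))"
    "f (x + s k *\<^sub>R a + s k *\<^sub>R b) - f (x + s k *\<^sub>R a) - f (x + s k *\<^sub>R b) + f x
       = (s k)\<^sup>2 * dir_deriv b (dir_deriv a f) (y k)" for k by blast
  from *[of b a, OF add.commute] obtain z where z: "z k \<in> cball x (s k * (norm b + norm a))"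
    "f (x + s k *\<^sub>R b + s k *\<^sub>R a) - f (x + s k *\<^sub>R b) - f (x + s k *\<^sub>R a) + f x
       = (s k)\<^sup>2 * dir_deriv a (dir_deriv b f) (z k)" for k by blast
  have lim: "y \<longlonglongrightarrow> x" if "\<And>k. y k \<in> cball x (s k * (norm a + norm b))" for y
  proof -
    have "(\<lambda>k. s k * (norm a + norm b)) \<longlonglongrightarrow> d / L * 0 * (norm a + norm b)"
      by (rule tendsto_mult[OF s0 tendsto_const])
    then have *: "(\<lambda>k. s k * (norm a + norm b)) \<longlonglongrightarrow> 0" by simp
    have "(\<lambda>k. dist (y k) x) \<longlonglongrightarrow> 0"
      by (rule Lim_null_comparison[OF _ *]) (use that in \<open>simp add: dist_commute\<close>)
    then show ?thesis
      by (rule tendsto_dist_iff[THEN iffD2])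
  qed
  have "dir_deriv b (dir_deriv a f) (y k) = dir_deriv a (dir_deriv b f) (z k)" for k
  proof -
    have "(s k)\<^sup>2 * dir_deriv b (dir_deriv a f) (y k) = (s k)\<^sup>2 * dir_deriv a (dir_deriv b f) (z k)"
      unfolding y(2)[symmetric] z(2)[symmetric] by (simp add: algebra_simps)
    then show ?thesis using s(1)[of k] by simp
  qed
  moreover have "isCont (dir_deriv u (dir_deriv v f)) x" for u v
    using smooth_on_continuous_on[OF smooth_on_dir_deriv[OF smooth_on_dir_deriv[OF assms(2)]]]
      assms(1,3) by (simp add: continuous_on_eq_continuous_at)
  then have "(\<lambda>k. dir_deriv u (dir_deriv v f) (y k)) \<longlonglongrightarrow> dir_deriv u (dir_deriv v f) x"
    if "y \<longlonglongrightarrow> x" for u v y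
    using that by (rule isCont_tendsto_compose)
  then have "(\<lambda>k. dir_deriv b (dir_deriv a f) (y k)) \<longlonglongrightarrow> dir_deriv b (dir_deriv a f) x"
    "(\<lambda>k. dir_deriv a (dir_deriv b f) (z k)) \<longlonglongrightarrow> dir_deriv a (dir_deriv b f) x"
    using lim[of y] y(1) lim[of z] z(1) by (simp_all add: add.commute)
  ultimately show ?thesis
    using LIMSEQ_unique by simp
qed

text \<open>Each coordinate \<open>f x \<bullet> c\<close> is real-valued, and taking a coordinate
  commutes with differentiation.\<close>

lemma dir_deriv_commute:
  fixes f :: "'a::euclidean_space \<Rightarrow> 'b::euclidean_space"
  assumes "open S" "smooth_on S f" "x \<in> S"
  shows "dir_deriv a (dir_deriv b f) x = dir_deriv b (dir_deriv a f) x"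
proof (rule euclidean_eqI)
  fix c :: 'b assume "c \<in> Basis"
  have bl: "bounded_linear (\<lambda>y::'b. y \<bullet> c)" by (rule bounded_linear_inner_left)
  have comp: "dir_deriv u (\<lambda>x. dir_deriv v (\<lambda>x. f x \<bullet> c) x) x = dir_deriv u (dir_deriv v f) x \<bullet> c" for u v
  proof -
    have "dir_deriv u (\<lambda>x. dir_deriv v (\<lambda>x. f x \<bullet> c) x) x = dir_deriv u (\<lambda>x. dir_deriv v f x \<bullet> c) x"
      using assms by (intro dir_deriv_cong[of S]) (auto intro!: dir_deriv_bounded_linear[OF bl] smooth_on_differentiable)
    also have "\<dots> = dir_deriv u (dir_deriv v f) x \<bullet> c"
      using assms by (intro dir_deriv_bounded_linear[OF bl] smooth_on_differentiable[of S] smooth_intros)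
    finally show ?thesis .
  qed
  show "dir_deriv a (dir_deriv b f) x \<bullet> c = dir_deriv b (dir_deriv a f) x \<bullet> c"
    using dir_deriv_commute_real[OF assms(1) _ assms(3), of "\<lambda>x. f x \<bullet> c" a b]
      smooth_on_bounded_linear[OF assms(1) bl assms(2)] comp[of a b] comp[of b a] by simp
qed

section \<open>A cutoff away from the origin\<close>

text \<open>The classical functions p(1/t) e^(-1/t), extended by 0 to t <= 0. Keeping the polynomial
  p as a parameter makes the family closed under differentiation.\<close>

definition flat :: "real poly \<Rightarrow> real \<Rightarrow> real" where
  "flat p t = (if t > 0 then poly p (1 / t) * exp (- (1 / t)) else 0)"

text \<open>With y = 1/t one has d/dt = - y^2 d/dy, which turns p(y) e^(-y) into y^2 (p(y) - p'(y))
  e^(-y).\<close>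

definition flat_step :: "real poly \<Rightarrow> real poly" where
  "flat_step p = [:0, 0, 1:] * (p - pderiv p)"

lemma poly_exp_tendsto_0: "((\<lambda>y. poly p y * exp (- y)) \<longlongrightarrow> (0::real)) at_top"
proof -
  have "((\<lambda>y. \<Sum>i\<le>degree p. coeff p i * (y ^ i / exp y)) \<longlongrightarrow> (\<Sum>i\<le>degree p. coeff p i * 0)) at_top"
    by (intro tendsto_sum tendsto_mult tendsto_const tendsto_power_div_exp_0)
  then show ?thesis
    by (simp add: poly_altdef sum_distrib_right exp_minus divide_inverse mult.assoc)
qed

lemma flat_tendsto_0: "(flat p \<longlongrightarrow> 0) (at 0)"
proof -
  have "((\<lambda>t. poly p (inverse t) * exp (- inverse t)) \<longlongrightarrow> 0) (at_right 0)"
    by (rule filterlim_compose[OF poly_exp_tendsto_0 filterlim_inverse_at_top_right])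
  moreover have "\<forall>\<^sub>F t in at_right 0. poly p (inverse t) * exp (- inverse t) = flat p t"
    by (auto simp: eventually_at_right_field flat_def inverse_eq_divide intro!: exI[of _ 1])
  ultimately have "(flat p \<longlongrightarrow> 0) (at_right 0)"
    using tendsto_cong by fastforce
  moreover have "\<forall>\<^sub>F t in at_left 0. flat p t = 0"
    by (auto simp: eventually_at_left_field flat_def intro!: exI[of _ "-1"])
  then have "(flat p \<longlongrightarrow> 0) (at_left 0)"
    using tendsto_cong[of "flat p" "\<lambda>_. 0"] by fastforce
  ultimately show ?thesis
    by (simp add: filterlim_split_at_real)
qed

lemma DERIV_flat: "(flat p has_real_derivative flat (flat_step p) t) (at t)"
proof -
  consider "t > 0" | "t = 0" | "t < 0" by linarith
  then show ?thesis
  proof cases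
    case 1
    have "((\<lambda>t. poly p (1 / t) * exp (- (1 / t))) has_real_derivative flat (flat_step p) t) (at t)"
      using 1 by (auto intro!: derivative_eq_intros DERIV_chain2[OF poly_DERIV]
          simp: flat_def flat_step_def field_simps power2_eq_square)
    then show ?thesis
      by (rule has_field_derivative_transform_within_open[of _ _ _ "{0<..}"]) (use 1 in \<open>auto simp: flat_def\<close>)
  next
    case 2
    have "((\<lambda>t. flat p t / t) \<longlongrightarrow> 0) (at 0)"
    proof -
      \<comment> \<open>At 0 the difference quotient is again a flat function, for the polynomial y
        p(y), so its limit is already known.\<close>
      have "flat p t / t = flat ([:0, 1:] * p) t" for t
        by (simp add: flat_def)
      then show ?thesis using flat_tendsto_0 by simp
    qed
    then show ?thesis
      using 2 by (simp add: has_field_derivative_iff flat_def)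
  next
    case 3
    have "((\<lambda>t. 0) has_real_derivative 0) (at t)" by simp
    then have "(flat p has_real_derivative 0) (at t)"
      by (rule has_field_derivative_transform_within_open[of _ _ _ "{..<0}"]) (use 3 in \<open>auto simp: flat_def\<close>)
    then show ?thesis using 3 by (simp add: flat_def)
  qed
qed

lemma smooth_on_flat: "smooth_on UNIV (flat p)"
  using smooth_on_real_sequence[of UNIV "\<lambda>j. flat ((flat_step ^^ j) p)" 0] DERIV_flat
  by (simp add: has_real_derivative_iff_has_vector_derivative)

text \<open>This is exp(- 1 / ((k + 1) |x|^2 - 1)) outside the ball of radius 1 / sqrt (k + 1) and 0
  inside. It is nowhere equal to 1, but it lies in [0, 1] and tends to 1 off the origin, which is
  all that dominated convergence asks. Dependence on (k + 1) |x|^2 alone makes the gradient bound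
  uniform in k.\<close>

definition cutoff :: "nat \<Rightarrow> 'a::euclidean_space \<Rightarrow> real" where
  "cutoff k x = flat 1 (real (Suc k) * (x \<bullet> x) - 1)"

lemma smooth_on_cutoff: "smooth_on UNIV (cutoff k :: 'a::euclidean_space \<Rightarrow> real)"
  unfolding cutoff_def
  by (rule smooth_on_compose[OF open_UNIV open_UNIV _ _ smooth_on_flat]) (auto intro!: smooth_intros)

lemma cutoff_bounds: "0 \<le> cutoff k x" "cutoff k x \<le> 1"
  by (auto simp: cutoff_def flat_def)

lemma cutoff_eq_0: "real (Suc k) * (norm x)\<^sup>2 \<le> 1 \<Longrightarrow> cutoff k x = 0"
  by (simp add: cutoff_def flat_def dot_square_norm)

lemma dir_deriv_cutoff:
  "dir_deriv u (cutoff k) x = 2 * real (Suc k) * (x \<bullet> u) * flat [:0, 0, 1:] (real (Suc k) * (x \<bullet> x) - 1)"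
proof -
  have "((\<lambda>x. real (Suc k) * (x \<bullet> x) - 1) has_derivative (\<lambda>u. real (Suc k) * (2 * (x \<bullet> u)))) (at x)"
    by (auto intro!: derivative_eq_intros simp: inner_commute algebra_simps)
  from has_derivative_compose[OF this DERIV_flat[of 1, unfolded has_field_derivative_def]]
  show ?thesis
    unfolding cutoff_def
    by (rule dir_deriv_eqI[THEN trans]) (simp add: flat_step_def pderiv_1 mult_ac)
qed

text \<open>With t = (k + 1) |x|^2 the gradient of the cutoff is 2 x / |x|^2 times this quantity.
  Substituting y = 1 / (t - 1) gives t y^2 = y + y^2, and y + y^2 <= 3 e^y by the quadratic Taylor
  bound.\<close>

lemma flat_weight_bound: "t > 0 \<Longrightarrow> t * flat [:0, 0, 1:] (t - 1) \<le> 3" "t > 0 \<Longrightarrow> 0 \<le> t * flat [:0, 0, 1:] (t - 1)"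
proof -
  assume t: "t > 0"
  show "0 \<le> t * flat [:0, 0, 1:] (t - 1)"
    using t by (simp add: flat_def)
  show "t * flat [:0, 0, 1:] (t - 1) \<le> 3"
  proof (cases "t > 1")
    case True
    define y where "y = 1 / (t - 1)"
    have y: "y > 0" "t = 1 + 1 / y" using True by (auto simp: y_def)
    have "1 + y + y\<^sup>2 / 2 \<le> exp y"
      using exp_lower_Taylor_quadratic[of y] y by simp
    then have "y + y\<^sup>2 \<le> 3 * exp y" using y zero_le_power2[of y] by linarith
    then have "(y + y\<^sup>2) * exp (- y) \<le> 3 * (exp y * exp (- y))"
      unfolding mult.assoc[symmetric] by (intro mult_right_mono) auto
    then have "(y + y\<^sup>2) * exp (- y) \<le> 3" by (simp add: exp_minus_inverse)
    moreover have "t * (y * y) = y + y\<^sup>2"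
      using y by (simp add: algebra_simps power2_eq_square)
    ultimately have "t * (y * y * exp (- y)) \<le> 3"
      by (metis mult.assoc)
    then show ?thesis
      using True by (simp add: flat_def y_def)
  qed (simp add: flat_def)
qed

lemma flat_weight_tendsto: "((\<lambda>t. t * flat [:0, 0, 1:] (t - 1)) \<longlongrightarrow> 0) at_top"
proof (rule Lim_null_comparison)
  show "\<forall>\<^sub>F t in at_top. norm (t * flat [:0, 0, 1:] (t - 1)) \<le> t / (t - 1)\<^sup>2"
    using eventually_gt_at_top[of 1]
    by eventually_elim (auto simp: flat_def abs_mult power2_eq_square divide_simps intro!: mult_left_le)
  show "((\<lambda>t::real. t / (t - 1)\<^sup>2) \<longlongrightarrow> 0) at_top"
    by real_asymp
qed

lemma scaled_square_at_top:
  "x \<noteq> (0::'a::euclidean_space) \<Longrightarrow> filterlim (\<lambda>k. real (Suc k) * (x \<bullet> x)) at_top sequentially"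
  using filterlim_tendsto_pos_mult_at_top[OF tendsto_const _
      filterlim_compose[OF filterlim_real_sequentially filterlim_Suc], of "x \<bullet> x"]
  by (simp add: mult.commute)

lemma cutoff_tendsto_1:
  assumes "x \<noteq> (0::'a::euclidean_space)"
  shows "(\<lambda>k. cutoff k x) \<longlonglongrightarrow> 1"
proof -
  have "((\<lambda>t. flat 1 (t - 1)) \<longlongrightarrow> 1) at_top"
  proof (rule Lim_transform_eventually)
    show "((\<lambda>t::real. exp (- (1 / (t - 1)))) \<longlongrightarrow> 1) at_top" by real_asymp
    show "\<forall>\<^sub>F t in at_top. exp (- (1 / (t - 1))) = flat 1 (t - 1)"
      using eventually_gt_at_top[of 1] by eventually_elim (simp add: flat_def)
  qed
  from filterlim_compose[OF this scaled_square_at_top[OF assms]]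
  show ?thesis by (simp add: cutoff_def)
qed

lemma dir_deriv_cutoff_eq:
  assumes "x \<noteq> (0::'a::euclidean_space)"
  shows "dir_deriv u (cutoff k) x = 2 * (x \<bullet> u) / (x \<bullet> x) *
    (real (Suc k) * (x \<bullet> x) * flat [:0, 0, 1:] (real (Suc k) * (x \<bullet> x) - 1))"
  using assms by (simp add: dir_deriv_cutoff)

lemma dir_deriv_cutoff_bound:
  assumes "x \<noteq> (0::'a::euclidean_space)"
  shows "\<bar>dir_deriv u (cutoff k) x\<bar> \<le> 6 * norm u / norm x"
proof -
  have "\<bar>dir_deriv u (cutoff k) x\<bar> \<le> (2 * (norm x * norm u) / (x \<bullet> x)) * 3"
    unfolding dir_deriv_cutoff_eq[OF assms] abs_mult
    using assms flat_weight_bound[of "real (Suc k) * (x \<bullet> x)"] Cauchy_Schwarz_ineq2[of x u]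
    by (intro mult_mono) (auto simp: abs_mult divide_right_mono)
  then show ?thesis
    using assms by (simp add: dot_square_norm power2_eq_square)
qed

lemma dir_deriv_cutoff_tendsto_0:
  assumes "x \<noteq> (0::'a::euclidean_space)"
  shows "(\<lambda>k. dir_deriv u (cutoff k) x) \<longlonglongrightarrow> 0"
proof -
  have "(\<lambda>k. real (Suc k) * (x \<bullet> x) * flat [:0, 0, 1:] (real (Suc k) * (x \<bullet> x) - 1)) \<longlonglongrightarrow> 0"
    using filterlim_compose[OF flat_weight_tendsto scaled_square_at_top[OF assms]] .
  from tendsto_mult_right_zero[OF this, of "2 * (x \<bullet> u) / (x \<bullet> x)"]
  show ?thesis unfolding dir_deriv_cutoff_eq[OF assms] .
qed

section \<open>Integration by parts on Euclidean space\<close>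

text \<open>A line in a nonzero direction meets the origin for at most one parameter, and the
  fundamental theorem of calculus tolerates finitely many exceptional points as long as F is
  continuous. This is how a kink at the origin stays harmless.\<close>

lemma line_Lipschitz:
  fixes F :: "'a::euclidean_space \<Rightarrow> real"
  assumes "continuous_on UNIV F" "\<And>x. x \<noteq> 0 \<Longrightarrow> F differentiable (at x)"
    "\<And>x. x \<noteq> 0 \<Longrightarrow> \<bar>dir_deriv b F x\<bar> \<le> L" "b \<noteq> 0" "0 \<le> s" "0 \<le> L"
  shows "\<bar>F (x + s *\<^sub>R b) - F x\<bar> \<le> L * s"
proof -
  define Z where "Z = {t. x + t *\<^sub>R b = 0}"
  define F' where "F' = (\<lambda>t. if t \<in> Z then 0 else dir_deriv b F (x + t *\<^sub>R b))"
  have "t = u" if "t \<in> Z" "u \<in> Z" for t u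
    using that \<open>b \<noteq> 0\<close> by (simp add: Z_def) (metis add_left_cancel scaleR_cancel_right)
  then have "finite Z"
    by (metis (full_types) finite.emptyI finite_insert finite_subset insertCI subsetI subset_singletonD ex_in_conv)
  moreover have "continuous_on {0..s} (\<lambda>t. F (x + t *\<^sub>R b))"
    by (rule continuous_on_compose2[OF assms(1)]) (auto intro!: continuous_intros)
  moreover have "((\<lambda>t. F (x + t *\<^sub>R b)) has_vector_derivative F' t) (at t)" if "t \<in> {0<..<s} - Z" for t
    using that line_has_vector_derivative[of F x t b] assms(2) by (auto simp: F'_def Z_def)
  ultimately have "(F' has_integral (F (x + s *\<^sub>R b) - F (x + 0 *\<^sub>R b))) {0..s}"
    using assms by (intro fundamental_theorem_of_calculus_interior_strong[of Z]) auto
  then have "norm (F (x + s *\<^sub>R b) - F (x + 0 *\<^sub>R b)) \<le> L * measure lborel {0..s}"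
    using assms by (intro has_integral_bound_real[where f = F']) (auto simp: F'_def Z_def)
  then show ?thesis using assms by simp
qed

lemma integrable_bounded_support:
  fixes f :: "'a::euclidean_space \<Rightarrow> 'b::{banach,second_countable_topology}"
  assumes "f \<in> borel_measurable lborel" "AE x in lborel. norm (f x) \<le> B"
    "\<And>x. R \<le> norm x \<Longrightarrow> f x = 0"
  shows "integrable lborel f"
proof (rule Bochner_Integration.integrable_bound)
  show "integrable lborel (\<lambda>x. B * indicator (cball (0::'a) R) x)"
    using emeasure_bounded_finite[OF bounded_cball[of "0::'a" R]] by auto
  show "AE x in lborel. norm (f x) \<le> norm (B * indicator (cball (0::'a) R) x)"
    using assms(2)
  proof eventually_elim
    case (elim x)
    then show ?case using assms(3)[of x] by (cases "norm x \<le> R") auto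
  qed
qed fact

text \<open>The difference quotients of \<open>F\<close> have integral 0 by translation invariance.\<close>

lemma has_bochner_integral_dir_deriv:
  fixes F :: "'a::euclidean_space \<Rightarrow> real"
  assumes F: "continuous_on UNIV F" "\<And>x. R \<le> norm x \<Longrightarrow> F x = 0"
    "\<And>x. x \<noteq> 0 \<Longrightarrow> F differentiable (at x)"
    and F': "continuous_on (- {0}) (dir_deriv b F)" "\<And>x. x \<noteq> 0 \<Longrightarrow> \<bar>dir_deriv b F x\<bar> \<le> L"
  shows "has_bochner_integral lborel (dir_deriv b F) 0"
proof (cases "b = 0")
  \<comment> \<open>The zero direction is treated apart: F need not be differentiable at the origin,
    so its derivative is 0 only almost everywhere, and the argument along lines needs a nonzero
    direction.\<close>
  case True
  have "AE x in lborel. 0 = dir_deriv b F x"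
    using AE_lborel_singleton[of "0::'a"]
  proof eventually_elim
    case (elim x)
    then show ?case using F(3) linear_0[OF linear_dir_deriv] True by metis
  qed
  moreover have m: "dir_deriv b F \<in> borel_measurable lborel"
    using borel_measurable_continuous_countable_exceptions[of "{0}" "dir_deriv b F"] F'(1) by simp
  ultimately show ?thesis
    using has_bochner_integral_cong_AE[of "\<lambda>_. 0" lborel "dir_deriv b F" 0]
      has_bochner_integral_zero[of "lborel :: 'a measure", where 'b = real] by simp
next
  case False
  have m: "dir_deriv b F \<in> borel_measurable lborel"
    using borel_measurable_continuous_countable_exceptions[of "{0}" "dir_deriv b F"] F'(1) by simp
  have mF: "F \<in> borel_measurable borel"
    using F(1) by (rule borel_measurable_continuous_onI)
  define L' where "L' = max L 0"
  have L': "\<And>x. x \<noteq> 0 \<Longrightarrow> \<bar>dir_deriv b F x\<bar> \<le> L'" "0 \<le> L'"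
    using F'(2) by (force simp: L'_def)+
  \<comment> \<open>Steps of length at most 1 keep all difference quotients supported in one ball,
    of radius R + |b|.\<close>
  define s where "s = (\<lambda>k. inverse (real (Suc k)))"
  have s: "0 < s k" "s k \<le> 1" for k by (auto simp: s_def field_simps)
  define f where "f = (\<lambda>k x. (F (x + s k *\<^sub>R b) - F x) / s k)"
  have "compact (F ` cball 0 R)"
    by (intro compact_continuous_image continuous_on_subset[OF F(1)]) auto
  then obtain B where B: "\<And>x. x \<in> cball 0 R \<Longrightarrow> \<bar>F x\<bar> \<le> B"
    using compact_imp_bounded bounded_iff by (metis image_eqI real_norm_def)
  have "norm (F x) \<le> max B 0" for x
    using B[of x] F(2)[of x] by (cases "norm x \<le> R") auto
  then have intF: "integrable lborel F"
    using F(2) mF by (intro integrable_bounded_support[of F "max B 0" R]) auto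
  have shift: "integrable lborel (\<lambda>x. F (x + c))" "(\<integral>x. F (x + c) \<partial>lborel) = (\<integral>x. F x \<partial>lborel)" for c
    using intF mF integral_distr[of "(+) c" lborel borel F] integrable_distr_eq[of "(+) c" lborel borel F]
    by (simp_all add: lborel_distr_plus add.commute)
  have int_f: "(\<integral>x. f k x \<partial>lborel) = 0" for k
    using shift[of "s k *\<^sub>R b"] intF by (simp add: f_def)
  have lim: "AE x in lborel. (\<lambda>k. f k x) \<longlonglongrightarrow> dir_deriv b F x"
    using AE_lborel_singleton[of "0::'a"]
  proof eventually_elim
    case (elim x)
    have "((\<lambda>t. F (x + t *\<^sub>R b)) has_vector_derivative dir_deriv b F x) (at 0)"
      using line_has_vector_derivative[of F x 0 b] F(3)[OF elim] by simp
    then have "((\<lambda>t. (F (x + t *\<^sub>R b) - F x) / t) \<longlongrightarrow> dir_deriv b F x) (at 0)"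
      by (simp add: has_real_derivative_iff_has_vector_derivative[symmetric] has_field_derivative_iff)
    moreover have "filterlim s (at 0) sequentially"
      using LIMSEQ_inverse_real_of_nat s by (auto simp: filterlim_at s_def)
    ultimately show ?case
      unfolding f_def by (rule filterlim_compose)
  qed
  \<comment> \<open>The Lipschitz bound along lines supplies the dominating function, also for
    segments that cross the origin.\<close>
  have bnd: "norm (f k x) \<le> L' * indicator (cball 0 (R + norm b)) x" for k x
  proof (cases "norm x \<le> R + norm b")
    case True
    have "\<bar>F (x + s k *\<^sub>R b) - F x\<bar> \<le> L' * s k"
      using s[of k] False by (intro line_Lipschitz F L') auto
    then show ?thesis
      using s[of k] True by (simp add: f_def field_simps)
  next
    case out: False
    have "norm (s k *\<^sub>R b) \<le> norm b"
      using s[of k] by (simp add: mult_left_le_one_le)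
    then have "R \<le> norm (x + s k *\<^sub>R b)"
      using out norm_triangle_ineq4[of "x + s k *\<^sub>R b" "s k *\<^sub>R b"] by simp
    moreover have "R \<le> norm x" using out norm_ge_zero[of b] by linarith
    ultimately show ?thesis
      using F(2) out by (simp add: f_def)
  qed
  have W: "integrable lborel (\<lambda>x. L' * indicator (cball (0::'a) (R + norm b)) x)"
    using emeasure_bounded_finite[OF bounded_cball[of "0::'a" "R + norm b"]] by auto
  have mf: "f k \<in> borel_measurable lborel" for k
    unfolding f_def using mF by measurable
  note dct = m mf W lim AE_I2[OF bnd]
  have "integrable lborel (dir_deriv b F)"
    "(\<lambda>k. \<integral>x. f k x \<partial>lborel) \<longlonglongrightarrow> (\<integral>x. dir_deriv b F x \<partial>lborel)"
    by (rule integrable_dominated_convergence[OF dct], rule integral_dominated_convergence[OF dct])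
  then show ?thesis
    using LIMSEQ_unique[OF _ tendsto_const[of 0]] by (simp add: int_f has_bochner_integral_iff)
qed

section \<open>Integration in polar coordinates\<close>

lemma finite_sphere_measure: "finite_measure (sphere_measure :: 'a::euclidean_space measure)"
proof (rule finite_measureI)
  have "sphere (0::'a) 1 = space (sphere_measure :: 'a measure)"
    by (simp add: sphere_measure_def space_scale_measure space_restrict_space)
  moreover have "{x::'a. 0 < norm x \<and> norm x < 1 \<and> sgn x \<in> sphere 0 1} \<subseteq> ball 0 1"
    by auto
  then have "emeasure lborel {x::'a. 0 < norm x \<and> norm x < 1 \<and> sgn x \<in> sphere 0 1} < \<infinity>"
    by (intro emeasure_bounded_finite bounded_subset[OF bounded_ball])
  ultimately show "emeasure (sphere_measure :: 'a measure) (space sphere_measure) \<noteq> \<infinity>"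
    using emeasure_sphere_measure[OF borel_closed[OF closed_sphere] subset_refl, where 'a = 'a]
    by (simp add: ennreal_mult_eq_top_iff ennreal_of_nat_eq_real_of_nat)
qed

lemma sets_sphere_measure:
  "sets (sphere_measure :: 'a::euclidean_space measure) = sets (restrict_space borel (sphere 0 1))"
  by (simp add: sphere_measure_def)

lemma sgn_borel_measurable [measurable]: "sgn \<in> borel_measurable (borel :: 'a::euclidean_space measure)"
proof -
  have "sgn = (\<lambda>x::'a. inverse (norm x) *\<^sub>R x)"
    by (simp add: fun_eq_iff sgn_div_norm)
  then show ?thesis by simp
qed

text \<open>The truncated cone of height t is the dilate by t of the one of height 1, and Lebesgue
  measure scales by t^n.\<close>

lemma emeasure_cone_scale:
  assumes B: "B \<in> sets (borel :: 'a::euclidean_space measure)" and t: "0 < t"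
  shows "emeasure lborel {x::'a. 0 < norm x \<and> norm x < t \<and> sgn x \<in> B} =
    ennreal (t ^ DIM('a)) * emeasure lborel {x::'a. 0 < norm x \<and> norm x < 1 \<and> sgn x \<in> B}"
proof -
  define S where "S = (\<lambda>t. {x::'a. 0 < norm x \<and> norm x < t \<and> sgn x \<in> B})"
  have [measurable]: "S t \<in> sets borel" for t
    using B unfolding S_def by measurable
  have "(\<lambda>x. t *\<^sub>R x) -` S t = S 1"
    using t by (auto simp: S_def sgn_scaleR)
  then have "emeasure (density (distr lborel borel (\<lambda>x::'a. 0 + t *\<^sub>R x)) (\<lambda>_. ennreal (\<bar>t\<bar> ^ DIM('a)))) (S t)
      = ennreal (t ^ DIM('a)) * emeasure lborel (S 1)"
    using t by (simp add: emeasure_density_const emeasure_distr)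
  moreover have "(lborel :: 'a measure) = density (distr lborel borel (\<lambda>x. 0 + t *\<^sub>R x)) (\<lambda>_. ennreal (\<bar>t\<bar> ^ DIM('a)))"
    using t by (intro lborel_affine) auto
  ultimately show ?thesis unfolding S_def by metis
qed

lemma nn_integral_power_lessThan:
  assumes "n \<ge> 1"
  shows "(\<integral>\<^sup>+r. ennreal (r ^ (n - 1)) * indicator {0<..<t} r \<partial>lborel) = ennreal (if t > 0 then t ^ n / n else 0)"
proof (cases "t > 0")
  case True
  have "(\<integral>\<^sup>+r. ennreal (r ^ (n - 1)) * indicator {0<..<t} r \<partial>lborel) =
      (\<integral>\<^sup>+r. ennreal (r ^ (n - 1)) * indicator {0..t} r \<partial>lborel)"
  proof (rule nn_integral_cong_AE)
    show "AE r in lborel. ennreal (r ^ (n - 1)) * indicator {0<..<t} r = ennreal (r ^ (n - 1)) * indicator {0..t} r"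
      using AE_lborel_singleton[of 0] AE_lborel_singleton[of t]
      by eventually_elim (auto split: split_indicator)
  qed
  also have "\<dots> = ennreal (t ^ n / n - 0 ^ n / n)"
    using True assms
    by (intro nn_integral_FTC_Icc) (auto intro!: derivative_eq_intros simp: power_0_left)
  finally show ?thesis using True assms by (simp add: power_0_left)
qed simp

text \<open>For fixed B both sides are measures in A. They agree on the intervals below t by the
  scaling of cones, and these intervals form a generator stable under intersection.\<close>

lemma emeasure_polar_rectangle:
  fixes B :: "'a::euclidean_space set"
  assumes A: "A \<in> sets borel" "A \<subseteq> {0<..}" and B: "B \<in> sets borel" "B \<subseteq> sphere 0 1"
  shows "emeasure lborel {x::'a. norm x \<in> A \<and> sgn x \<in> B} =
    (\<integral>\<^sup>+r. ennreal (r ^ (DIM('a) - 1)) * indicator A r \<partial>lborel) * emeasure sphere_measure B"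
proof -
  let ?n = "DIM('a)"
  define c where "c = emeasure lborel {x::'a. 0 < norm x \<and> norm x < 1 \<and> sgn x \<in> B}"
  have "{x::'a. 0 < norm x \<and> norm x < 1 \<and> sgn x \<in> B} \<subseteq> ball 0 1" by auto
  then have c: "c < \<infinity>"
    unfolding c_def by (intro emeasure_bounded_finite bounded_subset[OF bounded_ball])
  have sB: "emeasure sphere_measure B = of_nat ?n * c"
    using B by (simp add: emeasure_sphere_measure c_def)
  \<comment> \<open>The distribution of the norm on the cone over B, to be compared with r^(n-1) dr
    times the spherical measure n c of B.\<close>
  define \<mu> where "\<mu> = distr (restrict_space lborel {x::'a. x \<noteq> 0 \<and> sgn x \<in> B}) borel norm"
  define \<nu> where "\<nu> = density lborel (\<lambda>r. ennreal (r ^ (?n - 1)) * indicator {0<..} r * (of_nat ?n * c))"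
  have [measurable]: "{x::'a. x \<noteq> 0 \<and> sgn x \<in> B} \<in> sets borel"
    using B by measurable
  have \<mu>: "emeasure \<mu> X = emeasure lborel {x::'a. x \<noteq> 0 \<and> sgn x \<in> B \<and> norm x \<in> X}"
    if [measurable]: "X \<in> sets borel" for X
  proof -
    have "norm \<in> measurable (restrict_space lborel {x::'a. x \<noteq> 0 \<and> sgn x \<in> B}) borel"
      by (intro measurable_restrict_space1) simp
    moreover have "norm -` X \<inter> {x::'a. x \<noteq> 0 \<and> sgn x \<in> B} = {x. x \<noteq> 0 \<and> sgn x \<in> B \<and> norm x \<in> X}"
      by auto
    ultimately show ?thesis
      by (simp add: \<mu>_def emeasure_distr space_restrict_space) (subst emeasure_restrict_space, auto)
  qed
  have \<nu>: "emeasure \<nu> X = (\<integral>\<^sup>+r. ennreal (r ^ (?n - 1)) * indicator (X \<inter> {0<..}) r \<partial>lborel) * (of_nat ?n * c)"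
    if [measurable]: "X \<in> sets borel" for X
  proof -
    have "emeasure \<nu> X = (\<integral>\<^sup>+r. ennreal (r ^ (?n - 1)) * indicator {0<..} r * (of_nat ?n * c) * indicator X r \<partial>lborel)"
      unfolding \<nu>_def by (subst emeasure_density) auto
    also have "\<dots> = (\<integral>\<^sup>+r. ennreal (r ^ (?n - 1)) * indicator (X \<inter> {0<..}) r * (of_nat ?n * c) \<partial>lborel)"
      by (intro nn_integral_cong) (auto split: split_indicator)
    finally show ?thesis by (simp add: nn_integral_multc)
  qed
  have eq: "emeasure \<mu> {..<t} = emeasure \<nu> {..<t}" for t
  proof (cases "t > 0")
    case True
    have "emeasure \<mu> {..<t} = ennreal (t ^ ?n) * c"
      using emeasure_cone_scale[OF B(1) True] by (simp add: \<mu> c_def conj_ac)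
    \<comment> \<open>The factor n in \<open>sphere_measure\<close> cancels the 1/n that comes from
      integrating r^(n-1).\<close>
    also have "\<dots> = ennreal (t ^ ?n / ?n) * (of_nat ?n * c)"
      using True by (simp add: mult.assoc[symmetric] ennreal_of_nat_eq_real_of_nat ennreal_mult[symmetric])
    also have "\<dots> = emeasure \<nu> {..<t}"
      using True nn_integral_power_lessThan[of ?n t] DIM_positive[where 'a = 'a]
      by (simp add: \<nu> Int_commute greaterThanLessThan_def Suc_le_eq)
    finally show ?thesis .
  next
    case False
    then have "{x::'a. x \<noteq> 0 \<and> sgn x \<in> B \<and> norm x \<in> {..<t}} = {}" "{..<t} \<inter> {0<..} = {}"
      by (auto simp: not_less intro: order.trans[OF _ norm_ge_zero])
    moreover have "{..<t} \<in> sets borel" by simp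
    ultimately show ?thesis
      by (simp only: \<mu> \<nu> emeasure_empty) simp
  qed
  have "\<mu> = \<nu>"
  proof (rule measure_eqI_generator_eq[of "range lessThan" UNIV _ _ "\<lambda>i. {..<real i}"])
    show "Int_stable (range lessThan :: real set set)"
    proof -
      have "{..<a} \<inter> {..<b} = {..<min a b}" for a b :: real by auto
      then show ?thesis by (auto simp: Int_stable_def)
    qed
    show "sets \<mu> = sigma_sets UNIV (range lessThan)" "sets \<nu> = sigma_sets UNIV (range lessThan)"
      by (simp_all add: \<mu>_def \<nu>_def) (simp_all add: borel_Iio)
    show "(\<Union>i. {..<real i}) = UNIV"
      by (auto intro: reals_Archimedean2)
    show "emeasure \<mu> {..<real i} \<noteq> \<infinity>" for i
    proof -
      have "emeasure \<mu> {..<real i} \<le> emeasure lborel (ball (0::'a) (real i))"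
        by (subst \<mu>) (auto intro!: emeasure_mono)
      also have "\<dots> < \<infinity>" by (intro emeasure_bounded_finite) simp
      finally show ?thesis by simp
    qed
  qed (use eq in auto)
  then have "emeasure \<mu> A = emeasure \<nu> A" by simp
  moreover have "{x::'a. x \<noteq> 0 \<and> sgn x \<in> B \<and> norm x \<in> A} = {x. norm x \<in> A \<and> sgn x \<in> B}"
    using A by force
  moreover have "A \<inter> {0<..} = A" using A by auto
  ultimately show ?thesis
    using A sB by (simp add: \<mu> \<nu>)
qed

section \<open>Change of variables to polar coordinates\<close>

definition polar :: "'a::euclidean_space \<Rightarrow> real \<times> 'a" where
  "polar x = (norm x, sgn x)"

lemma polar_measurable:
  "polar \<in> measurable (restrict_space lborel (- {0::'a::euclidean_space})) polar_measure"
proof -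
  have "sgn \<in> measurable (restrict_space lborel (- {0::'a})) sphere_measure"
    unfolding measurable_cong_sets[OF refl sets_sphere_measure]
    by (intro measurable_restrict_space2 measurable_restrict_space1)
      (auto simp: space_restrict_space norm_sgn)
  moreover have "norm \<in> measurable (restrict_space lborel (- {0::'a})) (restrict_space lborel {0<..})"
    by (intro measurable_restrict_space2 measurable_restrict_space1) (auto simp: space_restrict_space)
  ultimately show ?thesis
    unfolding polar_def polar_measure_def by (intro measurable_Pair)
qed

lemma fst_polar_measurable [measurable]:
  "fst \<in> borel_measurable (polar_measure :: (real \<times> 'a::euclidean_space) measure)"
  unfolding polar_measure_def
  by (rule measurable_compose[OF measurable_fst measurable_restrict_space1]) simp

text \<open>A product of sigma-finite measures is determined by its rectangles. The Jacobian r^(n-1)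
  depends on r alone, so it can be put into the first factor before the comparison.\<close>

lemma distr_polar:
  "distr (restrict_space lborel (- {0::'a::euclidean_space})) polar_measure polar =
    density polar_measure (\<lambda>z. ennreal (fst z ^ (DIM('a) - 1)))"
proof -
  let ?f = "\<lambda>r. ennreal (r ^ (DIM('a) - 1))"
  define M1 where "M1 = density (restrict_space lborel {0<..}) ?f"
  interpret S: finite_measure "sphere_measure :: 'a measure" by (rule finite_sphere_measure)
  have S: "sigma_finite_measure (sphere_measure :: 'a measure)" by unfold_locales
  interpret L: sigma_finite_measure "restrict_space lborel {0::real<..}"
    by (rule sigma_finite_measure_restrict_space[OF lborel.sigma_finite_measure_axioms]) simp
  have f: "?f \<in> borel_measurable (restrict_space lborel {0<..})"
    by (intro measurable_restrict_space1) simp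
  have M1: "sigma_finite_measure M1"
    unfolding M1_def using f by (intro L.sigma_finite_iff_density_finite[THEN iffD2]) auto
  have 1: "density sphere_measure (\<lambda>_. 1) = (sphere_measure :: 'a measure)"
    by (rule density_1)
  have "M1 \<Otimes>\<^sub>M (sphere_measure :: 'a measure) = density polar_measure (\<lambda>z. ?f (fst z))"
    using pair_measure_density[OF f, of "\<lambda>_. 1" "sphere_measure :: 'a measure"] S
    by (simp add: 1 M1_def polar_measure_def case_prod_beta')
  moreover have "M1 \<Otimes>\<^sub>M (sphere_measure :: 'a measure) = distr (restrict_space lborel (- {0::'a})) polar_measure polar"
  proof (rule pair_measure_eqI[OF M1 S])
    show "sets (M1 \<Otimes>\<^sub>M sphere_measure) = sets (distr (restrict_space lborel (- {0::'a})) polar_measure polar)"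
      by (simp add: M1_def polar_measure_def cong: sets_pair_measure_cong)
    fix A and B :: "'a set" assume AB: "A \<in> sets M1" "B \<in> sets sphere_measure"
    then have A: "A \<in> sets borel" "A \<subseteq> {0<..}"
      by (auto simp: M1_def sets_restrict_space_iff)
    have B: "B \<in> sets borel" "B \<subseteq> sphere 0 1"
      using AB by (auto simp: sets_sphere_measure sets_restrict_space_iff)
    have "A \<times> B \<in> sets (polar_measure :: (real \<times> 'a) measure)"
      using AB unfolding polar_measure_def M1_def by (intro pair_measureI) auto
    moreover have "polar -` (A \<times> B) \<inter> - {0} = {x::'a. norm x \<in> A \<and> sgn x \<in> B}"
      using A by (auto simp: polar_def)
    moreover have "{x::'a. norm x \<in> A \<and> sgn x \<in> B} \<subseteq> - {0}" using A by auto
    ultimately have "emeasure (distr (restrict_space lborel (- {0::'a})) polar_measure polar) (A \<times> B)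
        = emeasure lborel {x::'a. norm x \<in> A \<and> sgn x \<in> B}"
      by (simp add: emeasure_distr[OF polar_measurable] space_restrict_space emeasure_restrict_space)
    also have "\<dots> = (\<integral>\<^sup>+r. ?f r * indicator A r \<partial>lborel) * emeasure sphere_measure B"
      by (rule emeasure_polar_rectangle[OF A B])
    also have "(\<integral>\<^sup>+r. ?f r * indicator A r \<partial>lborel) = emeasure M1 A"
    proof -
      have "emeasure M1 A = (\<integral>\<^sup>+r. ?f r * indicator A r \<partial>restrict_space lborel {0<..})"
        using AB f unfolding M1_def by (intro emeasure_density) auto
      also have "\<dots> = (\<integral>\<^sup>+r. ?f r * indicator A r * indicator {0<..} r \<partial>lborel)"
        by (rule nn_integral_restrict_space) simp
      also have "\<dots> = (\<integral>\<^sup>+r. ?f r * indicator A r \<partial>lborel)"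
        using A by (intro nn_integral_cong) (auto split: split_indicator)
      finally show ?thesis by simp
    qed
    finally show "emeasure M1 A * emeasure sphere_measure B =
        emeasure (distr (restrict_space lborel (- {0::'a})) polar_measure polar) (A \<times> B)" by simp
  qed
  ultimately show ?thesis by simp
qed

text \<open>The image of Lebesgue measure has a density with respect to
  \<open>polar_measure\<close>, so null sets pull back to null sets. This carries almost everywhere
  statements about functions of (r, omega) over to Euclidean space.\<close>

lemma AE_polar:
  assumes "AE z in polar_measure. P z"
  shows "AE x::'a::euclidean_space in lborel. P (polar x)"
proof -
  have "AE z in density polar_measure (\<lambda>z. ennreal (fst z ^ (DIM('a) - 1))). P z"
  proof (subst AE_density)
    show "(\<lambda>z. ennreal (fst z ^ (DIM('a) - 1))) \<in> borel_measurable (polar_measure :: (real \<times> 'a) measure)"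
      by measurable
  qed (use assms in auto)
  then have "AE x in restrict_space lborel (- {0::'a}). P (polar x)"
    unfolding distr_polar[symmetric] by (rule AE_distrD[OF polar_measurable])
  then have "AE x::'a in lborel. x \<in> - {0} \<longrightarrow> P (polar x)"
    by (subst (asm) AE_restrict_space_iff) auto
  with AE_lborel_singleton[of "0::'a"] show ?thesis
    by eventually_elim auto
qed

text \<open>The pair \<open>polar 0\<close> lies outside the space of \<open>polar_measure\<close>,
  so nothing is known of f there; the origin is removed as a single exceptional point.\<close>

lemma borel_measurable_polar:
  fixes f :: "real \<times> 'a::euclidean_space \<Rightarrow> real"
  assumes "f \<in> borel_measurable polar_measure"
  shows "(\<lambda>x. f (polar x)) \<in> borel_measurable lborel"
proof (rule measurable_discrete_difference[where X = "{0}"])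
  have "(\<lambda>x. f (polar x)) \<in> borel_measurable (restrict_space lborel (- {0}))"
    using measurable_compose[OF polar_measurable assms] .
  then show "(\<lambda>x. indicator (- {0}) x *\<^sub>R f (polar x)) \<in> borel_measurable lborel"
    by (subst (asm) borel_measurable_restrict_space_iff) (auto simp: mult.commute)
qed auto

text \<open>Since \<open>polar_measure\<close> carries no Jacobian, the reciprocal of r^(n-1)
  appears on the right.\<close>

lemma integral_polar:
  fixes f :: "real \<times> 'a::euclidean_space \<Rightarrow> real"
  assumes f: "f \<in> borel_measurable polar_measure"
  shows "(\<integral>z. f z \<partial>polar_measure) = (\<integral>x. f (polar x) / norm x ^ (DIM('a) - 1) \<partial>lborel)"
proof -
  let ?n = "DIM('a) - 1"
  have m: "(\<lambda>z. f z / fst z ^ ?n) \<in> borel_measurable polar_measure"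
    using f by simp
  have pos: "0 < fst z" if "z \<in> space (polar_measure :: (real \<times> 'a) measure)" for z
    using that by (auto simp: space_polar_measure)
  have "(\<integral>z. f z \<partial>polar_measure) = (\<integral>z. fst z ^ ?n *\<^sub>R (f z / fst z ^ ?n) \<partial>polar_measure)"
    using pos by (intro Bochner_Integration.integral_cong) force+
  also have "\<dots> = (\<integral>z. f z / fst z ^ ?n \<partial>density polar_measure (\<lambda>z. ennreal (fst z ^ ?n)))"
    using m pos by (intro integral_density[symmetric]) (auto intro!: AE_I2 less_imp_le zero_le_power)
  also have "\<dots> = (\<integral>x. f (polar x) / fst (polar x) ^ ?n \<partial>restrict_space lborel (- {0::'a}))"
    unfolding distr_polar[symmetric] by (rule integral_distr[OF polar_measurable m])
  also have "\<dots> = (\<integral>x. indicator (- {0::'a}) x *\<^sub>R (f (polar x) / fst (polar x) ^ ?n) \<partial>lborel)"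
    by (rule integral_restrict_space) simp
  also have "\<dots> = (\<integral>x. f (polar x) / norm x ^ ?n \<partial>lborel)"
    by (intro integral_discrete_difference[where X = "{0}"]) (auto simp: polar_def)
  finally show ?thesis .
qed

text \<open>In polar coordinates the integrand becomes r^(n-3), which is bounded on (0, R] when n >=
  3.\<close>

lemma integrable_inverse_norm_square:
  assumes "DIM('a::euclidean_space) \<ge> 3"
  shows "integrable lborel (\<lambda>x::'a. indicator (cball 0 R) x / (norm x)\<^sup>2)"
proof (rule integrableI_bounded)
  let ?n = "DIM('a)"
  show "(\<lambda>x::'a. indicator (cball 0 R) x / (norm x)\<^sup>2) \<in> borel_measurable lborel"
    by (intro borel_measurable_divide borel_measurable_indicator) auto
  define g where "g = (\<lambda>z::real \<times> 'a. ennreal (indicator {..R} (fst z) / (fst z)\<^sup>2))"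
  have g: "g \<in> borel_measurable polar_measure" unfolding g_def by measurable
  interpret S: finite_measure "sphere_measure :: 'a measure" by (rule finite_sphere_measure)
  have "(\<integral>\<^sup>+(x::'a). ennreal (norm (indicator (cball 0 R) x / (norm x)\<^sup>2 :: real)) \<partial>lborel) =
      (\<integral>\<^sup>+(x::'a). g (polar x) * indicator (- {0}) x \<partial>lborel)"
    by (intro nn_integral_cong) (auto simp: g_def polar_def split: split_indicator)
  also have "\<dots> = (\<integral>\<^sup>+(x::'a). g (polar x) \<partial>restrict_space lborel (- {0}))"
    by (rule nn_integral_restrict_space[symmetric]) simp
  also have "\<dots> = (\<integral>\<^sup>+z. g z \<partial>density polar_measure (\<lambda>z. ennreal (fst z ^ (?n - 1))))"
    unfolding distr_polar[symmetric] using g by (intro nn_integral_distr[symmetric] polar_measurable) simp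
  also have "\<dots> = (\<integral>\<^sup>+z. ennreal (fst z ^ (?n - 1)) * g z \<partial>polar_measure)"
    using g by (intro nn_integral_density) auto
  also have "\<dots> \<le> (\<integral>\<^sup>+z. ennreal (\<bar>R\<bar> ^ (?n - 3)) * indicator ({0<..R} \<times> sphere 0 1) z \<partial>(polar_measure :: (real \<times> 'a) measure))"
  proof (rule nn_integral_mono)
    fix z assume z: "z \<in> space (polar_measure :: (real \<times> 'a) measure)"
    then have r: "fst z > 0" "snd z \<in> sphere 0 1" by (auto simp: space_polar_measure)
    have "fst z ^ (?n - 1) / (fst z)\<^sup>2 = fst z ^ (?n - 3)"
    proof -
      have "?n - 1 = (?n - 3) + 2" using assms by simp
      then show ?thesis using r by (simp only: power_add) simp
    qed
    moreover have "fst z ^ (?n - 3) \<le> \<bar>R\<bar> ^ (?n - 3)" if "fst z \<le> R"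
      using that r by (intro power_mono) auto
    ultimately show "ennreal (fst z ^ (?n - 1)) * g z \<le> ennreal (\<bar>R\<bar> ^ (?n - 3)) * indicator ({0<..R} \<times> sphere 0 1) z"
      using r by (cases z) (auto simp: g_def ennreal_mult[symmetric] split: split_indicator)
  qed
  also have "\<dots> = ennreal (\<bar>R\<bar> ^ (?n - 3)) * emeasure (polar_measure :: (real \<times> 'a) measure) ({0<..R} \<times> sphere 0 1)"
  proof (rule nn_integral_cmult_indicator)
    show "{0<..R} \<times> sphere 0 1 \<in> sets (polar_measure :: (real \<times> 'a) measure)"
      unfolding polar_measure_def
      by (intro pair_measureI) (auto simp: sets_sphere_measure sets_restrict_space_iff)
  qed
  also have "emeasure (polar_measure :: (real \<times> 'a) measure) ({0<..R} \<times> sphere 0 1) =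
      emeasure (restrict_space lborel {0<..}) {0<..R} * emeasure (sphere_measure :: 'a measure) (sphere 0 1)"
    unfolding polar_measure_def
    by (rule S.emeasure_pair_measure_Times) (auto simp: sets_sphere_measure sets_restrict_space_iff)
  also have "emeasure (restrict_space lborel {0<..}) {0<..R} = emeasure lborel {0<..R}"
    by (rule emeasure_restrict_space) auto
  also have "ennreal (\<bar>R\<bar> ^ (?n - 3)) * (emeasure lborel {0<..R} * emeasure (sphere_measure :: 'a measure) (sphere 0 1)) < \<infinity>"
    using S.emeasure_finite[of "sphere 0 1"] emeasure_bounded_finite[of "{0<..R}"]
    by (auto intro!: ennreal_mult_less_top[THEN iffD2] simp: less_top[symmetric] ennreal_mult_eq_top_iff)
  finally show "(\<integral>\<^sup>+(x::'a). ennreal (norm (indicator (cball 0 R) x / (norm x)\<^sup>2 :: real)) \<partial>lborel) < \<infinity>" .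
qed

section \<open>The divergence theorem with a singularity at the origin\<close>

text \<open>Dominates the \<open>1 / r\<^sup>2\<close> singularities below; it is locally integrable exactly because the
  dimension is not 2, and it is the constant 1 in dimension 1.\<close>

definition sing :: "'a::euclidean_space \<Rightarrow> real" where
  "sing x = 1 + (real DIM('a) - 1) / (norm x)\<^sup>2"

lemma sing_ge_1: "1 \<le> sing x"
proof -
  have "1 \<le> real DIM('a)" using DIM_positive[where 'a = 'a] by linarith
  then show ?thesis by (simp add: sing_def)
qed

lemma integrable_sing:
  assumes "DIM('a::euclidean_space) \<noteq> 2"
  shows "integrable lborel (\<lambda>x::'a. sing x * indicator (cball 0 R) x)"
proof -
  have i: "integrable lborel (indicator (cball (0::'a) R) :: 'a \<Rightarrow> real)"
    using emeasure_bounded_finite[OF bounded_cball[of "0::'a" R]] by auto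
  show ?thesis
  proof (cases "DIM('a) = 1")
    case True
    then show ?thesis using i by (simp add: sing_def)
  next
    case False
    then have "DIM('a) \<ge> 3" using assms DIM_positive[where 'a = 'a] by linarith
    from Bochner_Integration.integrable_add[OF i integrable_mult_right[OF integrable_inverse_norm_square[OF this, of R], of "real DIM('a) - 1"]]
    show ?thesis by (simp add: sing_def algebra_simps)
  qed
qed

lemma continuous_off_0_borel_measurable:
  fixes f :: "'a::euclidean_space \<Rightarrow> 'b::topological_space"
  shows "continuous_on (- {0}) f \<Longrightarrow> f \<in> borel_measurable lborel"
  using borel_measurable_continuous_countable_exceptions[of "{0}" f] by simp

lemma AE_sing_bound:
  assumes "AE x in lborel. norm (f x) \<le> K * sing x" "\<And>x. R \<le> norm x \<Longrightarrow> f x = 0"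
  shows "AE x in lborel. norm (f x) \<le> norm (K * (sing x * indicator (cball (0::'a::euclidean_space) R) x))"
  using assms(1)
proof eventually_elim
  case (elim x)
  then show ?case
    using assms(2)[of x] by (cases "norm x \<le> R") auto
qed

lemma integrable_sing_bound:
  fixes f :: "'a::euclidean_space \<Rightarrow> 'b::{banach,second_countable_topology}"
  assumes "DIM('a) \<noteq> 2" "f \<in> borel_measurable lborel"
    "AE x in lborel. norm (f x) \<le> K * sing x" "\<And>x. R \<le> norm x \<Longrightarrow> f x = 0"
  shows "integrable lborel f"
  by (rule Bochner_Integration.integrable_bound[OF integrable_mult_right[OF integrable_sing[OF assms(1)]]
      assms(2) AE_sing_bound[OF assms(3,4)]])

lemma integral_cutoff_tendsto:
  fixes f :: "'a::euclidean_space \<Rightarrow> real"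
  assumes "DIM('a) \<noteq> 2" "f \<in> borel_measurable lborel"
    "AE x in lborel. norm (f x) \<le> K * sing x" "\<And>x. R \<le> norm x \<Longrightarrow> f x = 0"
  shows "(\<lambda>k. \<integral>x. cutoff k x * f x \<partial>lborel) \<longlonglongrightarrow> (\<integral>x. f x \<partial>lborel)"
    and "integrable lborel (\<lambda>x. cutoff k x * f x)"
proof -
  have m: "(\<lambda>x. cutoff k x * f x) \<in> borel_measurable lborel" for k
    using smooth_on_continuous_on[OF smooth_on_cutoff[of k]] assms(2)
    by (intro borel_measurable_times) (auto intro: borel_measurable_continuous_onI)
  have lim: "AE x in lborel. (\<lambda>k. cutoff k x * f x) \<longlonglongrightarrow> f x"
    using AE_lborel_singleton[of "0::'a"]
  proof eventually_elim
    case (elim x)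
    then show ?case using tendsto_mult_right[OF cutoff_tendsto_1[of x], where c = "f x"] by simp
  qed
  have bnd: "AE x in lborel. norm (cutoff k x * f x) \<le> norm (f x)" for k
    by (rule AE_I2) (auto simp: abs_mult cutoff_bounds mult_left_le_one_le)
  have "integrable lborel (\<lambda>x. norm (f x))"
    by (intro integrable_norm integrable_sing_bound[OF assms])
  note dct = assms(2) m this lim bnd
  show "(\<lambda>k. \<integral>x. cutoff k x * f x \<partial>lborel) \<longlonglongrightarrow> (\<integral>x. f x \<partial>lborel)"
    by (rule integral_dominated_convergence[OF dct])
  show "integrable lborel (\<lambda>x. cutoff k x * f x)"
    by (rule integrable_dominated_convergence2[OF dct])
qed

text \<open>The gradient of the cutoff is at most 6/|x|, so the factor |x| in the bound of f leaves
  the integrable majorant \<open>sing\<close>. The direction may vary with x: the divergence theorem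
  takes a constant basis vector, the weak radial derivative takes \<open>sgn x\<close>.\<close>

lemma integral_cutoff_deriv_tendsto_0:
  fixes f :: "'a::euclidean_space \<Rightarrow> real" and u :: "'a \<Rightarrow> 'a"
  assumes dim: "DIM('a) \<noteq> 2" and f: "f \<in> borel_measurable lborel"
    "AE x in lborel. norm (f x) \<le> K * norm x * sing x" "\<And>x. R \<le> norm x \<Longrightarrow> f x = 0"
    and u: "u \<in> borel_measurable borel" "\<And>x. norm (u x) \<le> 1"
  shows "(\<lambda>k. \<integral>x. dir_deriv (u x) (cutoff k) x * f x \<partial>lborel) \<longlonglongrightarrow> 0"
    and "integrable lborel (\<lambda>x. dir_deriv (u x) (cutoff k) x * f x)"
proof -
  have "continuous_on UNIV (flat p)" for p
    by (rule smooth_on_continuous_on[OF smooth_on_flat])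
  then have [measurable]: "flat p \<in> borel_measurable borel" for p
    by (rule borel_measurable_continuous_onI)
  have m: "(\<lambda>x. dir_deriv (u x) (cutoff k) x * f x) \<in> borel_measurable lborel" for k
    unfolding dir_deriv_cutoff using f(1) u(1) by measurable
  have lim: "AE x in lborel. (\<lambda>k. dir_deriv (u x) (cutoff k) x * f x) \<longlonglongrightarrow> 0"
    using AE_lborel_singleton[of "0::'a"]
  proof eventually_elim
    case (elim x)
    then show ?case using tendsto_mult_right[OF dir_deriv_cutoff_tendsto_0[of x "u x"], where c = "f x"] by simp
  qed
  have bnd: "AE x in lborel. norm (dir_deriv (u x) (cutoff k) x * f x)
      \<le> 6 * \<bar>K\<bar> * (sing x * indicator (cball 0 R) x)" for k
    using AE_lborel_singleton[of "0::'a"] f(2)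
  proof eventually_elim
    case (elim x)
    have "\<bar>dir_deriv (u x) (cutoff k) x\<bar> \<le> 6 / norm x"
      using dir_deriv_cutoff_bound[OF elim(1), of "u x" k] u(2)[of x] elim
      by (elim order.trans) (simp add: divide_right_mono)
    moreover have "\<bar>f x\<bar> \<le> \<bar>K\<bar> * norm x * sing x"
    proof -
      have "K * (norm x * sing x) \<le> \<bar>K\<bar> * (norm x * sing x)"
        using sing_ge_1[of x] by (intro mult_right_mono) auto
      then show ?thesis using elim(2) by (simp add: mult.assoc)
    qed
    ultimately have "\<bar>dir_deriv (u x) (cutoff k) x * f x\<bar> \<le> 6 / norm x * (\<bar>K\<bar> * norm x * sing x)"
      unfolding abs_mult by (intro mult_mono) auto
    then have "\<bar>dir_deriv (u x) (cutoff k) x * f x\<bar> \<le> 6 * \<bar>K\<bar> * sing x"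
      using elim(1) by simp
    then show ?case
      using f(3)[of x] by (cases "norm x \<le> R") auto
  qed
  have W: "integrable lborel (\<lambda>x::'a. 6 * \<bar>K\<bar> * (sing x * indicator (cball 0 R) x))"
    by (intro integrable_mult_right integrable_sing[OF dim])
  have 0: "(\<lambda>x::'a. 0::real) \<in> borel_measurable lborel" by simp
  note dct = 0 m W lim bnd
  show "(\<lambda>k. \<integral>x. dir_deriv (u x) (cutoff k) x * f x \<partial>lborel) \<longlonglongrightarrow> 0"
    using integral_dominated_convergence[OF dct] by simp
  show "integrable lborel (\<lambda>x. dir_deriv (u x) (cutoff k) x * f x)"
    by (rule integrable_dominated_convergence2[OF dct])
qed

text \<open>The product vanishes on the ball of radius 1 / sqrt (k + 1), whatever f does at the
  origin.\<close>

lemma smooth_on_cutoff_mult: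
  assumes "smooth_on (- {0::'a::euclidean_space}) f"
  shows "smooth_on UNIV (\<lambda>x. cutoff k x * f x)"
proof -
  define e where "e = 1 / sqrt (real (Suc k))"
  have "smooth_on (- {0}) (\<lambda>x. cutoff k x * f x)"
    by (intro smooth_intros assms smooth_on_subset[OF smooth_on_cutoff]) auto
  moreover have "smooth_on (ball 0 e) (\<lambda>x. cutoff k x * f x)"
  proof (subst smooth_on_cong[of _ _ "\<lambda>_. 0"])
    fix x :: 'a assume "x \<in> ball 0 e"
    then have "(norm x)\<^sup>2 \<le> e\<^sup>2" by (intro power_mono) auto
    then have "real (Suc k) * (norm x)\<^sup>2 \<le> 1"
      by (simp add: e_def power_divide field_simps)
    then show "cutoff k x * f x = 0" using cutoff_eq_0 by (metis mult_zero_left)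
  qed (auto intro: smooth_on_const)
  ultimately have "smooth_on (- {0} \<union> ball 0 e) (\<lambda>x. cutoff k x * f x)"
    by (intro smooth_on_Un) auto
  moreover have "- {0} \<union> ball (0::'a) e = UNIV" by (auto simp: e_def)
  ultimately show ?thesis by simp
qed

lemma dir_deriv_zero_off:
  assumes "\<And>x. R < norm x \<Longrightarrow> f x = 0" "R < norm x"
  shows "dir_deriv u f x = 0"
proof -
  have "dir_deriv u f x = dir_deriv u (\<lambda>_. 0) x"
  proof (rule dir_deriv_cong)
    show "open {x. R < norm x}" by (intro open_Collect_less continuous_intros)
  qed (use assms in auto)
  then show ?thesis by simp
qed

lemma bounded_of_compact_support:
  fixes f :: "'a::euclidean_space \<Rightarrow> 'b::real_normed_vector"
  assumes "continuous_on UNIV f" "\<And>x. R < norm x \<Longrightarrow> f x = 0"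
  obtains B where "\<And>x. norm (f x) \<le> B"
proof -
  have "compact (f ` cball 0 R)"
    by (intro compact_continuous_image continuous_on_subset[OF assms(1)]) auto
  then obtain B where B: "\<And>x. x \<in> cball 0 R \<Longrightarrow> norm (f x) \<le> B"
    using compact_imp_bounded bounded_iff by (metis image_eqI)
  have "norm (f x) \<le> max B 0" for x
    using B[of x] assms(2)[of x] by (cases "norm x \<le> R") auto
  then show ?thesis using that by blast
qed

text \<open>The field \<open>cutoff k x * Y b x\<close> is smooth everywhere, so its derivatives
  integrate to 0; the product rule and the limit in k do the rest. The size allowed for Y, a
  multiple of |x| + (n - 1) / |x|, makes the flux through small spheres vanish; in dimension 1 the
  field itself must tend to 0. The bound on derivatives concerns the divergence as a whole, in which
  more singular terms may cancel.\<close>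

theorem divergence_theorem_singular:
  fixes Y :: "'a::euclidean_space \<Rightarrow> 'a \<Rightarrow> real"
  assumes dim: "DIM('a) \<noteq> 2"
    and smooth: "\<And>b. b \<in> Basis \<Longrightarrow> smooth_on (- {0}) (Y b)"
    and supp: "\<And>b x. b \<in> Basis \<Longrightarrow> R \<le> norm x \<Longrightarrow> Y b x = 0"
    and bound: "\<And>b x. b \<in> Basis \<Longrightarrow> x \<noteq> 0 \<Longrightarrow> \<bar>Y b x\<bar> \<le> K * norm x * sing x"
    and div_bound: "\<And>x. x \<noteq> 0 \<Longrightarrow> \<bar>\<Sum>b\<in>Basis. dir_deriv b (Y b) x\<bar> \<le> K * sing x"
  shows "has_bochner_integral lborel (\<lambda>x. \<Sum>b\<in>Basis. dir_deriv b (Y b) x) 0"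
proof -
  define D where "D = (\<lambda>x. \<Sum>b\<in>Basis. dir_deriv b (Y b) x)"
  have mY: "Y b \<in> borel_measurable lborel" if "b \<in> Basis" for b
    by (intro continuous_off_0_borel_measurable smooth_on_continuous_on smooth that)
  have mD: "D \<in> borel_measurable lborel" unfolding D_def
    by (intro continuous_off_0_borel_measurable smooth_on_continuous_on smooth_intros smooth) auto
  \<comment> \<open>On the sphere |x| = R the derivatives of Y are not yet seen to vanish, so the
    radius is enlarged by 1.\<close>
  have D0: "D x = 0" if "R + 1 \<le> norm x" for x
    unfolding D_def using that by (intro sum.neutral ballI dir_deriv_zero_off[of R] supp) auto
  have aeD: "AE x in lborel. norm (D x) \<le> K * sing x"
    using AE_lborel_singleton[of "0::'a"] by eventually_elim (simp add: D_def div_bound)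
  have aeY: "AE x in lborel. norm (Y b x) \<le> K * norm x * sing x" if "b \<in> Basis" for b
    using AE_lborel_singleton[of "0::'a"] by eventually_elim (simp add: bound that)
  have zero: "has_bochner_integral lborel (dir_deriv b (\<lambda>x. cutoff k x * Y b x)) 0" if b: "b \<in> Basis" for b k
  proof -
    have s: "smooth_on UNIV (\<lambda>x. cutoff k x * Y b x)"
      by (rule smooth_on_cutoff_mult[OF smooth[OF b]])
    have c: "continuous_on UNIV (dir_deriv b (\<lambda>x. cutoff k x * Y b x))"
      by (intro smooth_on_continuous_on smooth_on_dir_deriv s)
    obtain L where "\<And>x. norm (dir_deriv b (\<lambda>x. cutoff k x * Y b x) x) \<le> L"
      by (rule bounded_of_compact_support[OF c, of R])
        (auto intro!: dir_deriv_zero_off[of R] simp: supp b)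
    then show ?thesis
      using s supp[OF b] continuous_on_subset[OF c]
      by (intro has_bochner_integral_dir_deriv[of _ R _ L])
        (auto intro: smooth_on_continuous_on smooth_on_differentiable)
  qed
  have I1: "integrable lborel (\<lambda>x. cutoff k x * D x)" for k
    by (rule integral_cutoff_tendsto(2)[OF dim mD aeD D0])
  have I2: "integrable lborel (\<lambda>x. dir_deriv b (cutoff k) x * Y b x)" if "b \<in> Basis" for b k
    using integral_cutoff_deriv_tendsto_0(2)[OF dim mY[OF that] aeY[OF that] supp[OF that], where u = "\<lambda>_. b"] that
    by auto
  have eq: "(\<integral>x. cutoff k x * D x \<partial>lborel) = - (\<Sum>b\<in>Basis. \<integral>x. dir_deriv b (cutoff k) x * Y b x \<partial>lborel)" for k
  proof -
    have "AE x in lborel. cutoff k x * D x + (\<Sum>b\<in>Basis. dir_deriv b (cutoff k) x * Y b x) =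
        (\<Sum>b\<in>Basis. dir_deriv b (\<lambda>x. cutoff k x * Y b x) x)"
      using AE_lborel_singleton[of "0::'a"]
    proof eventually_elim
      case (elim x)
      have "dir_deriv b (\<lambda>x. cutoff k x * Y b x) x = cutoff k x * dir_deriv b (Y b) x + dir_deriv b (cutoff k) x * Y b x"
        if "b \<in> Basis" for b
        using elim that by (intro dir_deriv_mult smooth_on_differentiable[OF smooth_on_cutoff]
            smooth_on_differentiable[OF smooth]) auto
      then show ?case by (simp add: D_def sum_distrib_left sum.distrib)
    qed
    then have "(\<integral>x. cutoff k x * D x + (\<Sum>b\<in>Basis. dir_deriv b (cutoff k) x * Y b x) \<partial>lborel) =
        (\<integral>x. (\<Sum>b\<in>Basis. dir_deriv b (\<lambda>x. cutoff k x * Y b x) x) \<partial>lborel)"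
      using zero I1 I2 by (intro integral_cong_AE borel_measurable_integrable
          Bochner_Integration.integrable_add Bochner_Integration.integrable_sum)
        (auto simp: has_bochner_integral_iff)
    also have "\<dots> = (\<Sum>b\<in>Basis. \<integral>x. dir_deriv b (\<lambda>x. cutoff k x * Y b x) x \<partial>lborel)"
      using zero by (intro Bochner_Integration.integral_sum) (auto simp: has_bochner_integral_iff)
    also have "\<dots> = 0"
      using zero by (intro sum.neutral) (auto simp: has_bochner_integral_iff)
    finally show ?thesis
      using I1 I2 by (subst (asm) Bochner_Integration.integral_add) (auto simp: Bochner_Integration.integral_sum)
  qed
  have "(\<lambda>k. \<integral>x. cutoff k x * D x \<partial>lborel) \<longlonglongrightarrow> - (\<Sum>b\<in>(Basis::'a set). 0)"
    unfolding eq
  proof (intro tendsto_minus tendsto_sum)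
    fix b :: 'a assume b: "b \<in> Basis"
    show "(\<lambda>k. \<integral>x. dir_deriv b (cutoff k) x * Y b x \<partial>lborel) \<longlonglongrightarrow> 0"
      using integral_cutoff_deriv_tendsto_0(1)[OF dim mY[OF b] aeY[OF b] supp[OF b], where u = "\<lambda>_. b"] b by simp
  qed
  moreover have "(\<lambda>k. \<integral>x. cutoff k x * D x \<partial>lborel) \<longlonglongrightarrow> (\<integral>x. D x \<partial>lborel)"
    by (rule integral_cutoff_tendsto(1)[OF dim mD aeD D0])
  ultimately have "(\<integral>x. D x \<partial>lborel) = 0"
    using LIMSEQ_unique by fastforce
  moreover have "integrable lborel D"
    by (rule integrable_sing_bound[OF dim mD aeD D0])
  ultimately show ?thesis
    unfolding D_def has_bochner_integral_iff by simp
qed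

section \<open>The radial multiplier identity\<close>

definition Euler :: "('a::euclidean_space \<Rightarrow> 'b::euclidean_space) \<Rightarrow> 'a \<Rightarrow> 'b" where
  "Euler g x = (\<Sum>c\<in>Basis. (x \<bullet> c) *\<^sub>R dir_deriv c g x)"

text \<open>\<open>r^(- (n - 1) / 2) \<partial>\<^sub>r (r^((n - 1) / 2) g)\<close>, with \<open>Euler g = r \<partial>\<^sub>r g\<close>.\<close>

definition half_deriv :: "('a::euclidean_space \<Rightarrow> 'b::euclidean_space) \<Rightarrow> 'a \<Rightarrow> 'b" where
  "half_deriv g x = (1 / norm x) *\<^sub>R Euler g x + ((real DIM('a) - 1) / (2 * norm x)) *\<^sub>R g x"

definition grad_sq :: "('a::euclidean_space \<Rightarrow> 'b::euclidean_space) \<Rightarrow> 'a \<Rightarrow> real" where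
  "grad_sq g x = (\<Sum>b\<in>Basis. dir_deriv b g x \<bullet> dir_deriv b g x)"

definition divg :: "('a::euclidean_space \<Rightarrow> 'a \<Rightarrow> real) \<Rightarrow> 'a \<Rightarrow> real" where
  "divg Y x = (\<Sum>b\<in>Basis. dir_deriv b (Y b) x)"

lemma open_off_0 [simp]: "open (- {0::'a::euclidean_space})"
  by (simp add: open_Compl)

lemma smooth_on_coord [smooth_intros]: "smooth_on S (\<lambda>x. x \<bullet> b)"
  by (rule smooth_on_subset[of UNIV]) (auto intro!: smooth_intros)

lemma dir_deriv_coord: "dir_deriv u (\<lambda>x. x \<bullet> b) x = u \<bullet> b"
  by (rule dir_deriv_eqI) (auto intro!: derivative_eq_intros)

lemma sum_Basis_inner_square: "(\<Sum>b\<in>Basis. (x \<bullet> b) * (x \<bullet> b)) = (norm (x::'a::euclidean_space))\<^sup>2"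
  by (simp add: euclidean_inner[symmetric] dot_square_norm)

lemma dir_deriv_inner_self:
  assumes "g differentiable (at x)"
  shows "dir_deriv u (\<lambda>x. g x \<bullet> g x) x = 2 * (g x \<bullet> dir_deriv u g x)"
  using dir_deriv_inner[OF assms assms, of u] by (simp add: inner_commute)

section \<open>Pointwise divergence formulas\<close>

lemma divg_add:
  assumes "\<And>b. b \<in> Basis \<Longrightarrow> X b differentiable (at x)" "\<And>b. b \<in> Basis \<Longrightarrow> Y b differentiable (at x)"
  shows "divg (\<lambda>b x. X b x + Y b x) x = divg X x + divg Y x"
  unfolding divg_def using assms by (simp add: dir_deriv_add sum.distrib)

lemma divg_radial_mult:
  assumes "x \<noteq> (0::'a::euclidean_space)" "smooth_on {0<..} \<alpha>" "\<And>b. b \<in> Basis \<Longrightarrow> smooth_on (- {0}) (X b)"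
    and "(\<alpha> has_real_derivative \<alpha>') (at (norm x))"
  shows "divg (\<lambda>b x. \<alpha> (norm x) * X b x) x = \<alpha>' / norm x * (\<Sum>b\<in>Basis. (x \<bullet> b) * X b x) + \<alpha> (norm x) * divg X x"
proof -
  have "dir_deriv b (\<lambda>x. \<alpha> (norm x) * X b x) x =
      \<alpha> (norm x) * dir_deriv b (X b) x + \<alpha>' / norm x * ((x \<bullet> b) * X b x)" if "b \<in> Basis" for b
  proof -
    have "dir_deriv b (\<lambda>x. \<alpha> (norm x)) x = (x \<bullet> b) / norm x * \<alpha>'"
      using dir_deriv_norm_compose[OF assms(1), of \<alpha> \<alpha>' b] assms(4)
      by (simp add: has_real_derivative_iff_has_vector_derivative)
    then show ?thesis
      using assms that by (subst dir_deriv_mult)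
        (auto intro!: smooth_on_differentiable[of "- {0}"] smooth_on_norm_compose)
  qed
  then show ?thesis
    by (simp add: divg_def sum.distrib sum_distrib_left)
qed

lemma smooth_on_divide_power:
  fixes w :: "real \<Rightarrow> real"
  assumes "smooth_on {0<..} w"
  shows "smooth_on {0<..} (\<lambda>r. w r / r ^ k)"
proof (subst smooth_on_cong)
  show "w r / r ^ k = w r * r powr (- real k)" if "r \<in> {0<..}" for r :: real
    using that by (simp add: powr_minus powr_realpow divide_inverse)
qed (auto intro!: smooth_on_mult smooth_on_powr assms)

text \<open>The arithmetic of the multiplier identity with its analytic quantities as atoms: Q is
  |grad g|^2, S stands for \<open>Euler g\<close>, L for the Laplacian of g, and a pair of letters
  for an inner product. T collects second derivatives and cancels.\<close>

lemma multiplier_algebra: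
  fixes r :: real
  assumes "r \<noteq> 0"
  shows "2 * (w' / r - w / r\<^sup>2) / r * SS + 2 * (w / r) * (LS + Q + T)
    + (- (w' / r - w / r\<^sup>2) / r * (r\<^sup>2 * Q) + - (w / r) * (n * Q + 2 * T))
    + ((n - 1) * (w' / r - w / r\<^sup>2) / r * Sg + (n - 1) * (w / r) * (Lg + Q))
    + ((n - 1) / 2 * (w' / r ^ 3 - 3 * w / r ^ 4) / r * (r\<^sup>2 * gg)
      + (n - 1) / 2 * (w / r ^ 3) * (n * gg + 2 * Sg))
   = 2 * w * (LS / r + (n - 1) / (2 * r) * Lg)
    + w' * (SS / r\<^sup>2 + (n - 1) / r\<^sup>2 * Sg + (n - 1)\<^sup>2 / (4 * r\<^sup>2) * gg)
    + (2 * w / r - w') * (Q - SS / r\<^sup>2 + (n - 1) * (n - 3) / 4 * gg / r\<^sup>2)"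
proof -
  \<comment> \<open>With i for 1/r both sides become polynomials, and the identity is checked by
    expansion.\<close>
  define i where "i = inverse r"
  have e: "- (w' / r - w / r\<^sup>2) / r * (r\<^sup>2 * Q) = - ((w' - w * i) * Q)"
    "(n - 1) / 2 * (w' / r ^ 3 - 3 * w / r ^ 4) / r * (r\<^sup>2 * gg)
      = (n - 1) / 2 * ((w' * i ^ 2 - 3 * w * i ^ 3) * gg)"
    using assms by (simp_all add: i_def field_simps eval_nat_numeral)
  have d: "c / r = c * i" "c / r\<^sup>2 = c * i ^ 2" "c / r ^ 3 = c * i ^ 3"
    "c / (2 * r) = c / 2 * i" "c / (4 * r\<^sup>2) = c / 4 * i ^ 2" for c
    using assms by (simp_all add: i_def field_simps)
  have "2 * (w' / r - w / r\<^sup>2) / r * SS + 2 * (w / r) * (LS + Q + T)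
    + (- (w' / r - w / r\<^sup>2) / r * (r\<^sup>2 * Q) + - (w / r) * (n * Q + 2 * T))
    + ((n - 1) * (w' / r - w / r\<^sup>2) / r * Sg + (n - 1) * (w / r) * (Lg + Q))
    + ((n - 1) / 2 * (w' / r ^ 3 - 3 * w / r ^ 4) / r * (r\<^sup>2 * gg)
      + (n - 1) / 2 * (w / r ^ 3) * (n * gg + 2 * Sg))
    = 2 * (w' * i - w * i ^ 2) * i * SS + 2 * (w * i) * (LS + Q + T)
    + (- ((w' - w * i) * Q) + - (w * i) * (n * Q + 2 * T))
    + ((n - 1) * (w' * i - w * i ^ 2) * i * Sg + (n - 1) * (w * i) * (Lg + Q))
    + ((n - 1) / 2 * ((w' * i ^ 2 - 3 * w * i ^ 3) * gg)
      + (n - 1) / 2 * (w * i ^ 3) * (n * gg + 2 * Sg))"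
    by (subst e(1), subst e(2)) (simp only: d)
  also have "\<dots> = 2 * w * (LS * i + (n - 1) / 2 * i * Lg)
    + w' * (SS * i ^ 2 + (n - 1) * i ^ 2 * Sg + (n - 1)\<^sup>2 / 4 * i ^ 2 * gg)
    + (2 * w * i - w') * (Q - SS * i ^ 2 + (n - 1) * (n - 3) / 4 * gg * i ^ 2)"
    by (simp add: field_simps eval_nat_numeral)
  finally show ?thesis
    unfolding d .
qed

lemma smooth_on_Euler: "smooth_on (- {0}) g \<Longrightarrow> smooth_on (- {0}) (Euler g)"
  unfolding Euler_def by (intro smooth_intros) auto

lemma smooth_on_grad_sq: "smooth_on (- {0}) g \<Longrightarrow> smooth_on (- {0}) (grad_sq g)"
  unfolding grad_sq_def by (intro smooth_intros) auto

context
  fixes g :: "'a::euclidean_space \<Rightarrow> 'b::euclidean_space" and x :: 'a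
  assumes g: "smooth_on (- {0}) g" and x: "x \<noteq> 0"
begin

private lemma diffs: "g differentiable (at x)" "dir_deriv u g differentiable (at x)"
  using g x by (auto intro!: smooth_on_differentiable[of "- {0}"] smooth_intros)

text \<open>Half of x . grad |grad g|^2. It occurs once in \<open>div1\<close>, multiplied later by
  2 w / r, and twice in \<open>div2\<close>, multiplied by - w / r, so it cancels in the
  sum.\<close>

private definition "T = (\<Sum>b\<in>Basis. \<Sum>c\<in>Basis. (x \<bullet> c) * (dir_deriv b g x \<bullet> dir_deriv b (dir_deriv c g) x))"

private lemma div1: "divg (\<lambda>b x. dir_deriv b g x \<bullet> Euler g x) x = laplacian g x \<bullet> Euler g x + grad_sq g x + T"
proof -
  have E: "dir_deriv b (Euler g) x = dir_deriv b g x + (\<Sum>c\<in>Basis. (x \<bullet> c) *\<^sub>R dir_deriv b (dir_deriv c g) x)"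
    if "b \<in> Basis" for b
  proof -
    have "dir_deriv b (Euler g) x = (\<Sum>c\<in>Basis. dir_deriv b (\<lambda>x. (x \<bullet> c) *\<^sub>R dir_deriv c g x) x)"
      unfolding Euler_def using x
      by (intro dir_deriv_sum smooth_on_differentiable[of "- {0}"] smooth_intros g) auto
    also have "\<dots> = (\<Sum>c\<in>Basis. (x \<bullet> c) *\<^sub>R dir_deriv b (dir_deriv c g) x + (b \<bullet> c) *\<^sub>R dir_deriv c g x)"
      by (intro sum.cong refl, subst dir_deriv_scaleR)
        (use x in \<open>auto intro!: diffs smooth_on_differentiable[of "- {0}"] smooth_intros simp: dir_deriv_coord\<close>)
    also have "\<dots> = dir_deriv b g x + (\<Sum>c\<in>Basis. (x \<bullet> c) *\<^sub>R dir_deriv b (dir_deriv c g) x)"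
      using dir_deriv_sum_Basis[OF diffs(1), of b] by (simp add: sum.distrib)
    finally show ?thesis .
  qed
  have "divg (\<lambda>b x. dir_deriv b g x \<bullet> Euler g x) x =
      (\<Sum>b\<in>Basis. dir_deriv b g x \<bullet> dir_deriv b (Euler g) x + dir_deriv b (dir_deriv b g) x \<bullet> Euler g x)"
    unfolding divg_def using x
    by (intro sum.cong refl dir_deriv_inner diffs smooth_on_differentiable[OF smooth_on_Euler[OF g]]) auto
  then show ?thesis
    by (simp add: E inner_add_right inner_sum_right sum.distrib T_def grad_sq_def laplacian_def inner_sum_left)
qed

text \<open>Symmetry of second derivatives enters here: it turns the derivative of |grad g|^2 along
  x into 2 T.\<close>

private lemma div2: "divg (\<lambda>b x. (x \<bullet> b) * grad_sq g x) x = real DIM('a) * grad_sq g x + 2 * T"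
proof -
  have "dir_deriv b (grad_sq g) x = (\<Sum>c\<in>Basis. 2 * (dir_deriv c g x \<bullet> dir_deriv c (dir_deriv b g) x))" for b
  proof -
    have "dir_deriv b (grad_sq g) x = (\<Sum>c\<in>Basis. dir_deriv b (\<lambda>x. dir_deriv c g x \<bullet> dir_deriv c g x) x)"
      unfolding grad_sq_def using x
      by (intro dir_deriv_sum smooth_on_differentiable[of "- {0}"] smooth_intros g) auto
    then show ?thesis
      using dir_deriv_commute[OF open_off_0 g, of x b] x
      by (simp add: dir_deriv_inner_self[OF diffs(2)])
  qed
  then have "divg (\<lambda>b x. (x \<bullet> b) * grad_sq g x) x =
      (\<Sum>b\<in>Basis. (x \<bullet> b) * (\<Sum>c\<in>Basis. 2 * (dir_deriv c g x \<bullet> dir_deriv c (dir_deriv b g) x)) + (b \<bullet> b) * grad_sq g x)"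
    unfolding divg_def using x
    by (intro sum.cong refl, subst dir_deriv_mult)
      (auto intro!: smooth_on_differentiable[OF smooth_on_grad_sq[OF g]] smooth_on_differentiable[OF smooth_on_coord[of UNIV]]
        simp: dir_deriv_coord)
  also have "\<dots> = (\<Sum>b\<in>Basis. \<Sum>c\<in>Basis. (x \<bullet> b) * (2 * (dir_deriv c g x \<bullet> dir_deriv c (dir_deriv b g) x)))
      + real DIM('a) * grad_sq g x"
    by (simp add: sum.distrib sum_distrib_left)
  also have "(\<Sum>b\<in>Basis. \<Sum>c\<in>Basis. (x \<bullet> b) * (2 * (dir_deriv c g x \<bullet> dir_deriv c (dir_deriv b g) x))) = 2 * T"
    unfolding T_def by (subst sum.swap) (simp add: sum_distrib_left algebra_simps)
  finally show ?thesis by simp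
qed

private lemma div3: "divg (\<lambda>b x. dir_deriv b g x \<bullet> g x) x = laplacian g x \<bullet> g x + grad_sq g x"
  by (simp add: divg_def dir_deriv_inner[OF diffs(2) diffs(1)] sum.distrib laplacian_def grad_sq_def inner_sum_left)

private lemma div4: "divg (\<lambda>b x. (x \<bullet> b) * (g x \<bullet> g x)) x = real DIM('a) * (g x \<bullet> g x) + 2 * (Euler g x \<bullet> g x)"
proof -
  have "dir_deriv b (\<lambda>x. (x \<bullet> b) * (g x \<bullet> g x)) x = (x \<bullet> b) * (2 * (g x \<bullet> dir_deriv b g x)) + (g x \<bullet> g x)"
    if "b \<in> Basis" for b
    using that x dir_deriv_mult[OF smooth_on_differentiable[OF smooth_on_coord[of UNIV b]]
        smooth_on_differentiable[OF smooth_on_inner[OF open_off_0 g g]], of x b]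
    by (simp add: dir_deriv_coord dir_deriv_inner_self[OF diffs(1)])
  then show ?thesis
    unfolding divg_def inner_commute[of "Euler g x"]
    by (simp add: sum.distrib Euler_def inner_sum_right sum_distrib_left algebra_simps)
qed

private lemma radial_sums:
  "(\<Sum>b\<in>Basis. (x \<bullet> b) * (dir_deriv b g x \<bullet> Euler g x)) = Euler g x \<bullet> Euler g x"
  "(\<Sum>b\<in>Basis. (x \<bullet> b) * (dir_deriv b g x \<bullet> g x)) = Euler g x \<bullet> g x"
  "(\<Sum>b\<in>Basis. (x \<bullet> b) * ((x \<bullet> b) * c)) = (norm x)\<^sup>2 * c"
proof -
  show "(\<Sum>b\<in>Basis. (x \<bullet> b) * (dir_deriv b g x \<bullet> g x)) = Euler g x \<bullet> g x"
    unfolding Euler_def by (simp add: inner_sum_left)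
  have "(\<Sum>b\<in>Basis. (x \<bullet> b) * (dir_deriv b g x \<bullet> y)) = Euler g x \<bullet> y" for y
    unfolding Euler_def by (simp add: inner_sum_left)
  then show "(\<Sum>b\<in>Basis. (x \<bullet> b) * (dir_deriv b g x \<bullet> Euler g x)) = Euler g x \<bullet> Euler g x" .
  show "(\<Sum>b\<in>Basis. (x \<bullet> b) * ((x \<bullet> b) * c)) = (norm x)\<^sup>2 * c"
    by (simp add: sum_distrib_right[symmetric] mult.assoc[symmetric] sum_Basis_inner_square)
qed

lemma norm_half_deriv_sq:
  "half_deriv g x \<bullet> half_deriv g x = (Euler g x \<bullet> Euler g x) / (norm x)\<^sup>2
    + (real DIM('a) - 1) / (norm x)\<^sup>2 * (Euler g x \<bullet> g x)
    + (real DIM('a) - 1)\<^sup>2 / (4 * (norm x)\<^sup>2) * (g x \<bullet> g x)"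
  using x by (simp add: half_deriv_def inner_add_left inner_add_right inner_commute[of "g x" "Euler g x"]
      field_simps power2_eq_square)

text \<open>The mixed term in |D g|^2 is a divergence up to a multiple of |g|^2 / r^2. This is the
  usual route to Hardy's inequality and the origin of the coefficient (n - 1) (n - 3) / 4.\<close>

lemma half_deriv_sq_eq:
  "half_deriv g x \<bullet> half_deriv g x = (Euler g x \<bullet> Euler g x) / (norm x)\<^sup>2
    + divg (\<lambda>b x. ((real DIM('a) - 1) / 2 / (norm x)\<^sup>2) * ((x \<bullet> b) * (g x \<bullet> g x))) x
    - (real DIM('a) - 1) * (real DIM('a) - 3) / 4 * (g x \<bullet> g x) / (norm x)\<^sup>2"
proof -
  have s: "smooth_on {0<..} (\<lambda>r::real. (real DIM('a) - 1) / 2 / r\<^sup>2)"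
    by (intro smooth_on_divide_power smooth_on_const)
  have "((\<lambda>r::real. (real DIM('a) - 1) / 2 / r\<^sup>2) has_real_derivative - (real DIM('a) - 1) / norm x ^ 3) (at (norm x))"
    using x by (auto intro!: derivative_eq_intros simp: field_simps eval_nat_numeral)
  then have D: "divg (\<lambda>b x. ((real DIM('a) - 1) / 2 / (norm x)\<^sup>2) * ((x \<bullet> b) * (g x \<bullet> g x))) x =
      - (real DIM('a) - 1) / norm x ^ 3 / norm x * ((norm x)\<^sup>2 * (g x \<bullet> g x))
      + (real DIM('a) - 1) / 2 / (norm x)\<^sup>2 * (real DIM('a) * (g x \<bullet> g x) + 2 * (Euler g x \<bullet> g x))"
    using divg_radial_mult[OF x s, of "\<lambda>b x. (x \<bullet> b) * (g x \<bullet> g x)"]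
    by (simp add: div4 radial_sums smooth_intros g)
  show ?thesis
    unfolding D norm_half_deriv_sq using x
    by (simp add: inner_commute[of "g x" "Euler g x"] field_simps power2_eq_square eval_nat_numeral)
qed

text \<open>In polar coordinates, with \<open>u = r^((n - 1) / 2) g\<close>, this is the radial derivative of
  \<open>w |\<partial>\<^sub>r u|\<^sup>2 - w r\<^sup>-\<^sup>2 (|\<nabla>\<^sub>\<omega> u|\<^sup>2 + (n - 1) (n - 3) / 4 |u|\<^sup>2)\<close> integrated over spheres.\<close>

lemma radial_multiplier_identity:
  fixes w :: "real \<Rightarrow> real"
  assumes w: "smooth_on {0<..} w" "(w has_real_derivative w') (at (norm x))"
  defines "Y \<equiv> \<lambda>b x. (2 * (w (norm x) / norm x)) * (dir_deriv b g x \<bullet> Euler g x)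
      + (- (w (norm x) / norm x)) * ((x \<bullet> b) * grad_sq g x)
      + ((real DIM('a) - 1) * (w (norm x) / norm x)) * (dir_deriv b g x \<bullet> g x)
      + ((real DIM('a) - 1) / 2 * (w (norm x) / norm x ^ 3)) * ((x \<bullet> b) * (g x \<bullet> g x))"
  shows "divg Y x = 2 * w (norm x) * (laplacian g x \<bullet> half_deriv g x)
    + w' * (half_deriv g x \<bullet> half_deriv g x)
    + (2 * w (norm x) / norm x - w') * (grad_sq g x - (Euler g x \<bullet> Euler g x) / (norm x)\<^sup>2
      + (real DIM('a) - 1) * (real DIM('a) - 3) / 4 * (g x \<bullet> g x) / (norm x)\<^sup>2)"
    and "\<And>b. smooth_on (- {0}) (Y b)"
proof -
  \<comment> \<open>The first two terms of Y are the Rellich-Pohozaev field for the multiplier 2 w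
    d_r; the third completes d_r to D; the fourth removes the mixed term in w / r^3 that the third
    leaves behind.\<close>
  let ?N = "real DIM('a) - 1" and ?r = "norm x"
  have inv: "smooth_on {0<..} (\<lambda>r::real. w r / r ^ k)" for k
    by (intro smooth_on_divide_power w)
  have a: "smooth_on {0<..} (\<lambda>r. c * (w r / r))" "smooth_on {0<..} (\<lambda>r. - (w r / r))" for c
    by (intro smooth_on_mult smooth_on_minus smooth_on_const inv[of 1, unfolded power_one_right] open_greaterThan)+
  have b: "smooth_on {0<..} (\<lambda>r. c * (w r / r ^ 3))" for c
    by (intro smooth_on_mult smooth_on_const inv open_greaterThan)
  have a': "((\<lambda>r. w r / r) has_real_derivative w' / ?r - w ?r / ?r\<^sup>2) (at ?r)"
    using x by (auto intro!: derivative_eq_intros w simp: field_simps power2_eq_square)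
  have b': "((\<lambda>r. w r / r ^ 3) has_real_derivative w' / ?r ^ 3 - 3 * w ?r / ?r ^ 4) (at ?r)"
    using x by (auto intro!: derivative_eq_intros w simp: field_simps eval_nat_numeral)
  have X: "smooth_on (- {0}) (\<lambda>x. dir_deriv b g x \<bullet> Euler g x)"
    "smooth_on (- {0}) (\<lambda>x. (x \<bullet> b) * grad_sq g x)"
    "smooth_on (- {0}) (\<lambda>x. dir_deriv b g x \<bullet> g x)"
    "smooth_on (- {0}) (\<lambda>x. (x \<bullet> b) * (g x \<bullet> g x))" for b
    by (intro smooth_intros g smooth_on_Euler[OF g] smooth_on_grad_sq[OF g] open_off_0)+
  have Ys: "smooth_on (- {0}) (\<lambda>x. (2 * (w (norm x) / norm x)) * (dir_deriv b g x \<bullet> Euler g x))"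
    "smooth_on (- {0}) (\<lambda>x. (- (w (norm x) / norm x)) * ((x \<bullet> b) * grad_sq g x))"
    "smooth_on (- {0}) (\<lambda>x. (?N * (w (norm x) / norm x)) * (dir_deriv b g x \<bullet> g x))"
    "smooth_on (- {0}) (\<lambda>x. (?N / 2 * (w (norm x) / norm x ^ 3)) * ((x \<bullet> b) * (g x \<bullet> g x)))" for b
    by (intro smooth_on_mult[OF open_off_0] X smooth_on_norm_compose[OF a(1)] smooth_on_norm_compose[OF a(2)]
        smooth_on_norm_compose[OF b])+
  show "smooth_on (- {0}) (Y b)" for b
    unfolding Y_def by (intro smooth_on_add[OF open_off_0] Ys)
  have "divg Y x = divg (\<lambda>b x. (2 * (w (norm x) / norm x)) * (dir_deriv b g x \<bullet> Euler g x)) x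
      + divg (\<lambda>b x. (- (w (norm x) / norm x)) * ((x \<bullet> b) * grad_sq g x)) x
      + divg (\<lambda>b x. (?N * (w (norm x) / norm x)) * (dir_deriv b g x \<bullet> g x)) x
      + divg (\<lambda>b x. (?N / 2 * (w (norm x) / norm x ^ 3)) * ((x \<bullet> b) * (g x \<bullet> g x))) x"
    unfolding Y_def using x
    by (simp only: divg_add smooth_on_differentiable[OF Ys(1)] smooth_on_differentiable[OF Ys(2)]
        smooth_on_differentiable[OF Ys(3)] smooth_on_differentiable[OF Ys(4)] differentiable_add
        Compl_iff singleton_iff not_False_eq_True)
  also have "divg (\<lambda>b x. (2 * (w (norm x) / norm x)) * (dir_deriv b g x \<bullet> Euler g x)) x =
      2 * (w' / ?r - w ?r / ?r\<^sup>2) / ?r * (Euler g x \<bullet> Euler g x)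
      + 2 * (w ?r / ?r) * (laplacian g x \<bullet> Euler g x + grad_sq g x + T)"
    using divg_radial_mult[OF x a(1) X(1) DERIV_cmult[OF a', of 2]] by (simp only: div1 radial_sums)
  also have "divg (\<lambda>b x. (- (w (norm x) / norm x)) * ((x \<bullet> b) * grad_sq g x)) x =
      - (w' / ?r - w ?r / ?r\<^sup>2) / ?r * (?r\<^sup>2 * grad_sq g x)
      + - (w ?r / ?r) * (real DIM('a) * grad_sq g x + 2 * T)"
    using divg_radial_mult[OF x a(2) X(2) DERIV_minus[OF a']] by (simp only: div2 radial_sums)
  also have "divg (\<lambda>b x. (?N * (w (norm x) / norm x)) * (dir_deriv b g x \<bullet> g x)) x =
      ?N * (w' / ?r - w ?r / ?r\<^sup>2) / ?r * (Euler g x \<bullet> g x)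
      + ?N * (w ?r / ?r) * (laplacian g x \<bullet> g x + grad_sq g x)"
    using divg_radial_mult[OF x a(1) X(3) DERIV_cmult[OF a', of ?N]] by (simp only: div3 radial_sums)
  also have "divg (\<lambda>b x. (?N / 2 * (w (norm x) / norm x ^ 3)) * ((x \<bullet> b) * (g x \<bullet> g x))) x =
      ?N / 2 * (w' / ?r ^ 3 - 3 * w ?r / ?r ^ 4) / ?r * (?r\<^sup>2 * (g x \<bullet> g x))
      + ?N / 2 * (w ?r / ?r ^ 3) * (real DIM('a) * (g x \<bullet> g x) + 2 * (Euler g x \<bullet> g x))"
    using divg_radial_mult[OF x b X(4) DERIV_cmult[OF b', of "?N / 2"]] by (simp only: div4 radial_sums)
  also have "2 * (w' / ?r - w ?r / ?r\<^sup>2) / ?r * (Euler g x \<bullet> Euler g x)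
      + 2 * (w ?r / ?r) * (laplacian g x \<bullet> Euler g x + grad_sq g x + T)
      + (- (w' / ?r - w ?r / ?r\<^sup>2) / ?r * (?r\<^sup>2 * grad_sq g x)
        + - (w ?r / ?r) * (real DIM('a) * grad_sq g x + 2 * T))
      + (?N * (w' / ?r - w ?r / ?r\<^sup>2) / ?r * (Euler g x \<bullet> g x)
        + ?N * (w ?r / ?r) * (laplacian g x \<bullet> g x + grad_sq g x))
      + (?N / 2 * (w' / ?r ^ 3 - 3 * w ?r / ?r ^ 4) / ?r * (?r\<^sup>2 * (g x \<bullet> g x))
        + ?N / 2 * (w ?r / ?r ^ 3) * (real DIM('a) * (g x \<bullet> g x) + 2 * (Euler g x \<bullet> g x)))
    = 2 * w ?r * (laplacian g x \<bullet> half_deriv g x)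
      + w' * (half_deriv g x \<bullet> half_deriv g x)
      + (2 * w ?r / ?r - w') * (grad_sq g x - (Euler g x \<bullet> Euler g x) / ?r\<^sup>2
        + ?N * (real DIM('a) - 3) / 4 * (g x \<bullet> g x) / ?r\<^sup>2)"
  proof -
    have "laplacian g x \<bullet> half_deriv g x =
        (laplacian g x \<bullet> Euler g x) / ?r + ?N / (2 * ?r) * (laplacian g x \<bullet> g x)"
      by (simp add: half_deriv_def inner_add_right)
    then show ?thesis
      unfolding norm_half_deriv_sq using x by (simp only: multiplier_algebra norm_eq_zero not_False_eq_True)
  qed
  finally show "divg Y x = 2 * w (norm x) * (laplacian g x \<bullet> half_deriv g x)
    + w' * (half_deriv g x \<bullet> half_deriv g x)
    + (2 * w (norm x) / norm x - w') * (grad_sq g x - (Euler g x \<bullet> Euler g x) / (norm x)\<^sup>2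
      + (real DIM('a) - 1) * (real DIM('a) - 3) / 4 * (g x \<bullet> g x) / (norm x)\<^sup>2)" .
qed

end

text \<open>With N = n - 1 and i = 1/|x| the two sides differ by N (1 - i)^2. Products of two
  quantities of size 1 + (n - 1) / |x| are thus dominated by \<open>sing\<close>, also in dimension
  1, where both sides equal 1.\<close>

lemma sing_square_bound:
  assumes "x \<noteq> (0::'a::euclidean_space)"
  shows "(1 + (real DIM('a) - 1) / norm x)\<^sup>2 \<le> real DIM('a) * sing x"
proof -
  define N where "N = real DIM('a) - 1"
  have N: "0 \<le> N" using DIM_positive[where 'a = 'a] unfolding N_def by linarith
  define i where "i = 1 / norm x"
  have "0 \<le> N * (1 - i)\<^sup>2" using N by simp
  then have "(1 + N * i)\<^sup>2 \<le> (1 + N) * (1 + N * i\<^sup>2)"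
    by (simp add: power2_eq_square algebra_simps)
  then show ?thesis
    by (simp add: sing_def N_def i_def power_divide)
qed

text \<open>Cauchy-Schwarz: the radial part of the gradient is no larger than the whole, so the
  angular energy |grad g|^2 - |d_r g|^2 is nonnegative.\<close>

lemma Euler_sq_le: "Euler g x \<bullet> Euler g x \<le> (norm x)\<^sup>2 * grad_sq g (x::'a::euclidean_space)"
proof -
  have "norm (Euler g x) \<le> (\<Sum>c\<in>Basis. \<bar>x \<bullet> c\<bar> * norm (dir_deriv c g x))"
    unfolding Euler_def by (rule order.trans[OF norm_sum]) simp
  then have "(norm (Euler g x))\<^sup>2 \<le> (\<Sum>c\<in>Basis. \<bar>x \<bullet> c\<bar> * norm (dir_deriv c g x))\<^sup>2"
    by (intro power_mono) auto
  also have "\<dots> \<le> (\<Sum>c\<in>Basis. \<bar>x \<bullet> c\<bar>\<^sup>2) * (\<Sum>c\<in>Basis. (norm (dir_deriv c g x))\<^sup>2)"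
    by (rule Cauchy_Schwarz_ineq_sum)
  also have "\<dots> = (norm x)\<^sup>2 * grad_sq g x"
    by (simp add: grad_sq_def dot_square_norm power2_eq_square sum_Basis_inner_square[unfolded power2_eq_square])
  finally show ?thesis by (simp add: dot_square_norm)
qed

lemma smooth_on_half_deriv:
  fixes g :: "'a::euclidean_space \<Rightarrow> 'b::euclidean_space"
  assumes "smooth_on (- {0}) g"
  shows "smooth_on (- {0}) (half_deriv g)"
proof -
  have "smooth_on {0<..} (\<lambda>r::real. 1 / r ^ 1)" "smooth_on {0<..} (\<lambda>r::real. (real DIM('a) - 1) / 2 / r ^ 1)"
    by (intro smooth_on_divide_power smooth_on_const)+
  from this[THEN smooth_on_norm_compose]
  have "smooth_on (- {0}) (\<lambda>x. (1 / norm x ^ 1) *\<^sub>R Euler g x + ((real DIM('a) - 1) / 2 / norm x ^ 1) *\<^sub>R g x)"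
    by (intro smooth_on_add[OF open_off_0] smooth_on_scaleR[OF open_off_0] smooth_on_Euler[OF assms] assms)
  then show ?thesis
    by (simp add: half_deriv_def[abs_def] mult.commute)
qed

lemma norm_Euler_le:
  assumes "\<And>b. b \<in> Basis \<Longrightarrow> norm (dir_deriv b g x) \<le> C"
  shows "norm (Euler g (x::'a::euclidean_space)) \<le> norm x * (real DIM('a) * C)"
proof -
  have "norm (Euler g x) \<le> (\<Sum>c\<in>(Basis :: 'a set). norm x * C)"
    unfolding Euler_def
    by (intro sum_norm_le) (use assms in \<open>auto intro!: mult_mono Basis_le_norm\<close>)
  then show ?thesis by (simp add: mult.left_commute)
qed

lemma norm_half_deriv_le:
  assumes x: "x \<noteq> (0::'a::euclidean_space)" and "norm (g x) \<le> C" "\<And>b. b \<in> Basis \<Longrightarrow> norm (dir_deriv b g x) \<le> C"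
  shows "norm (half_deriv g x) \<le> real DIM('a) * C * (1 + (real DIM('a) - 1) / norm x)"
proof -
  let ?n = "real DIM('a)"
  have n: "1 \<le> ?n" using DIM_positive[where 'a = 'a] by linarith
  have C: "0 \<le> C" using order.trans[OF norm_ge_zero assms(2)] .
  have "norm (half_deriv g x) \<le> norm (Euler g x) / norm x + (?n - 1) / (2 * norm x) * norm (g x)"
    unfolding half_deriv_def using n by (intro order.trans[OF norm_triangle_ineq] add_mono) auto
  also have "\<dots> \<le> ?n * C + (?n - 1) / norm x * (?n * C)"
  proof (intro add_mono mult_mono)
    show "norm (Euler g x) / norm x \<le> ?n * C"
      using x norm_Euler_le[OF assms(3)] by (simp add: field_simps)
    show "(?n - 1) / (2 * norm x) \<le> (?n - 1) / norm x"
      using x n by (intro frac_le) auto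
    show "norm (g x) \<le> ?n * C"
      using assms(2) n C mult_right_mono[of 1 ?n C] by simp
  qed (use n C in auto)
  finally show ?thesis by (simp add: algebra_simps)
qed

text \<open>Collects what is known of g = e^(phi/h) v. First derivatives stay bounded near the
  origin, while the Laplacian of the radial weight contributes a term of order (n - 1) / |x|; in
  dimension 1 its bound is a plain constant.\<close>

locale compactly_supported_off_0 =
  fixes g :: "'a::euclidean_space \<Rightarrow> 'b::euclidean_space" and R C n :: real
  assumes n: "n = real DIM('a)"
    and dim: "DIM('a) \<noteq> 2"
    and g: "smooth_on (- {0}) g"
    and supp_g: "\<And>x. R < norm x \<Longrightarrow> g x = 0"
    and R: "1 \<le> R"
    and bound_g: "\<And>x. x \<noteq> 0 \<Longrightarrow> norm (g x) \<le> C"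
    and bound_dg: "\<And>x b. x \<noteq> 0 \<Longrightarrow> b \<in> Basis \<Longrightarrow> norm (dir_deriv b g x) \<le> C"
    and bound_lap: "\<And>x. x \<noteq> 0 \<Longrightarrow> norm (laplacian g x) \<le> C * (1 + (n - 1) / norm x)"
begin

lemmas sing_n = sing_def[where 'a = 'a, folded n]
lemmas sing_square_n = sing_square_bound[where 'a = 'a, folded n]
lemmas half_deriv_n = half_deriv_def[where 'a = 'a and 'b = 'b, folded n]

abbreviation "c\<^sub>n \<equiv> (n - 1) * (n - 3) / 4"

lemma n_ge_1: "1 \<le> n"
  using DIM_positive[where 'a = 'a] unfolding n by linarith

lemma C_nonneg: "0 \<le> C"
proof -
  obtain b :: 'a where "b \<in> Basis" using nonempty_Basis by blast
  then have "b \<noteq> 0" by auto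
  from order.trans[OF norm_ge_zero bound_g[OF this]] show ?thesis .
qed

text \<open>The upper bound keeps the factor n - 1, which matches the coefficient of 1/|x|^2 in
  \<open>sing\<close>; in dimension 1 both vanish.\<close>

lemma c\<^sub>n_bounds: "0 \<le> c\<^sub>n" "c\<^sub>n \<le> n * (n - 1)"
proof -
  show "0 \<le> c\<^sub>n"
  proof (cases "DIM('a) = 1")
    case False
    then have "3 \<le> DIM('a)" using dim DIM_positive[where 'a = 'a] by linarith
    then show ?thesis by (simp add: n)
  qed (simp add: n)
  have "(n - 1) * (n - 3) \<le> (n - 1) * (4 * n)"
    using n_ge_1 by (intro mult_left_mono) auto
  then show "c\<^sub>n \<le> n * (n - 1)"
    by (simp only: pos_divide_le_eq[OF zero_less_numeral] mult_ac)
qed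

lemma supports:
  assumes "R < norm x"
  shows "g x = 0" "dir_deriv b g x = 0" "dir_deriv c (dir_deriv b g) x = 0" "laplacian g x = 0"
    "Euler g x = 0" "half_deriv g x = 0" "grad_sq g x = 0"
proof -
  show *: "g x = 0" "dir_deriv b g x = 0" for b
    using assms by (auto intro: supp_g dir_deriv_zero_off[of R])
  show "dir_deriv c (dir_deriv b g) x = 0" for b c
    using assms by (intro dir_deriv_zero_off[of R]) (auto intro: dir_deriv_zero_off[of R] supp_g)
  then show "laplacian g x = 0" by (simp add: laplacian_def)
  show "Euler g x = 0" "grad_sq g x = 0" by (simp_all add: Euler_def grad_sq_def *)
  then show "half_deriv g x = 0" by (simp add: half_deriv_n *)
qed

lemma bound_Euler: "x \<noteq> 0 \<Longrightarrow> norm (Euler g x) \<le> norm x * (n * C)"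
  unfolding n by (intro norm_Euler_le bound_dg)

lemma bound_grad_sq: "x \<noteq> 0 \<Longrightarrow> grad_sq g x \<le> n * C\<^sup>2"
proof -
  assume x: "x \<noteq> 0"
  have "grad_sq g x \<le> (\<Sum>c\<in>(Basis :: 'a set). C\<^sup>2)"
    unfolding grad_sq_def dot_square_norm using x by (intro sum_mono power_mono bound_dg) auto
  then show ?thesis by (simp add: n)
qed

lemma bound_half_deriv: "x \<noteq> 0 \<Longrightarrow> norm (half_deriv g x) \<le> n * C * (1 + (n - 1) / norm x)"
  unfolding n by (intro norm_half_deriv_le bound_g bound_dg)

lemma bound_half_deriv_sq: "x \<noteq> 0 \<Longrightarrow> half_deriv g x \<bullet> half_deriv g x \<le> n ^ 3 * C\<^sup>2 * sing x"
proof -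
  assume x: "x \<noteq> 0"
  have "half_deriv g x \<bullet> half_deriv g x \<le> (n * C * (1 + (n - 1) / norm x))\<^sup>2"
    unfolding dot_square_norm using bound_half_deriv[OF x] by (intro power_mono) auto
  also have "\<dots> = n\<^sup>2 * C\<^sup>2 * (1 + (n - 1) / norm x)\<^sup>2"
    by (simp add: power_mult_distrib)
  also have "\<dots> \<le> n\<^sup>2 * C\<^sup>2 * (n * sing x)"
    by (intro mult_left_mono sing_square_n x) auto
  finally show ?thesis by (simp add: eval_nat_numeral mult_ac)
qed

lemma bound_hardy: "x \<noteq> 0 \<Longrightarrow> c\<^sub>n * (g x \<bullet> g x) / (norm x)\<^sup>2 \<le> n * C\<^sup>2 * sing x"
proof -
  assume x: "x \<noteq> 0"
  have "c\<^sub>n * (g x \<bullet> g x) / (norm x)\<^sup>2 \<le> n * (n - 1) * C\<^sup>2 / (norm x)\<^sup>2"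
    unfolding dot_square_norm using c\<^sub>n_bounds bound_g[OF x] C_nonneg n_ge_1
    by (intro divide_right_mono mult_mono power_mono) auto
  also have "\<dots> \<le> n * C\<^sup>2 * sing x"
    using n_ge_1 by (simp add: sing_n algebra_simps)
  finally show ?thesis .
qed

lemma bound_radial_sq: "x \<noteq> 0 \<Longrightarrow> (Euler g x \<bullet> Euler g x) / (norm x)\<^sup>2 \<le> n * C\<^sup>2 * sing x"
proof -
  assume x: "x \<noteq> 0"
  have "(Euler g x \<bullet> Euler g x) / (norm x)\<^sup>2 \<le> grad_sq g x"
    using Euler_sq_le[of g x] x by (simp add: field_simps)
  also have "\<dots> \<le> n * C\<^sup>2 * 1" using bound_grad_sq[OF x] by simp
  also have "\<dots> \<le> n * C\<^sup>2 * sing x" using sing_ge_1[of x] n_ge_1 by (intro mult_left_mono) auto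
  finally show ?thesis .
qed

lemma integrable_off_0:
  fixes f :: "'a \<Rightarrow> real"
  assumes "continuous_on (- {0}) f" "\<And>x. x \<noteq> 0 \<Longrightarrow> \<bar>f x\<bar> \<le> K * sing x" "\<And>x. R < norm x \<Longrightarrow> f x = 0"
  shows "integrable lborel f"
proof (rule integrable_sing_bound[OF dim continuous_off_0_borel_measurable[OF assms(1)], of K "R + 1"])
  show "AE x in lborel. norm (f x) \<le> K * sing x"
    using AE_lborel_singleton[of "0::'a"] by eventually_elim (simp add: assms)
qed (auto intro: assms)

lemma continuous_off_0:
  "continuous_on (- {0}) g" "continuous_on (- {0}) (half_deriv g)" "continuous_on (- {0}) (Euler g)"
  "continuous_on (- {0}) (laplacian g)" "continuous_on (- {0}) (grad_sq g)"
proof -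
  show "continuous_on (- {0}) (laplacian g)"
    unfolding laplacian_def[abs_def] by (intro smooth_on_continuous_on smooth_intros g open_off_0)
qed (intro smooth_on_continuous_on g smooth_on_half_deriv smooth_on_Euler smooth_on_grad_sq)+

lemma integrable_half_deriv_sq: "integrable lborel (\<lambda>x. half_deriv g x \<bullet> half_deriv g x)"
  using bound_half_deriv_sq
  by (intro integrable_off_0 continuous_intros continuous_off_0) (auto simp: supports)

lemma integrable_radial_sq: "integrable lborel (\<lambda>x. (Euler g x \<bullet> Euler g x) / (norm x)\<^sup>2)"
  using bound_radial_sq
  by (intro integrable_off_0 continuous_intros continuous_off_0) (auto simp: supports)

lemma norm_mult_sing: "x \<noteq> (0::'a) \<Longrightarrow> norm x * sing x = norm x + (n - 1) / norm x"
  by (simp add: sing_n field_simps power2_eq_square)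

text \<open>This fails pointwise, since the summand (n - 1) g / (2 r) of D g may be large. The
  difference of the integrands is a divergence minus the nonnegative Hardy term.\<close>

lemma integral_half_deriv_sq_le:
  "(\<integral>x. half_deriv g x \<bullet> half_deriv g x \<partial>lborel) \<le> (\<integral>x. (Euler g x \<bullet> Euler g x) / (norm x)\<^sup>2 \<partial>lborel)"
proof -
  define Z where "Z = (\<lambda>b x. ((n - 1) / 2 / (norm x)\<^sup>2) * ((x \<bullet> b) * (g x \<bullet> g x)))"
  have eq: "divg Z x = half_deriv g x \<bullet> half_deriv g x - (Euler g x \<bullet> Euler g x) / (norm x)\<^sup>2
      + c\<^sub>n * (g x \<bullet> g x) / (norm x)\<^sup>2" if "x \<noteq> 0" for x
    using half_deriv_sq_eq[OF g that, folded n] by (simp add: Z_def)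
  \<comment> \<open>One summand for each of the three terms of \<open>divg Z\<close>; the sum is
    also at least C^2, which bounds the field Z itself.\<close>
  define K where "K = n ^ 3 * C\<^sup>2 + n * C\<^sup>2 + n * C\<^sup>2"
  have K: "C\<^sup>2 \<le> K"
  proof -
    have "1 * C\<^sup>2 \<le> n * C\<^sup>2" using n_ge_1 by (intro mult_right_mono) auto
    moreover have "0 \<le> n * C\<^sup>2" "0 \<le> n ^ 3 * C\<^sup>2" using n_ge_1 by auto
    ultimately show ?thesis unfolding K_def by linarith
  qed
  have Z0: "has_bochner_integral lborel (\<lambda>x. \<Sum>b\<in>Basis. dir_deriv b (Z b) x) 0"
  proof (rule divergence_theorem_singular[OF dim, of _ "R + 1" K])
    show "smooth_on (- {0}) (Z b)" for b
    proof -
      have "smooth_on {0<..} (\<lambda>r::real. (n - 1) / 2 / r\<^sup>2)"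
        by (intro smooth_on_divide_power smooth_on_const)
      then show ?thesis
        unfolding Z_def by (intro smooth_on_mult[OF open_off_0] smooth_on_norm_compose)
          (auto intro!: smooth_intros g)
    qed
    show "Z b x = 0" if "R + 1 \<le> norm x" for b x
      using that by (simp add: Z_def supports)
    show "\<bar>Z b x\<bar> \<le> K * norm x * sing x" if "b \<in> Basis" "x \<noteq> 0" for b x
    proof -
      have "\<bar>Z b x\<bar> = (n - 1) / 2 / (norm x)\<^sup>2 * (\<bar>x \<bullet> b\<bar> * (norm (g x))\<^sup>2)"
        using n_ge_1 by (simp add: Z_def abs_mult dot_square_norm)
      also have "\<dots> \<le> (n - 1) / (norm x)\<^sup>2 * (norm x * C\<^sup>2)"
        using that n_ge_1 bound_g[of x] C_nonneg
        by (intro mult_mono power_mono Basis_le_norm) (auto intro!: frac_le)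
      also have "\<dots> = C\<^sup>2 * ((n - 1) / norm x)"
        using that by (simp add: power2_eq_square field_simps)
      also have "\<dots> \<le> K * (norm x * sing x)"
        using that K n_ge_1 by (intro mult_mono) (auto simp: norm_mult_sing intro: order.trans[OF _ K])
      finally show ?thesis by (simp add: mult.assoc)
    qed
    show "\<bar>\<Sum>b\<in>Basis. dir_deriv b (Z b) x\<bar> \<le> K * sing x" if "x \<noteq> 0" for x
    proof -
      have "0 \<le> c\<^sub>n * (g x \<bullet> g x) / (norm x)\<^sup>2" using c\<^sub>n_bounds(1) by simp
      then show ?thesis
        unfolding divg_def[symmetric] eq[OF that] K_def
        using bound_half_deriv_sq[OF that] bound_radial_sq[OF that] bound_hardy[OF that]
          divide_nonneg_nonneg[OF inner_ge_zero[of "Euler g x"] zero_le_power2[of "norm x"]]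
          inner_ge_zero[of "half_deriv g x"]
        unfolding distrib_right abs_le_iff by linarith
    qed
  qed
  have "(\<integral>x. half_deriv g x \<bullet> half_deriv g x \<partial>lborel)
      \<le> (\<integral>x. (Euler g x \<bullet> Euler g x) / (norm x)\<^sup>2 + divg Z x \<partial>lborel)"
  proof (rule integral_mono_AE[OF integrable_half_deriv_sq])
    show "integrable lborel (\<lambda>x. (Euler g x \<bullet> Euler g x) / (norm x)\<^sup>2 + divg Z x)"
      using Z0 integrable_radial_sq unfolding divg_def has_bochner_integral_iff by auto
    show "AE x in lborel. half_deriv g x \<bullet> half_deriv g x \<le> (Euler g x \<bullet> Euler g x) / (norm x)\<^sup>2 + divg Z x"
      using AE_lborel_singleton[of "0::'a"]
    proof eventually_elim
      case (elim x)
      have "0 \<le> c\<^sub>n * (g x \<bullet> g x) / (norm x)\<^sup>2" using c\<^sub>n_bounds(1) by simp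
      then show ?case using eq[OF elim] by linarith
    qed
  qed
  also have "\<dots> = (\<integral>x. (Euler g x \<bullet> Euler g x) / (norm x)\<^sup>2 \<partial>lborel)"
    using Z0 integrable_radial_sq unfolding divg_def has_bochner_integral_iff
    by (subst Bochner_Integration.integral_add) auto
  finally show ?thesis .
qed

text \<open>Integrates the pointwise identity and drops the term P, which is nonnegative because r
  w' <= w. The bound w <= delta r compensates the factors 1/r and 1/r^3 of the field Y, so that Y is
  small enough at the origin for the divergence theorem.\<close>

lemma radial_multiplier_inequality:
  fixes w w' :: "real \<Rightarrow> real" and \<delta> :: real
  assumes w: "smooth_on {0<..} w" "smooth_on {0<..} w'"
      "\<And>r. 0 < r \<Longrightarrow> (w has_real_derivative w' r) (at r)"
    and w_bounds: "\<And>r. 0 < r \<Longrightarrow> 0 \<le> w r" "\<And>r. 0 < r \<Longrightarrow> w r \<le> 1" "\<And>r. 0 < r \<Longrightarrow> w r \<le> \<delta> * r"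
      "\<And>r. 0 < r \<Longrightarrow> 0 \<le> w' r" "\<And>r. 0 < r \<Longrightarrow> r * w' r \<le> w r"
  shows "integrable lborel (\<lambda>x. 2 * w (norm x) * (laplacian g x \<bullet> half_deriv g x))"
    "integrable lborel (\<lambda>x. w' (norm x) * (half_deriv g x \<bullet> half_deriv g x))"
    "(\<integral>x. 2 * w (norm x) * (laplacian g x \<bullet> half_deriv g x) \<partial>lborel)
      \<le> - (\<integral>x. w' (norm x) * (half_deriv g x \<bullet> half_deriv g x) \<partial>lborel)"
proof -
  have cw: "continuous_on (- {0}) (\<lambda>x::'a. w (norm x))" "continuous_on (- {0}) (\<lambda>x::'a. w' (norm x))"
    by (intro smooth_on_continuous_on smooth_on_norm_compose w)+
  have \<delta>: "0 \<le> \<delta>" using w_bounds(1,3)[of 1] by simp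
  have w'_le: "w' r \<le> \<delta>" if "0 < r" for r
  proof -
    have "r * w' r \<le> r * \<delta>" using w_bounds(3,5)[OF that] by (simp add: mult.commute)
    then show ?thesis using that by simp
  qed
  define K1 where "K1 = 2 * (n\<^sup>2 * C\<^sup>2)"
  have 1: "\<bar>2 * w (norm x) * (laplacian g x \<bullet> half_deriv g x)\<bar> \<le> K1 * sing x" if x: "x \<noteq> 0" for x
  proof -
    let ?s = "1 + (n - 1) / norm x"
    have "\<bar>laplacian g x \<bullet> half_deriv g x\<bar> \<le> (C * ?s) * (n * C * ?s)"
      using bound_lap[OF x] bound_half_deriv[OF x] C_nonneg n_ge_1
      by (intro order.trans[OF Cauchy_Schwarz_ineq2] mult_mono) auto
    also have "\<dots> = n * C\<^sup>2 * ?s\<^sup>2" by (simp add: power2_eq_square mult_ac)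
    also have "\<dots> \<le> n * C\<^sup>2 * (n * sing x)" using n_ge_1 by (intro mult_left_mono sing_square_n x) auto
    finally have *: "\<bar>laplacian g x \<bullet> half_deriv g x\<bar> \<le> n\<^sup>2 * C\<^sup>2 * sing x"
      by (simp add: power2_eq_square mult_ac)
    have "\<bar>2 * w (norm x) * (laplacian g x \<bullet> half_deriv g x)\<bar> \<le> 2 * (n\<^sup>2 * C\<^sup>2 * sing x)"
      unfolding abs_mult using * w_bounds(1,2)[of "norm x"] x by (intro mult_mono) auto
    then show ?thesis by (simp add: K1_def mult.assoc)
  qed
  show i1: "integrable lborel (\<lambda>x. 2 * w (norm x) * (laplacian g x \<bullet> half_deriv g x))"
    by (intro integrable_off_0[of _ K1] continuous_intros continuous_off_0 cw 1) (auto simp: supports)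
  define K2 where "K2 = \<delta> * (n ^ 3 * C\<^sup>2)"
  have 2: "0 \<le> w' (norm x) * (half_deriv g x \<bullet> half_deriv g x)"
    "w' (norm x) * (half_deriv g x \<bullet> half_deriv g x) \<le> K2 * sing x" if x: "x \<noteq> 0" for x
  proof -
    have "w' (norm x) * (half_deriv g x \<bullet> half_deriv g x) \<le> \<delta> * (n ^ 3 * C\<^sup>2 * sing x)"
      using x w_bounds(4)[of "norm x"] w'_le[of "norm x"] \<delta> by (intro mult_mono bound_half_deriv_sq) auto
    then show "w' (norm x) * (half_deriv g x \<bullet> half_deriv g x) \<le> K2 * sing x"
      by (simp add: K2_def mult.assoc)
    show "0 \<le> w' (norm x) * (half_deriv g x \<bullet> half_deriv g x)"
      using x w_bounds(4)[of "norm x"] by simp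
  qed
  show i2: "integrable lborel (\<lambda>x. w' (norm x) * (half_deriv g x \<bullet> half_deriv g x))"
    by (intro integrable_off_0[of _ K2] continuous_intros continuous_off_0 cw) (auto simp: supports 2)
  define P where "P = (\<lambda>x. (2 * w (norm x) / norm x - w' (norm x)) * (grad_sq g x - (Euler g x \<bullet> Euler g x) / (norm x)\<^sup>2
        + c\<^sub>n * (g x \<bullet> g x) / (norm x)\<^sup>2))"
  define K3 where "K3 = 2 * \<delta> * (n * C\<^sup>2 + n * C\<^sup>2)"
  have 3: "0 \<le> P x" "P x \<le> K3 * sing x" if x: "x \<noteq> 0" for x
  proof -
    have a: "0 \<le> 2 * w (norm x) / norm x - w' (norm x)" "2 * w (norm x) / norm x - w' (norm x) \<le> 2 * \<delta>"
    proof -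
      have "w' (norm x) \<le> w (norm x) / norm x" "w (norm x) / norm x \<le> \<delta>" "0 \<le> w (norm x) / norm x"
        using x w_bounds[of "norm x"] by (simp_all add: field_simps)
      then show "0 \<le> 2 * w (norm x) / norm x - w' (norm x)" "2 * w (norm x) / norm x - w' (norm x) \<le> 2 * \<delta>"
        using x w_bounds(4)[of "norm x"] by (simp_all only: times_divide_eq_right[symmetric]) auto
    qed
    have "(Euler g x \<bullet> Euler g x) / (norm x)\<^sup>2 \<le> grad_sq g x"
      using Euler_sq_le[of g x] x by (simp add: field_simps)
    moreover have "0 \<le> c\<^sub>n * (g x \<bullet> g x) / (norm x)\<^sup>2" using c\<^sub>n_bounds(1) by simp
    moreover have "grad_sq g x \<le> n * C\<^sup>2 * sing x"
    proof -
      have "0 \<le> n * C\<^sup>2" using n_ge_1 by simp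
      from mult_left_mono[OF sing_ge_1[of x] this] bound_grad_sq[OF x] show ?thesis by linarith
    qed
    moreover have "0 \<le> (Euler g x \<bullet> Euler g x) / (norm x)\<^sup>2" by simp
    ultimately have b: "0 \<le> grad_sq g x - (Euler g x \<bullet> Euler g x) / (norm x)\<^sup>2 + c\<^sub>n * (g x \<bullet> g x) / (norm x)\<^sup>2"
      "grad_sq g x - (Euler g x \<bullet> Euler g x) / (norm x)\<^sup>2 + c\<^sub>n * (g x \<bullet> g x) / (norm x)\<^sup>2
        \<le> (n * C\<^sup>2 + n * C\<^sup>2) * sing x"
      using bound_hardy[OF x] unfolding distrib_right by linarith+
    show "0 \<le> P x" unfolding P_def using a(1) b(1) by (rule mult_nonneg_nonneg)
    have "P x \<le> 2 * \<delta> * ((n * C\<^sup>2 + n * C\<^sup>2) * sing x)"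
      unfolding P_def using a b \<delta> by (intro mult_mono) auto
    then show "P x \<le> K3 * sing x" by (simp add: K3_def mult.assoc)
  qed
  define Y where "Y = (\<lambda>b x. (2 * (w (norm x) / norm x)) * (dir_deriv b g x \<bullet> Euler g x)
      + (- (w (norm x) / norm x)) * ((x \<bullet> b) * grad_sq g x)
      + ((n - 1) * (w (norm x) / norm x)) * (dir_deriv b g x \<bullet> g x)
      + ((n - 1) / 2 * (w (norm x) / norm x ^ 3)) * ((x \<bullet> b) * (g x \<bullet> g x)))"
  have eq: "divg Y x = 2 * w (norm x) * (laplacian g x \<bullet> half_deriv g x)
      + w' (norm x) * (half_deriv g x \<bullet> half_deriv g x) + P x" if "x \<noteq> 0" for x
    unfolding Y_def P_def
    by (rule radial_multiplier_identity(1)[OF g that w(1) w(3), folded n]) (use that in simp)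
  have sY: "smooth_on (- {0}) (Y b)" for b
  proof -
    obtain x :: 'a where "x \<noteq> 0" using nonempty_Basis nonzero_Basis by blast
    from radial_multiplier_identity(2)[OF g this w(1) w(3), folded n] this show ?thesis unfolding Y_def by simp
  qed
  \<comment> \<open>The first two summands will multiply |x| and the last two (n - 1) / |x|; these
    two add up to |x| \<open>sing x\<close>.\<close>
  define KY where "KY = 2 * \<delta> * (n * C\<^sup>2) + \<delta> * (n * C\<^sup>2) + \<delta> * C\<^sup>2 * R + \<delta> * C\<^sup>2"
  have KY: "0 \<le> KY" unfolding KY_def using \<delta> n_ge_1 R by auto
  have Ybound: "\<bar>Y b x\<bar> \<le> KY * norm x * sing x" if b: "b \<in> Basis" and x: "x \<noteq> 0" for b x
  proof (cases "norm x \<le> R")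
    case True
    let ?r = "norm x"
    have r: "0 < ?r" using x by simp
    have a: "0 \<le> w ?r / ?r" "w ?r / ?r \<le> \<delta>" using w_bounds(1,3)[OF r] r by (auto simp: field_simps)
    have xb: "\<bar>x \<bullet> b\<bar> \<le> ?r" using b by (rule Basis_le_norm)
    have gg: "g x \<bullet> g x \<le> C\<^sup>2" unfolding dot_square_norm using bound_g[OF x] by (intro power_mono) auto
    have q: "0 \<le> grad_sq g x" unfolding grad_sq_def by (intro sum_nonneg) auto
    have "\<bar>dir_deriv b g x \<bullet> Euler g x\<bar> \<le> C * (?r * (n * C))"
      using bound_dg[OF x b] bound_Euler[OF x] C_nonneg by (intro order.trans[OF Cauchy_Schwarz_ineq2] mult_mono) auto
    then have t1: "\<bar>(2 * (w ?r / ?r)) * (dir_deriv b g x \<bullet> Euler g x)\<bar> \<le> (2 * \<delta>) * (C * (?r * (n * C)))"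
      unfolding abs_mult using a \<delta> by (intro mult_mono) auto
    have "\<bar>(x \<bullet> b) * grad_sq g x\<bar> \<le> ?r * (n * C\<^sup>2)"
      unfolding abs_mult using xb q bound_grad_sq[OF x] by (intro mult_mono) auto
    then have t2: "\<bar>(- (w ?r / ?r)) * ((x \<bullet> b) * grad_sq g x)\<bar> \<le> \<delta> * (?r * (n * C\<^sup>2))"
      using a \<delta> by (subst abs_mult, intro mult_mono) auto
    have "\<bar>dir_deriv b g x \<bullet> g x\<bar> \<le> C * C"
      using bound_dg[OF x b] bound_g[OF x] C_nonneg by (intro order.trans[OF Cauchy_Schwarz_ineq2] mult_mono) auto
    then have "\<bar>((n - 1) * (w ?r / ?r)) * (dir_deriv b g x \<bullet> g x)\<bar> \<le> ((n - 1) * \<delta>) * (C * C)"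
      unfolding abs_mult using a \<delta> n_ge_1 by (intro mult_mono) auto
    \<comment> \<open>On the support |x| <= R, so a constant may be traded for R / |x|, which the
      part (n - 1) / |x| of |x| \<open>sing x\<close> dominates.\<close>
    also have "\<dots> \<le> ((n - 1) * \<delta>) * (C * C) * (R / ?r)"
      using True r \<delta> n_ge_1 mult_left_mono[of 1 "R / ?r" "((n - 1) * \<delta>) * (C * C)"] by simp
    finally have t3: "\<bar>((n - 1) * (w ?r / ?r)) * (dir_deriv b g x \<bullet> g x)\<bar> \<le> \<delta> * C\<^sup>2 * R * ((n - 1) / ?r)"
      by (simp add: power2_eq_square field_simps)
    have "w ?r / ?r ^ 3 = w ?r / ?r / ?r\<^sup>2" by (simp add: eval_nat_numeral)
    also have "\<dots> \<le> \<delta> / ?r\<^sup>2" using a by (intro divide_right_mono) auto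
    finally have "\<bar>((n - 1) / 2 * (w ?r / ?r ^ 3)) * ((x \<bullet> b) * (g x \<bullet> g x))\<bar> \<le> ((n - 1) * (\<delta> / ?r\<^sup>2)) * (?r * C\<^sup>2)"
      unfolding abs_mult using xb gg n_ge_1 w_bounds(1)[OF r] r \<delta> by (intro mult_mono) auto
    also have "\<dots> = \<delta> * C\<^sup>2 * ((n - 1) / ?r)" using r by (simp add: power2_eq_square field_simps)
    finally have t4: "\<bar>((n - 1) / 2 * (w ?r / ?r ^ 3)) * ((x \<bullet> b) * (g x \<bullet> g x))\<bar> \<le> \<delta> * C\<^sup>2 * ((n - 1) / ?r)" .
    have "\<bar>Y b x\<bar> \<le> (2 * \<delta>) * (C * (?r * (n * C))) + \<delta> * (?r * (n * C\<^sup>2)) + \<delta> * C\<^sup>2 * R * ((n - 1) / ?r)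
        + \<delta> * C\<^sup>2 * ((n - 1) / ?r)"
      unfolding Y_def using t1 t2 t3 t4 by linarith
    also have "\<dots> = (2 * \<delta> * (n * C\<^sup>2) + \<delta> * (n * C\<^sup>2)) * ?r + (\<delta> * C\<^sup>2 * R + \<delta> * C\<^sup>2) * ((n - 1) / ?r)"
      by (simp add: algebra_simps power2_eq_square)
    also have "\<dots> \<le> KY * ?r + KY * ((n - 1) / ?r)"
    proof (intro add_mono mult_right_mono)
      have "0 \<le> 2 * \<delta> * (n * C\<^sup>2)" "0 \<le> \<delta> * (n * C\<^sup>2)" "0 \<le> \<delta> * C\<^sup>2 * R" "0 \<le> \<delta> * C\<^sup>2"
        using \<delta> n_ge_1 R by auto
      then show "2 * \<delta> * (n * C\<^sup>2) + \<delta> * (n * C\<^sup>2) \<le> KY" "\<delta> * C\<^sup>2 * R + \<delta> * C\<^sup>2 \<le> KY"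
        unfolding KY_def by linarith+
    qed (use n_ge_1 r in auto)
    also have "\<dots> = KY * norm x * sing x"
      using norm_mult_sing[OF x] by (simp add: distrib_left mult.assoc)
    finally show ?thesis .
  next
    case False
    then show ?thesis using KY sing_ge_1[of x] by (simp add: Y_def supports)
  qed
  define K where "K = KY + (K1 + K2 + K3)"
  have K: "0 \<le> K1" "0 \<le> K2" "0 \<le> K3" unfolding K1_def K2_def K3_def using \<delta> n_ge_1 by auto
  have Y0: "has_bochner_integral lborel (\<lambda>x. \<Sum>b\<in>Basis. dir_deriv b (Y b) x) 0"
  proof (rule divergence_theorem_singular[OF dim, of _ "R + 1" K])
    show "smooth_on (- {0}) (Y b)" for b by (rule sY)
    show "Y b x = 0" if "R + 1 \<le> norm x" for b x
      using that by (simp add: Y_def supports)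
    show "\<bar>Y b x\<bar> \<le> K * norm x * sing x" if "b \<in> Basis" "x \<noteq> 0" for b x
    proof -
      have "KY * (norm x * sing x) \<le> K * (norm x * sing x)"
        unfolding K_def using K sing_ge_1[of x] by (intro mult_right_mono) auto
      then show ?thesis using Ybound[OF that] by (simp add: mult.assoc)
    qed
    show "\<bar>\<Sum>b\<in>Basis. dir_deriv b (Y b) x\<bar> \<le> K * sing x" if "x \<noteq> 0" for x
    proof -
      have "0 \<le> KY * sing x" using KY sing_ge_1[of x] by simp
      then show ?thesis
        unfolding divg_def[symmetric] eq[OF that] K_def distrib_right
        using 1[OF that] 2[OF that] 3[OF that] by linarith
    qed
  qed
  have "(\<integral>x. 2 * w (norm x) * (laplacian g x \<bullet> half_deriv g x) + w' (norm x) * (half_deriv g x \<bullet> half_deriv g x) \<partial>lborel)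
      \<le> (\<integral>x. divg Y x \<partial>lborel)"
  proof (rule integral_mono_AE)
    show "integrable lborel (\<lambda>x. divg Y x)"
      using Y0 unfolding divg_def has_bochner_integral_iff by simp
    show "AE x in lborel. 2 * w (norm x) * (laplacian g x \<bullet> half_deriv g x)
        + w' (norm x) * (half_deriv g x \<bullet> half_deriv g x) \<le> divg Y x"
      using AE_lborel_singleton[of "0::'a"] by eventually_elim (use eq 3(1) in fastforce)
  qed (intro Bochner_Integration.integrable_add i1 i2)
  also have "\<dots> = 0" using Y0 unfolding divg_def has_bochner_integral_iff by simp
  finally show "(\<integral>x. 2 * w (norm x) * (laplacian g x \<bullet> half_deriv g x) \<partial>lborel)
      \<le> - (\<integral>x. w' (norm x) * (half_deriv g x \<bullet> half_deriv g x) \<partial>lborel)"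
    using i1 i2 by (simp add: Bochner_Integration.integral_add)
qed

end

section \<open>Pairing with a radial distributional derivative\<close>

lemma snd_polar_measurable [measurable]:
  "snd \<in> borel_measurable (polar_measure :: (real \<times> 'a::euclidean_space) measure)"
proof -
  have "(\<lambda>x. x) \<in> borel_measurable (sphere_measure :: 'a measure)"
    unfolding measurable_cong_sets[OF sets_sphere_measure refl]
    by (intro measurable_restrict_space1) simp
  then show ?thesis
    unfolding polar_measure_def by (rule measurable_compose[OF measurable_snd])
qed

lemma smooth_on_power: "smooth_on {0<..} (\<lambda>r::real. r ^ m)"
proof (subst smooth_on_cong)
  show "r ^ m = r powr real m" if "r \<in> {0<..}" for r :: real
    using that by (simp add: powr_realpow)
qed (auto intro: smooth_on_powr)

text \<open>The arithmetic of a product rule followed by division: P is r^(n-1), q its derivative, k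
  = (n - 1) / r, s = |g|^2, e = g . d_r g, and c, d are the cutoff and its radial
  derivative.\<close>

lemma product_rule_quotient:
  fixes D P c e k s d H q :: real
  assumes "H = P * (2 * e) + q * s" "D = c * H + d * (P * s)" "q / P = k" "P \<noteq> 0"
  shows "D / P = c * (2 * e + k * s) + d * s"
  using assms by (simp add: field_simps)

lemma norm_scaleR_sgn: "norm x *\<^sub>R sgn x = (x :: 'a::real_normed_vector)"
  by (cases "x = 0") (simp_all add: sgn_div_norm)

context compactly_supported_off_0
begin

lemma dir_deriv_sgn: "x \<noteq> 0 \<Longrightarrow> dir_deriv (sgn x) g x = (1 / norm x) *\<^sub>R Euler g x"
  using dir_deriv_sum_Basis[of g x "sgn x"] smooth_on_differentiable[OF g, of x]
  by (simp add: Euler_def scaleR_sum_right sgn_div_norm divide_inverse)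

text \<open>A test function standing for |g|^2: the factor r^(n-1) replaces the Jacobian absent from
  \<open>polar_measure\<close>, and the cutoff moves the support off the origin.\<close>

definition test_fun :: "nat \<Rightarrow> 'a \<Rightarrow> real" where
  "test_fun k x = cutoff k x * (norm x ^ (DIM('a) - 1) * (g x \<bullet> g x))"

lemma smooth_test_fun: "smooth_on UNIV (test_fun k)"
  unfolding test_fun_def
  by (intro smooth_on_cutoff_mult smooth_on_mult smooth_on_norm_compose smooth_on_power smooth_on_inner g open_off_0)

lemma test_fun_admissible: "test_fun k \<in> Cc_infinity" "0 \<notin> supp (test_fun k)"
proof -
  have "supp (test_fun k) \<subseteq> cball 0 R"
    unfolding supp_def
  proof (rule closure_minimal)
    have "norm x \<le> R" if "test_fun k x \<noteq> 0" for x
      using that supp_g[of x] by (cases "norm x \<le> R") (auto simp: test_fun_def)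
    then show "{x. test_fun k x \<noteq> 0} \<subseteq> cball 0 R" by auto
  qed simp
  then have "bounded (supp (test_fun k))" by (rule bounded_subset[OF bounded_cball])
  then show "test_fun k \<in> Cc_infinity"
    using smooth_test_fun by (simp add: Cc_infinity_def smooth_eq_smooth_on_UNIV compact_eq_bounded_closed supp_def)
  have "supp (test_fun k) \<subseteq> {x. 1 \<le> real (Suc k) * (norm x)\<^sup>2}"
    unfolding supp_def
  proof (rule closure_minimal)
    show "{x. test_fun k x \<noteq> 0} \<subseteq> {x. 1 \<le> real (Suc k) * (norm x)\<^sup>2}"
    proof
      fix x assume "x \<in> {x. test_fun k x \<noteq> 0}"
      then have "cutoff k x \<noteq> 0" by (auto simp: test_fun_def)
      then show "x \<in> {x. 1 \<le> real (Suc k) * (norm x)\<^sup>2}"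
        using cutoff_eq_0[of k x] by (cases "real (Suc k) * (norm x)\<^sup>2 \<le> 1") auto
    qed
    show "closed {x::'a. 1 \<le> real (Suc k) * (norm x)\<^sup>2}"
      by (intro closed_Collect_le continuous_intros)
  qed
  then show "0 \<notin> supp (test_fun k)" by auto
qed

text \<open>Up to the cutoff this is r^(1-n) d_r (r^(n-1) |g|^2) = 2 g . D g: the shift (n - 1) / (2
  r) in D is the one that turns the weak derivative into the product occurring in the multiplier
  argument.\<close>

lemma dir_deriv_test_fun:
  assumes x: "x \<noteq> 0"
  shows "dir_deriv (sgn x) (test_fun k) x / norm x ^ (DIM('a) - 1) =
    cutoff k x * (2 * (g x \<bullet> half_deriv g x)) + dir_deriv (sgn x) (cutoff k) x * (g x \<bullet> g x)"
proof -
  let ?m = "DIM('a) - 1"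
  have gd: "g differentiable (at x)" using x by (intro smooth_on_differentiable[OF g]) auto
  have "((\<lambda>r. r ^ ?m) has_vector_derivative real ?m * norm x ^ (?m - 1)) (at (norm x))"
    unfolding has_real_derivative_iff_has_vector_derivative[symmetric]
    by (auto intro!: derivative_eq_intros)
  from dir_deriv_norm_compose[OF x this, of "sgn x"] x
  have 1: "dir_deriv (sgn x) (\<lambda>x. norm x ^ ?m) x = real ?m * norm x ^ (?m - 1)"
    by (simp add: sgn_div_norm dot_square_norm power2_eq_square)
  have H: "dir_deriv (sgn x) (\<lambda>x. norm x ^ ?m * (g x \<bullet> g x)) x =
      norm x ^ ?m * (2 * (g x \<bullet> ((1 / norm x) *\<^sub>R Euler g x))) + real ?m * norm x ^ (?m - 1) * (g x \<bullet> g x)"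
  proof -
    have "(\<lambda>x. norm x ^ ?m) differentiable (at x)" "(\<lambda>x. g x \<bullet> g x) differentiable (at x)"
      using x smooth_on_differentiable[OF smooth_on_norm_compose[OF smooth_on_power], of x ?m]
        smooth_on_differentiable[OF smooth_on_inner[OF open_off_0 g g], of x] by auto
    from dir_deriv_mult[OF this, of "sgn x"] show ?thesis
      unfolding 1 dir_deriv_inner_self[OF gd] dir_deriv_sgn[OF x] .
  qed
  have D: "dir_deriv (sgn x) (test_fun k) x =
      cutoff k x * dir_deriv (sgn x) (\<lambda>x. norm x ^ ?m * (g x \<bullet> g x)) x
      + dir_deriv (sgn x) (cutoff k) x * (norm x ^ ?m * (g x \<bullet> g x))"
    unfolding test_fun_def using x
    by (intro dir_deriv_mult smooth_on_differentiable[OF smooth_on_cutoff]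
        smooth_on_differentiable[of "- {0}"] smooth_on_mult smooth_on_inner smooth_on_norm_compose smooth_on_power g) auto
  \<comment> \<open>In dimension 1 the exponent \<open>?m - 1\<close> is truncated to 0, but its
    coefficient is 0 as well.\<close>
  have q: "real ?m * norm x ^ (?m - 1) / norm x ^ ?m = (n - 1) / norm x"
  proof (cases ?m)
    case 0
    then have "DIM('a) = 1" using DIM_positive[where 'a = 'a] by linarith
    then have "n = 1" by (simp add: n)
    with 0 show ?thesis by simp
  next
    case (Suc j)
    have "real ?m = n - 1" using DIM_positive[where 'a = 'a] by (simp add: n of_nat_diff Suc_le_eq)
    with Suc x show ?thesis by simp
  qed
  have "dir_deriv (sgn x) (test_fun k) x / norm x ^ ?m =
      cutoff k x * (2 * (g x \<bullet> ((1 / norm x) *\<^sub>R Euler g x)) + (n - 1) / norm x * (g x \<bullet> g x))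
      + dir_deriv (sgn x) (cutoff k) x * (g x \<bullet> g x)"
    by (rule product_rule_quotient[OF H D q]) (use x in simp)
  then show ?thesis
    by (simp add: half_deriv_n inner_add_right distrib_left)
qed

text \<open>The weak derivative is tested with \<open>test_fun k\<close>, and k tends to infinity.
  The derivative of the cutoff is of size 6/r, and |Q| <= K r makes its contribution vanish in the
  limit; in dimension 1 a nonzero value of Q at 0 would leave a boundary term.\<close>

lemma radial_derivative_pairing:
  assumes QG: "has_radial_derivative Q G" and Q: "AE z in polar_measure. \<bar>Q z\<bar> \<le> K * fst z"
  shows "integrable lborel (\<lambda>x. Q (polar x) * (2 * (g x \<bullet> half_deriv g x)))"
    "integrable lborel (\<lambda>x. G (polar x) * (g x \<bullet> g x))"
    "(\<integral>x. Q (polar x) * (2 * (g x \<bullet> half_deriv g x)) \<partial>lborel) = - (\<integral>x. G (polar x) * (g x \<bullet> g x) \<partial>lborel)"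
proof -
  let ?m = "DIM('a) - 1"
  have mQ: "Q \<in> borel_measurable polar_measure" and mG: "G \<in> borel_measurable polar_measure"
    using QG by (auto simp: has_radial_derivative_def Linfty_def)
  obtain B where "AE z in polar_measure. \<bar>G z\<bar> \<le> B"
    using QG by (auto simp: has_radial_derivative_def Linfty_def)
  from AE_polar[OF this] have G: "AE x in lborel. \<bar>G (polar x)\<bar> \<le> B" by simp
  from AE_polar[OF Q] have Q: "AE x in lborel. \<bar>Q (polar x)\<bar> \<le> K * norm x" by (simp add: polar_def)
  note [measurable] = borel_measurable_polar[OF mQ] borel_measurable_polar[OF mG]
  have [measurable]: "g \<in> borel_measurable borel" "half_deriv g \<in> borel_measurable borel"
    using continuous_off_0_borel_measurable[OF continuous_off_0(1)]
      continuous_off_0_borel_measurable[OF continuous_off_0(2)] by simp_all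
  define f1 where "f1 = (\<lambda>x. Q (polar x) * (2 * (g x \<bullet> half_deriv g x)))"
  define f2 where "f2 = (\<lambda>x. Q (polar x) * (g x \<bullet> g x))"
  define f3 where "f3 = (\<lambda>x. G (polar x) * (g x \<bullet> g x))"
  have m: "f1 \<in> borel_measurable lborel" "f2 \<in> borel_measurable lborel" "f3 \<in> borel_measurable lborel"
    unfolding f1_def f2_def f3_def by simp_all
  have z: "f1 x = 0" "f2 x = 0" "f3 x = 0" if "R + 1 \<le> norm x" for x
    using that by (simp_all add: f1_def f2_def f3_def supports)
  have gg: "\<bar>g x \<bullet> g x\<bar> \<le> C\<^sup>2" if "x \<noteq> 0" for x
    using power_mono[OF bound_g[OF that], of 2] by (simp add: dot_square_norm)
  have b1: "AE x in lborel. norm (f1 x) \<le> \<bar>K\<bar> * R * (2 * (C * (n * C * n))) * sing x"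
    using AE_lborel_singleton[of "0::'a"] Q
  proof eventually_elim
    case (elim x)
    show ?case
    proof (cases "norm x \<le> R")
      case True
      let ?s = "1 + (n - 1) / norm x"
      have "1 \<le> ?s" using n_ge_1 by simp
      then have "?s * 1 \<le> ?s\<^sup>2" unfolding power2_eq_square by (intro mult_left_mono) auto
      from order.trans[OF this sing_square_n[OF elim(1)]] have "?s \<le> n * sing x"
        by (simp only: mult_1_right)
      then have "n * C * ?s \<le> n * C * (n * sing x)" using n_ge_1 C_nonneg by (intro mult_left_mono) auto
      then have "norm (half_deriv g x) \<le> n * C * (n * sing x)"
        using bound_half_deriv[OF elim(1)] by linarith
      then have "\<bar>g x \<bullet> half_deriv g x\<bar> \<le> C * (n * C * (n * sing x))"
        using bound_g[OF elim(1)] C_nonneg by (intro order.trans[OF Cauchy_Schwarz_ineq2] mult_mono) auto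
      moreover have "K * norm x \<le> \<bar>K\<bar> * R" using True by (intro mult_mono) auto
      then have "\<bar>Q (polar x)\<bar> \<le> \<bar>K\<bar> * R" using elim(2) by linarith
      ultimately have "\<bar>Q (polar x)\<bar> * (2 * \<bar>g x \<bullet> half_deriv g x\<bar>) \<le> \<bar>K\<bar> * R * (2 * (C * (n * C * (n * sing x))))"
        using R by (intro mult_mono) auto
      then show ?thesis by (simp add: f1_def abs_mult mult_ac)
    next
      case False
      then show ?thesis using C_nonneg n_ge_1 R sing_ge_1[of x] by (simp add: f1_def supports)
    qed
  qed
  have b2: "AE x in lborel. norm (f2 x) \<le> (\<bar>K\<bar> * C\<^sup>2) * norm x * sing x"
    using AE_lborel_singleton[of "0::'a"] Q
  proof eventually_elim
    case (elim x)
    have "K * norm x \<le> \<bar>K\<bar> * norm x" by (intro mult_right_mono) auto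
    then have "\<bar>Q (polar x)\<bar> * \<bar>g x \<bullet> g x\<bar> \<le> \<bar>K\<bar> * norm x * C\<^sup>2"
      using elim(2) gg[OF elim(1)] by (intro mult_mono) auto
    also have "\<dots> * 1 \<le> \<bar>K\<bar> * norm x * C\<^sup>2 * sing x" by (intro mult_left_mono sing_ge_1) auto
    finally show ?case by (simp add: f2_def abs_mult mult_ac)
  qed
  have b3: "AE x in lborel. norm (f3 x) \<le> (\<bar>B\<bar> * C\<^sup>2) * sing x"
    using AE_lborel_singleton[of "0::'a"] G
  proof eventually_elim
    case (elim x)
    have "\<bar>G (polar x)\<bar> * \<bar>g x \<bullet> g x\<bar> \<le> \<bar>B\<bar> * C\<^sup>2"
      using elim(2) gg[OF elim(1)] by (intro mult_mono) auto
    also have "\<dots> * 1 \<le> \<bar>B\<bar> * C\<^sup>2 * sing x" by (intro mult_left_mono sing_ge_1) auto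
    finally show ?case by (simp add: f3_def abs_mult)
  qed
  note L1 = integral_cutoff_tendsto[OF dim m(1) b1 z(1)]
  note L2 = integral_cutoff_deriv_tendsto_0[OF dim m(2) b2 z(2), where u = sgn]
  note L3 = integral_cutoff_tendsto[OF dim m(3) b3 z(3)]
  have sg: "sgn \<in> borel_measurable (borel :: 'a measure)" "norm (sgn x) \<le> 1" for x :: 'a
    by (simp_all add: norm_sgn)
  have weak: "(\<integral>x. cutoff k x * f1 x \<partial>lborel) + (\<integral>x. dir_deriv (sgn x) (cutoff k) x * f2 x \<partial>lborel)
      = - (\<integral>x. cutoff k x * f3 x \<partial>lborel)" for k
  proof -
    have sm: "smooth_on UNIV (test_fun k)" by (rule smooth_test_fun)
    have d: "test_fun k differentiable (at x)" for x
      by (rule smooth_on_differentiable[OF sm]) simp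
    \<comment> \<open>The derivative along the ray through omega is the directional derivative at r
      omega in the direction omega, which in Cartesian terms is \<open>sgn x\<close>.\<close>
    have dd: "deriv (\<lambda>s. test_fun k (s *\<^sub>R \<omega>)) r = dir_deriv \<omega> (test_fun k) (r *\<^sub>R \<omega>)" for r \<omega>
      using line_has_vector_derivative[OF d, where x = 0 and s = r and b = \<omega>]
      by (simp add: has_real_derivative_iff_has_vector_derivative[symmetric] DERIV_imp_deriv)
    have [measurable]: "test_fun k \<in> borel_measurable borel" "dir_deriv b (test_fun k) \<in> borel_measurable borel" for b
      by (intro borel_measurable_continuous_onI smooth_on_continuous_on smooth_on_dir_deriv sm)+
    \<comment> \<open>The direction varies with the point; expanding it in the basis leaves finitely
      many fixed directions, whose derivatives are continuous.\<close>
    have M1: "(\<lambda>z. Q z * dir_deriv (snd z) (test_fun k) (fst z *\<^sub>R snd z)) \<in> borel_measurable polar_measure"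
      unfolding dir_deriv_sum_Basis[OF d, of "snd _"] using mQ by measurable
    have M2: "(\<lambda>z. G z * test_fun k (fst z *\<^sub>R snd z)) \<in> borel_measurable polar_measure"
      using mG by measurable
    have "(\<integral>z. Q z * dir_deriv (snd z) (test_fun k) (fst z *\<^sub>R snd z) \<partial>polar_measure) =
        - (\<integral>z. G z * test_fun k (fst z *\<^sub>R snd z) \<partial>polar_measure)"
      using QG[unfolded has_radial_derivative_def, THEN conjunct2, THEN conjunct2, rule_format,
          OF conjI[OF test_fun_admissible[of k]]]
      by (simp add: case_prod_beta' dd)
    then have *: "(\<integral>x. Q (polar x) * dir_deriv (sgn x) (test_fun k) x / norm x ^ ?m \<partial>lborel) =
        - (\<integral>x. G (polar x) * test_fun k x / norm x ^ ?m \<partial>lborel)"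
      unfolding integral_polar[OF M1] integral_polar[OF M2] by (simp add: polar_def norm_scaleR_sgn)
    have e1: "(\<integral>x. Q (polar x) * dir_deriv (sgn x) (test_fun k) x / norm x ^ ?m \<partial>lborel) =
        (\<integral>x. cutoff k x * f1 x + dir_deriv (sgn x) (cutoff k) x * f2 x \<partial>lborel)"
    proof (intro integral_discrete_difference[where X = "{0}"])
      fix x :: 'a assume "x \<notin> {0}"
      then have "x \<noteq> 0" by simp
      from dir_deriv_test_fun[OF this, of k]
      show "Q (polar x) * dir_deriv (sgn x) (test_fun k) x / norm x ^ ?m =
          cutoff k x * f1 x + dir_deriv (sgn x) (cutoff k) x * f2 x"
        unfolding times_divide_eq_right[symmetric] by (simp add: f1_def f2_def algebra_simps)
    qed auto
    have e2: "(\<integral>x. cutoff k x * f1 x + dir_deriv (sgn x) (cutoff k) x * f2 x \<partial>lborel) =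
        (\<integral>x. cutoff k x * f1 x \<partial>lborel) + (\<integral>x. dir_deriv (sgn x) (cutoff k) x * f2 x \<partial>lborel)"
      by (intro Bochner_Integration.integral_add L1(2) L2(2) sg) auto
    have e3: "(\<integral>x. G (polar x) * test_fun k x / norm x ^ ?m \<partial>lborel) = (\<integral>x. cutoff k x * f3 x \<partial>lborel)"
      by (intro integral_discrete_difference[where X = "{0}"]) (auto simp: f3_def test_fun_def)
    show ?thesis using * unfolding e1 e2 e3 .
  qed
  have "(\<lambda>k. (\<integral>x. cutoff k x * f1 x \<partial>lborel) + (\<integral>x. dir_deriv (sgn x) (cutoff k) x * f2 x \<partial>lborel))
      \<longlonglongrightarrow> (\<integral>x. f1 x \<partial>lborel) + 0"
    by (intro tendsto_add L1(1) L2(1) sg) auto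
  moreover have "(\<lambda>k. - (\<integral>x. cutoff k x * f3 x \<partial>lborel)) \<longlonglongrightarrow> - (\<integral>x. f3 x \<partial>lborel)"
    by (intro tendsto_minus L3(1)) auto
  ultimately have "(\<integral>x. f1 x \<partial>lborel) = - (\<integral>x. f3 x \<partial>lborel)"
    unfolding weak using LIMSEQ_unique by fastforce
  then show "(\<integral>x. Q (polar x) * (2 * (g x \<bullet> half_deriv g x)) \<partial>lborel) = - (\<integral>x. G (polar x) * (g x \<bullet> g x) \<partial>lborel)"
    unfolding f1_def f3_def .
  show "integrable lborel (\<lambda>x. Q (polar x) * (2 * (g x \<bullet> half_deriv g x)))"
    using integrable_sing_bound[OF dim m(1) b1 z(1)] unfolding f1_def by auto
  show "integrable lborel (\<lambda>x. G (polar x) * (g x \<bullet> g x))"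
    using integrable_sing_bound[OF dim m(3) b3 z(3)] unfolding f3_def by auto
qed

end

section \<open>Conjugation by a radial exponential weight\<close>

context
  fixes \<psi> \<psi>1 \<psi>2 :: "real \<Rightarrow> real" and v :: "'a::euclidean_space \<Rightarrow> 'b::euclidean_space"
  assumes \<psi>: "smooth_on {0<..} \<psi>" "smooth_on {0<..} \<psi>1"
    "\<And>r. 0 < r \<Longrightarrow> (\<psi> has_real_derivative \<psi>1 r) (at r)"
    "\<And>r. 0 < r \<Longrightarrow> (\<psi>1 has_real_derivative \<psi>2 r) (at r)"
    and v: "smooth_on UNIV v"
begin

lemma smooth_on_exp_norm: "smooth_on (- {0}) (\<lambda>x::'a. exp (\<psi> (norm x)))"
  by (intro smooth_on_norm_compose smooth_on_compose[OF open_greaterThan open_UNIV _ \<psi>(1) smooth_on_exp]) simp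

lemma smooth_on_conj: "smooth_on (- {0}) (\<lambda>x. exp (\<psi> (norm x)) *\<^sub>R v x)"
  by (intro smooth_on_scaleR open_off_0 smooth_on_exp_norm smooth_on_subset[OF v]) simp

lemma v_differentiable: "v differentiable (at x)" "dir_deriv b v differentiable (at x)"
  by (intro smooth_on_differentiable[of UNIV] smooth_on_dir_deriv v; simp)+

lemma dir_deriv_exp_norm:
  "x \<noteq> 0 \<Longrightarrow> dir_deriv u (\<lambda>x::'a. exp (\<psi> (norm x))) x = \<psi>1 (norm x) / norm x * (x \<bullet> u) * exp (\<psi> (norm x))"
  using dir_deriv_norm_compose[of x "\<lambda>r. exp (\<psi> r)" "exp (\<psi> (norm x)) * \<psi>1 (norm x)" u]
    DERIV_chain2[OF DERIV_exp \<psi>(3)[of "norm x"]]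
  by (simp add: has_real_derivative_iff_has_vector_derivative mult_ac)

lemma dir_deriv_conj:
  assumes "x \<noteq> 0"
  shows "dir_deriv u (\<lambda>x. exp (\<psi> (norm x)) *\<^sub>R v x) x =
    exp (\<psi> (norm x)) *\<^sub>R dir_deriv u v x + (\<psi>1 (norm x) / norm x * (x \<bullet> u)) *\<^sub>R (exp (\<psi> (norm x)) *\<^sub>R v x)"
  using assms smooth_on_differentiable[OF smooth_on_exp_norm, of x]
  by (subst dir_deriv_scaleR) (auto simp: v_differentiable dir_deriv_exp_norm)

lemma Euler_conj:
  assumes "x \<noteq> 0"
  shows "Euler (\<lambda>x. exp (\<psi> (norm x)) *\<^sub>R v x) x =
    exp (\<psi> (norm x)) *\<^sub>R Euler v x + (\<psi>1 (norm x) * norm x) *\<^sub>R (exp (\<psi> (norm x)) *\<^sub>R v x)"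
proof -
  have "(\<Sum>c\<in>Basis. (x \<bullet> c) *\<^sub>R ((\<psi>1 (norm x) / norm x * (x \<bullet> c)) *\<^sub>R (exp (\<psi> (norm x)) *\<^sub>R v x)))
      = (\<psi>1 (norm x) / norm x * (\<Sum>c\<in>Basis. (x \<bullet> c) * (x \<bullet> c))) *\<^sub>R (exp (\<psi> (norm x)) *\<^sub>R v x)"
    by (simp add: scaleR_sum_left sum_distrib_left mult_ac)
  then show ?thesis
    using assms
    by (simp add: Euler_def dir_deriv_conj scaleR_add_right sum.distrib sum_Basis_inner_square
        scaleR_sum_right power2_eq_square mult_ac del: scaleR_scaleR)
      (simp add: mult_ac)
qed

text \<open>The term (n - 1) psi' g / r from the Laplacian of the radial weight and the transport
  term 2 psi' d_r g combine into 2 psi' D g, so the remaining coefficients involve only psi' and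
  psi''.\<close>

lemma laplacian_conj:
  assumes x: "x \<noteq> 0"
  defines "g \<equiv> \<lambda>x. exp (\<psi> (norm x)) *\<^sub>R v x"
  shows "laplacian g x = exp (\<psi> (norm x)) *\<^sub>R laplacian v x + (2 * \<psi>1 (norm x)) *\<^sub>R half_deriv g x
    + (\<psi>2 (norm x) - (\<psi>1 (norm x))\<^sup>2) *\<^sub>R g x"
proof -
  let ?r = "norm x" and ?n = "real DIM('a)"
  define \<rho> where "\<rho> = (\<lambda>x::'a. exp (\<psi> (norm x)))"
  \<comment> \<open>The gradient of psi(|x|) is mu(|x|) x.\<close>
  define \<mu> where "\<mu> = (\<lambda>r. \<psi>1 r / r)"
  define \<mu>' where "\<mu>' = \<psi>2 ?r / ?r - \<psi>1 ?r / ?r\<^sup>2"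
  have s\<mu>: "smooth_on {0<..} \<mu>"
    using smooth_on_divide_power[OF \<psi>(2), of 1] by (simp add: \<mu>_def)
  have d\<mu>: "(\<mu> has_real_derivative \<mu>') (at ?r)"
    using x \<psi>(4)[of ?r] unfolding \<mu>_def \<mu>'_def
    by (auto intro!: derivative_eq_intros simp: field_simps power2_eq_square)
  have sg: "smooth_on (- {0}) g" unfolding g_def by (rule smooth_on_conj)
  have s\<rho>: "smooth_on (- {0}) \<rho>" unfolding \<rho>_def by (rule smooth_on_exp_norm)
  note diffs = smooth_on_differentiable[OF sg, of x] smooth_on_differentiable[OF s\<rho>, of x]
    smooth_on_differentiable[OF smooth_on_norm_compose[OF s\<mu>], of x]
  have 1: "dir_deriv b (\<lambda>y. \<rho> y *\<^sub>R dir_deriv b v y) x =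
      \<rho> x *\<^sub>R dir_deriv b (dir_deriv b v) x + (\<mu> ?r * (x \<bullet> b)) *\<^sub>R (\<rho> x *\<^sub>R dir_deriv b v x)" for b
    using x diffs dir_deriv_exp_norm[OF x, of b]
    by (subst dir_deriv_scaleR) (auto simp: v_differentiable \<rho>_def \<mu>_def)
  have 2: "dir_deriv b (\<lambda>y. (\<mu> (norm y) * (y \<bullet> b)) *\<^sub>R g y) x =
      (\<mu> ?r * (x \<bullet> b)) *\<^sub>R dir_deriv b g x + (\<mu> ?r + \<mu>' / ?r * ((x \<bullet> b) * (x \<bullet> b))) *\<^sub>R g x" if "b \<in> Basis" for b
  proof -
    have c: "(\<lambda>y::'a. y \<bullet> b) differentiable (at x)"
      by (rule smooth_on_differentiable[OF smooth_on_coord[of UNIV]]) simp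
    have "dir_deriv b (\<lambda>y. \<mu> (norm y) * (y \<bullet> b)) x = \<mu> ?r + \<mu>' / ?r * ((x \<bullet> b) * (x \<bullet> b))"
      using x diffs c that dir_deriv_norm_compose[OF x d\<mu>[unfolded has_real_derivative_iff_has_vector_derivative], of b]
      by (subst dir_deriv_mult) (auto simp: dir_deriv_coord)
    then show ?thesis
      using x diffs c by (subst dir_deriv_scaleR) (auto intro!: differentiable_mult)
  qed
  \<comment> \<open>The gradient of g is written with g, not v, in its second summand, so that
    differentiating once more produces derivatives of g.\<close>
  have "laplacian g x = (\<Sum>b\<in>Basis. dir_deriv b (\<lambda>y. \<rho> y *\<^sub>R dir_deriv b v y + (\<mu> (norm y) * (y \<bullet> b)) *\<^sub>R g y) x)"
    unfolding laplacian_def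
  proof (intro sum.cong refl dir_deriv_cong[OF open_off_0])
    fix b :: 'a and y :: 'a assume "y \<in> - {0}"
    then show "dir_deriv b g y = \<rho> y *\<^sub>R dir_deriv b v y + (\<mu> (norm y) * (y \<bullet> b)) *\<^sub>R g y"
      using dir_deriv_conj[of y b] by (simp add: g_def \<rho>_def \<mu>_def)
  qed (use x in simp)
  also have "\<dots> = (\<Sum>b\<in>Basis. dir_deriv b (\<lambda>y. \<rho> y *\<^sub>R dir_deriv b v y) x
      + dir_deriv b (\<lambda>y. (\<mu> (norm y) * (y \<bullet> b)) *\<^sub>R g y) x)"
  proof (intro sum.cong refl dir_deriv_add)
    fix b :: 'a
    show "(\<lambda>y. \<rho> y *\<^sub>R dir_deriv b v y) differentiable (at x)"
      using x by (intro smooth_on_differentiable[of "- {0}"] smooth_on_scaleR s\<rho> smooth_on_dir_deriv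
          smooth_on_subset[OF v] open_off_0) auto
    show "(\<lambda>y. (\<mu> (norm y) * (y \<bullet> b)) *\<^sub>R g y) differentiable (at x)"
      using x by (intro smooth_on_differentiable[of "- {0}"] smooth_on_scaleR smooth_on_mult
          smooth_on_norm_compose s\<mu> sg smooth_on_coord open_off_0) auto
  qed
  also have "\<dots> = \<rho> x *\<^sub>R laplacian v x + \<mu> ?r *\<^sub>R (\<rho> x *\<^sub>R Euler v x) + \<mu> ?r *\<^sub>R Euler g x
      + (?n * \<mu> ?r + \<mu>' / ?r * ?r\<^sup>2) *\<^sub>R g x"
  proof -
    have "(\<Sum>b\<in>Basis. (\<mu> ?r + \<mu>' / ?r * ((x \<bullet> b) * (x \<bullet> b))) *\<^sub>R g x) = (?n * \<mu> ?r + \<mu>' / ?r * ?r\<^sup>2) *\<^sub>R g x"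
      by (simp add: scaleR_sum_left[symmetric] sum.distrib sum_distrib_left[symmetric] sum_Basis_inner_square
          flip: times_divide_eq_left)
    moreover have "(\<Sum>b\<in>Basis. (\<mu> ?r * (x \<bullet> b)) *\<^sub>R dir_deriv b g x) = \<mu> ?r *\<^sub>R Euler g x"
      by (simp add: Euler_def scaleR_sum_right)
    moreover have "(\<Sum>b\<in>Basis. (\<mu> ?r * (x \<bullet> b)) *\<^sub>R (\<rho> x *\<^sub>R dir_deriv b v x)) = \<mu> ?r *\<^sub>R (\<rho> x *\<^sub>R Euler v x)"
      by (simp add: Euler_def scaleR_sum_right mult_ac)
    moreover have "(\<Sum>b\<in>Basis. \<rho> x *\<^sub>R dir_deriv b (dir_deriv b v) x) = \<rho> x *\<^sub>R laplacian v x"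
      by (simp add: laplacian_def scaleR_sum_right)
    ultimately show ?thesis
      by (simp only: 1 2 sum.distrib cong: sum.cong) (simp add: add_ac)
  qed
  also have "\<rho> x *\<^sub>R Euler v x = Euler g x - (\<psi>1 ?r * ?r) *\<^sub>R g x"
    using Euler_conj[OF x] by (simp add: g_def \<rho>_def)
  finally have L: "laplacian g x = \<rho> x *\<^sub>R laplacian v x + \<mu> ?r *\<^sub>R (Euler g x - (\<psi>1 ?r * ?r) *\<^sub>R g x)
      + \<mu> ?r *\<^sub>R Euler g x + (?n * \<mu> ?r + \<mu>' / ?r * ?r\<^sup>2) *\<^sub>R g x" .
  have c1: "\<mu> ?r * (\<psi>1 ?r * ?r) = (\<psi>1 ?r)\<^sup>2" "?n * \<mu> ?r + \<mu>' / ?r * ?r\<^sup>2 = \<psi>2 ?r + 2 * \<psi>1 ?r * ((?n - 1) / (2 * ?r))"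
    using x by (simp_all add: \<mu>_def \<mu>'_def field_simps power2_eq_square)
  have "laplacian g x = \<rho> x *\<^sub>R laplacian v x + (2 * \<mu> ?r) *\<^sub>R Euler g x
      + ((?n * \<mu> ?r + \<mu>' / ?r * ?r\<^sup>2) - \<mu> ?r * (\<psi>1 ?r * ?r)) *\<^sub>R g x"
  proof -
    have "(a::'b) + m *\<^sub>R (e - c *\<^sub>R y) + m *\<^sub>R e + k *\<^sub>R y = a + (2 * m) *\<^sub>R e + (k - m * c) *\<^sub>R y"
      for a e y :: 'b and m c k :: real
      unfolding mult_2 scaleR_left_distrib scaleR_left_diff_distrib scaleR_right_diff_distrib
      by simp
    then show ?thesis unfolding L .
  qed
  then have "laplacian g x = \<rho> x *\<^sub>R laplacian v x + (2 * \<mu> ?r) *\<^sub>R Euler g x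
      + (\<psi>2 ?r + 2 * \<psi>1 ?r * ((?n - 1) / (2 * ?r)) - (\<psi>1 ?r)\<^sup>2) *\<^sub>R g x"
    unfolding c1 .
  then show ?thesis
    by (simp add: half_deriv_def \<mu>_def \<rho>_def scaleR_add_right scaleR_diff_left scaleR_add_left)
qed

text \<open>By \<open>laplacian_conj\<close> the only possibly unbounded contribution to the
  Laplacian of g is 2 psi' D g, of order 1 + (n - 1) / |x|. An upper bound on psi is enough, as psi
  itself enters through its exponential.\<close>

lemma conj_compactly_supported:
  assumes dim: "DIM('a) \<noteq> 2" and R: "1 \<le> R" "\<And>x. R < norm x \<Longrightarrow> v x = 0"
    and bounds: "\<And>r. 0 < r \<Longrightarrow> r \<le> R \<Longrightarrow> \<psi> r \<le> B \<and> \<bar>\<psi>1 r\<bar> \<le> B \<and> \<bar>\<psi>2 r\<bar> \<le> B"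
  shows "\<exists>C. compactly_supported_off_0 (\<lambda>x. exp (\<psi> (norm x)) *\<^sub>R v x) R C (real DIM('a))"
proof -
  let ?n = "real DIM('a)"
  define g where "g = (\<lambda>x. exp (\<psi> (norm x)) *\<^sub>R v x)"
  have sg: "smooth_on (- {0}) g" unfolding g_def by (rule smooth_on_conj)
  have g0: "g x = 0" if "R < norm x" for x using that R by (simp add: g_def)
  have dv0: "dir_deriv b v x = 0" "dir_deriv b (dir_deriv b v) x = 0" if "R < norm x" for b x
    using that by (auto intro!: dir_deriv_zero_off[of R] R)
  obtain D1 where D1: "\<And>x. norm (v x) \<le> D1"
    using bounded_of_compact_support[OF smooth_on_continuous_on[OF v] R(2)] by metis
  have "\<exists>D. \<forall>x. norm (dir_deriv b v x) \<le> D \<and> norm (dir_deriv b (dir_deriv b v) x) \<le> D" for b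
  proof -
    obtain A where A: "\<And>x. norm (dir_deriv b v x) \<le> A"
      using bounded_of_compact_support[OF smooth_on_continuous_on[OF smooth_on_dir_deriv[OF v]] dv0(1)] by metis
    obtain A' where A': "\<And>x. norm (dir_deriv b (dir_deriv b v) x) \<le> A'"
      using bounded_of_compact_support[OF smooth_on_continuous_on[OF smooth_on_dir_deriv[OF smooth_on_dir_deriv[OF v]]] dv0(2)] by metis
    show ?thesis
      using A A' by (intro exI[of _ "max A A'"]) (auto simp: le_max_iff_disj)
  qed
  then obtain D where D: "norm (dir_deriv b v x) \<le> D b" "norm (dir_deriv b (dir_deriv b v) x) \<le> D b" for b x
    by metis
  define D2 where "D2 = (\<Sum>b\<in>(Basis::'a set). D b)"
  have D0: "0 \<le> D b" for b using order.trans[OF norm_ge_zero D(1)] .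
  have D2: "norm (dir_deriv b v x) \<le> D2" if "b \<in> Basis" for b x
    unfolding D2_def using member_le_sum[OF that, of D] D0 D(1)[of b x] by auto
  have L: "norm (laplacian v x) \<le> D2" for x
    unfolding laplacian_def D2_def by (intro sum_norm_le D)
  have pos: "0 \<le> D1" "0 \<le> D2" using order.trans[OF norm_ge_zero D1] order.trans[OF norm_ge_zero L] by auto
  define B' where "B' = max B 0"
  have B': "\<psi> r \<le> B'" "\<bar>\<psi>1 r\<bar> \<le> B'" "\<bar>\<psi>2 r\<bar> \<le> B'" "0 \<le> B'" if "0 < r" "r \<le> R" for r
    using bounds[OF that] by (auto simp: B'_def)
  have B0: "0 \<le> B'" by (simp add: B'_def)
  have bg: "norm (g x) \<le> exp B' * D1" if x: "x \<noteq> 0" for x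
  proof (cases "norm x \<le> R")
    case True
    then show ?thesis using x B'(1)[of "norm x"] D1[of x] by (auto simp: g_def intro!: mult_mono)
  qed (use g0 pos in auto)
  have bdg: "norm (dir_deriv b g x) \<le> exp B' * D2 + B' * (exp B' * D1)" if x: "x \<noteq> 0" and b: "b \<in> Basis" for b x
  proof (cases "norm x \<le> R")
    case True
    have "\<bar>\<psi>1 (norm x) / norm x * (x \<bullet> b)\<bar> = \<bar>\<psi>1 (norm x)\<bar> * (\<bar>x \<bullet> b\<bar> / norm x)"
      by (simp add: abs_mult)
    also have "\<dots> \<le> B' * 1"
      using x True B'[of "norm x"] Basis_le_norm[OF b, of x] by (intro mult_mono) (auto simp: divide_le_eq_1)
    finally have *: "\<bar>\<psi>1 (norm x) / norm x * (x \<bullet> b)\<bar> \<le> B'" by simp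
    have "norm (dir_deriv b g x) \<le> norm (exp (\<psi> (norm x)) *\<^sub>R dir_deriv b v x)
        + norm ((\<psi>1 (norm x) / norm x * (x \<bullet> b)) *\<^sub>R g x)"
      unfolding g_def dir_deriv_conj[OF x] by (rule norm_triangle_ineq)
    also have "\<dots> \<le> exp B' * D2 + B' * (exp B' * D1)"
      using x True B'(1)[of "norm x"] D2[OF b, of x] bg[OF x] * B0 unfolding norm_scaleR
      by (intro add_mono mult_mono) auto
    finally show ?thesis .
  next
    case False
    then show ?thesis using dir_deriv_zero_off[of R g x b] g0 pos B0 by simp
  qed
  define C1 where "C1 = exp B' * D2 + B' * (exp B' * D1) + exp B' * D1"
  have C1: "norm (g x) \<le> C1" "\<And>b. b \<in> Basis \<Longrightarrow> norm (dir_deriv b g x) \<le> C1" if "x \<noteq> 0" for x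
    using bg[OF that] bdg[OF that] pos B0 unfolding C1_def
    by (smt (verit) mult_nonneg_nonneg exp_ge_zero)+
  have C1_pos: "0 \<le> C1" unfolding C1_def using pos B0 by simp
  have n1: "1 \<le> ?n" using DIM_positive[where 'a = 'a] by linarith
  \<comment> \<open>C1 controls g and its gradient; the other summands follow the three terms of
    \<open>laplacian_conj\<close>.\<close>
  define C where "C = C1 + exp B' * D2 + 2 * B' * (?n * C1) + (B' + B'\<^sup>2) * C1"
  have "C1 \<le> C" unfolding C_def using C1_pos pos B0 by simp
  have bl: "norm (laplacian g x) \<le> C * (1 + (?n - 1) / norm x)" if x: "x \<noteq> 0" for x
  proof (cases "norm x \<le> R")
    case True
    let ?s = "1 + (?n - 1) / norm x"
    have s1: "1 \<le> ?s" using n1 by simp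
    have hd: "norm (half_deriv g x) \<le> ?n * C1 * ?s"
      by (rule norm_half_deriv_le[OF x C1[OF x]])
    have q: "\<bar>\<psi>2 (norm x) - (\<psi>1 (norm x))\<^sup>2\<bar> \<le> B' + B'\<^sup>2"
    proof -
      have "\<bar>\<psi>1 (norm x)\<bar>\<^sup>2 \<le> B'\<^sup>2" using B'(2)[of "norm x"] x True by (intro power_mono) auto
      moreover have "0 \<le> (\<psi>1 (norm x))\<^sup>2" "0 \<le> B'\<^sup>2" by simp_all
      moreover have "\<bar>\<psi>2 (norm x)\<bar> \<le> B'" using B'(3)[of "norm x"] x True by simp
      ultimately show ?thesis unfolding power2_abs by linarith
    qed
    have "norm (laplacian g x) \<le> norm (exp (\<psi> (norm x)) *\<^sub>R laplacian v x)
        + norm ((2 * \<psi>1 (norm x)) *\<^sub>R half_deriv g x) + norm ((\<psi>2 (norm x) - (\<psi>1 (norm x))\<^sup>2) *\<^sub>R g x)"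
      unfolding g_def laplacian_conj[OF x]
      by (intro order.trans[OF norm_triangle_ineq] add_mono norm_triangle_ineq order_refl)
    also have "\<dots> \<le> exp B' * D2 + (2 * B') * (?n * C1 * ?s) + (B' + B'\<^sup>2) * C1"
      using x True B'(1,2)[of "norm x"] L[of x] hd q C1[OF x] B0 unfolding norm_scaleR
      by (intro add_mono mult_mono) (auto simp: abs_mult)
    also have "\<dots> \<le> exp B' * D2 * ?s + (2 * B') * (?n * C1 * ?s) + (B' + B'\<^sup>2) * C1 * ?s"
    proof -
      have "0 \<le> exp B' * D2" "0 \<le> (B' + B'\<^sup>2) * C1" using pos B0 C1_pos by simp_all
      from this[THEN mult_left_mono[OF s1]] show ?thesis by linarith
    qed
    also have "\<dots> \<le> C * ?s"
    proof -
      have "0 \<le> C1 * ?s" using C1_pos s1 by simp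
      then show ?thesis unfolding C_def distrib_right by (simp add: mult.assoc)
    qed
    finally show ?thesis .
  next
    case False
    have "laplacian g x = 0"
      unfolding laplacian_def using False g0
      by (intro sum.neutral ballI dir_deriv_zero_off[of R]) (auto intro: dir_deriv_zero_off[of R])
    moreover have "0 \<le> C" using C1_pos \<open>C1 \<le> C\<close> by linarith
    ultimately show ?thesis using n1 by simp
  qed
  have bC: "norm (g x) \<le> C" "\<And>b. b \<in> Basis \<Longrightarrow> norm (dir_deriv b g x) \<le> C" if "x \<noteq> 0" for x
    using order.trans[OF C1(1)[OF that] \<open>C1 \<le> C\<close>] order.trans[OF C1(2)[OF that] \<open>C1 \<le> C\<close>] by simp_all
  have "compactly_supported_off_0 g R C ?n"
    by unfold_locales (simp_all add: R bC bl dim sg g0)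
  then show ?thesis unfolding g_def by blast
qed

end

section \<open>The weights\<close>

lemma hl_smooth_has_vector_derivative:
  assumes "hl_smooth \<phi>" "0 < r"
  shows "((hl_deriv ^^ k) \<phi> has_vector_derivative (hl_deriv ^^ Suc k) \<phi> r) (at r)"
proof -
  have "(hl_deriv ^^ k) \<phi> differentiable (at r within {0..})"
    using assms unfolding hl_smooth_def differentiable_on_def by simp
  then have "((hl_deriv ^^ k) \<phi> has_vector_derivative hl_deriv ((hl_deriv ^^ k) \<phi>) r) (at r within {0..})"
    unfolding hl_deriv_def by (simp add: vector_derivative_works)
  \<comment> \<open>A point r > 0 is interior to \<open>{0..}\<close>, so the one-sided derivative
    is the two-sided one.\<close>
  moreover have "at r within {0..} = at r"
    using assms(2) by (intro at_within_interior) simp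
  ultimately show ?thesis by simp
qed

lemma hl_smooth_smooth_on: "hl_smooth \<phi> \<Longrightarrow> smooth_on {0<..} ((hl_deriv ^^ k) \<phi>)"
  by (rule smooth_on_real_sequence[of "{0<..}" "\<lambda>k. (hl_deriv ^^ k) \<phi>"])
    (auto intro: hl_smooth_has_vector_derivative simp del: funpow.simps)

lemma hl_smooth_continuous_on: "hl_smooth \<phi> \<Longrightarrow> continuous_on {0..} ((hl_deriv ^^ k) \<phi>)"
  unfolding hl_smooth_def by (simp add: differentiable_imp_continuous_on)

lemma continuous_on_norm_compose:
  fixes f :: "real \<Rightarrow> 'b::topological_space"
  shows "continuous_on {0..} f \<Longrightarrow> continuous_on UNIV (\<lambda>x::'a::real_normed_vector. f (norm x))"
  by (rule continuous_on_compose2[of "{0..}" f]) (auto intro: continuous_intros)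

section \<open>The weights w and m\<close>

definition dw_wt :: "real \<Rightarrow> real \<Rightarrow> real" where
  "dw_wt \<delta> r = \<delta> * (1 + r) powr (- \<delta> - 1)"

lemma DERIV_w_wt: "0 \<le> r \<Longrightarrow> (w_wt \<delta> has_real_derivative dw_wt \<delta> r) (at r)"
  unfolding w_wt_def[abs_def] dw_wt_def by (auto intro!: derivative_eq_intros)

lemma smooth_on_shift_powr: "smooth_on {0<..} (\<lambda>r::real. (1 + r) powr c)"
  by (rule smooth_on_compose[OF open_greaterThan open_greaterThan[of 0] _ _ smooth_on_powr])
    (auto intro!: smooth_intros)

lemma smooth_on_w_wt: "smooth_on {0<..} (w_wt \<delta>)" "smooth_on {0<..} (dw_wt \<delta>)"
  unfolding w_wt_def[abs_def] dw_wt_def[abs_def]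
  by (intro smooth_on_diff smooth_on_mult smooth_on_const smooth_on_shift_powr open_greaterThan)+

text \<open>The mean value theorem gives w(r) = r w'(z) with 0 < z < r, and w' decreases from w'(0)
  = delta; hence r w'(r) <= w(r) <= delta r.\<close>

lemma w_wt_bounds:
  assumes \<delta>: "0 < \<delta>" and r: "0 < r"
  shows "0 \<le> w_wt \<delta> r" "w_wt \<delta> r \<le> 1" "w_wt \<delta> r \<le> \<delta> * r" "0 \<le> dw_wt \<delta> r" "0 < dw_wt \<delta> r"
    "r * dw_wt \<delta> r \<le> w_wt \<delta> r"
proof -
  show pos: "0 \<le> dw_wt \<delta> r" "0 < dw_wt \<delta> r" using \<delta> r by (auto simp: dw_wt_def)
  show "w_wt \<delta> r \<le> 1" by (simp add: w_wt_def)
  obtain z where z: "0 < z" "z < r" "w_wt \<delta> r - w_wt \<delta> 0 = (r - 0) * dw_wt \<delta> z"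
    using MVT2[OF r, of "w_wt \<delta>" "dw_wt \<delta>"] DERIV_w_wt by auto
  have "w_wt \<delta> 0 = 0" by (simp add: w_wt_def)
  then have w: "w_wt \<delta> r = r * dw_wt \<delta> z" using z(3) by simp
  have "(1 + r) powr (- \<delta> - 1) \<le> (1 + z) powr (- \<delta> - 1)"
    using z \<delta> by (intro powr_mono2') auto
  then have "dw_wt \<delta> r \<le> dw_wt \<delta> z" using \<delta> by (simp add: dw_wt_def)
  then show rw: "r * dw_wt \<delta> r \<le> w_wt \<delta> r" unfolding w using r by (intro mult_left_mono) auto
  then show "0 \<le> w_wt \<delta> r" using pos r by (meson less_imp_le mult_nonneg_nonneg order.trans)
  have "(1 + z) powr (- \<delta> - 1) \<le> 1 powr (- \<delta> - 1)"
    using z \<delta> by (intro powr_mono2') auto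
  then have "dw_wt \<delta> z \<le> \<delta>" using \<delta> by (simp add: dw_wt_def)
  then show "w_wt \<delta> r \<le> \<delta> * r" unfolding w using r by (simp add: mult.commute mult_left_mono)
qed

text \<open>The inequality (1 + r)^2 <= 2 (1 + r^2) is raised to the power (1 + delta) / 2, which is
  at most 1, so its factor 2 becomes at most 2.\<close>

lemma m_wt_dw_wt:
  assumes "0 < \<delta>" "\<delta> < 1" "0 \<le> r"
  shows "\<delta> / 2 \<le> (m_wt \<delta> r)\<^sup>2 * dw_wt \<delta> r"
proof -
  let ?s = "(1 + \<delta>) / 2"
  have m: "(m_wt \<delta> r)\<^sup>2 = (1 + r\<^sup>2) powr ?s"
    by (simp add: m_wt_def power2_eq_square flip: powr_add)
  have "(1 + r) powr (1 + \<delta>) = ((1 + r)\<^sup>2) powr ?s"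
  proof -
    have "(1 + r)\<^sup>2 = (1 + r) powr 2" using assms by simp
    moreover have "2 * ?s = 1 + \<delta>" by (simp add: field_simps)
    ultimately show ?thesis by (simp only: powr_powr)
  qed
  also have "\<dots> \<le> (2 * (1 + r\<^sup>2)) powr ?s"
  proof (rule powr_mono2)
    have "0 \<le> (1 - r)\<^sup>2" by simp
    then show "(1 + r)\<^sup>2 \<le> 2 * (1 + r\<^sup>2)" by (simp add: power2_eq_square algebra_simps)
  qed (use assms in auto)
  also have "\<dots> = 2 powr ?s * (1 + r\<^sup>2) powr ?s" by (rule powr_mult)
  also have "\<dots> \<le> 2 powr 1 * (1 + r\<^sup>2) powr ?s"
    using assms by (intro mult_right_mono powr_mono) auto
  finally have "(1 + r) powr (1 + \<delta>) \<le> 2 * (m_wt \<delta> r)\<^sup>2" by (simp add: m)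
  then have "(1 + r) powr (- \<delta> - 1) * (1 + r) powr (1 + \<delta>) \<le> (1 + r) powr (- \<delta> - 1) * (2 * (m_wt \<delta> r)\<^sup>2)"
    by (intro mult_left_mono) auto
  moreover have "(1 + r) powr (- \<delta> - 1) * (1 + r) powr (1 + \<delta>) = 1"
    using assms by (simp flip: powr_add)
  ultimately have "1 \<le> (1 + r) powr (- \<delta> - 1) * (2 * (m_wt \<delta> r)\<^sup>2)" by simp
  then have "\<delta> * 1 \<le> \<delta> * ((1 + r) powr (- \<delta> - 1) * (2 * (m_wt \<delta> r)\<^sup>2))"
    using assms by (intro mult_left_mono) auto
  then show ?thesis unfolding dw_wt_def by (simp add: mult_ac)
qed

lemma m_wt_ge_1: "0 < \<delta> \<Longrightarrow> 1 \<le> m_wt \<delta> r"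
  unfolding m_wt_def by (rule ge_one_powr_ge_zero) auto

lemma continuous_on_m_wt: "continuous_on UNIV (\<lambda>x::'a::real_normed_vector. m_wt \<delta> (norm x))"
proof -
  have "1 + (norm x)\<^sup>2 \<noteq> 0" for x :: 'a
    using zero_le_power2[of "norm x"] by linarith
  then show ?thesis unfolding m_wt_def by (intro continuous_intros) auto
qed

lemma continuous_on_dw_wt: "continuous_on UNIV (\<lambda>x::'a::real_normed_vector. dw_wt \<delta> (norm x))"
proof -
  have "1 + norm x \<noteq> 0" for x :: 'a using norm_ge_zero[of x] by linarith
  then show ?thesis unfolding dw_wt_def by (intro continuous_intros) auto
qed

lemma integrable_weight:
  fixes k f :: "'a::euclidean_space \<Rightarrow> real"
  assumes k: "continuous_on UNIV k" and f: "f \<in> borel_measurable lborel" "AE x in lborel. \<bar>f x\<bar> \<le> B"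
    "\<And>x. R < norm x \<Longrightarrow> f x = 0"
  shows "integrable lborel (\<lambda>x. k x * f x)"
proof -
  have "compact (k ` cball 0 (R + 1))"
    by (intro compact_continuous_image continuous_on_subset[OF k]) auto
  then obtain K where K: "\<And>x. x \<in> cball 0 (R + 1) \<Longrightarrow> \<bar>k x\<bar> \<le> K"
    using compact_imp_bounded bounded_iff by (metis image_eqI real_norm_def)
  have [measurable]: "k \<in> borel_measurable borel" using k by (rule borel_measurable_continuous_onI)
  show ?thesis
  proof (rule integrable_bounded_support[of _ "\<bar>K\<bar> * \<bar>B\<bar>" "R + 1"])
    show "(\<lambda>x. k x * f x) \<in> borel_measurable lborel" using f(1) by measurable
    show "AE x in lborel. norm (k x * f x) \<le> \<bar>K\<bar> * \<bar>B\<bar>"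
      using f(2)
    proof eventually_elim
      case (elim x)
      show ?case
      proof (cases "norm x \<le> R")
        case True
        then have "\<bar>k x\<bar> \<le> \<bar>K\<bar>" using K[of x] by fastforce
        then show ?thesis using elim by (auto simp: abs_mult intro!: mult_mono)
      qed (use f(3) in auto)
    qed
  qed (use f(3) in auto)
qed

lemma L2_norm_sq: "(L2_norm f)\<^sup>2 = (\<integral>x. (cmod (f x))\<^sup>2 \<partial>lborel)"
  unfolding L2_norm_def by (simp add: integral_nonneg_AE)

text \<open>The weight has a kink at 0 if \<open>\<phi>'\<close> does not vanish there. In dimension 1 a cutoff near 0 would leave
  a boundary term, so the integration by parts is done directly for the Lipschitz weight.\<close>

lemma integral_weighted_energy_eq_0:
  fixes v :: "'a::euclidean_space \<Rightarrow> 'b::euclidean_space" and \<phi> :: "real \<Rightarrow> real"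
  assumes \<phi>: "hl_smooth \<phi>" and M: "\<And>r. 0 < r \<Longrightarrow> \<bar>hl_deriv \<phi> r\<bar> \<le> M"
    and v: "smooth_on UNIV v" "\<And>x. R < norm x \<Longrightarrow> v x = 0"
  shows "has_bochner_integral lborel (\<lambda>x. exp (\<phi> (norm x)) * (laplacian v x \<bullet> v x + grad_sq v x)
    + hl_deriv \<phi> (norm x) / norm x * exp (\<phi> (norm x)) * (Euler v x \<bullet> v x)) 0"
proof -
  define \<rho> where "\<rho> = (\<lambda>x::'a. exp (\<phi> (norm x)))"
  define F where "F = (\<lambda>b x. \<rho> x * (dir_deriv b v x \<bullet> v x))"
  define H where "H = (\<lambda>b x. dir_deriv b (dir_deriv b v) x \<bullet> v x + dir_deriv b v x \<bullet> dir_deriv b v x)"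
  have s\<phi>: "smooth_on {0<..} \<phi>" "smooth_on {0<..} (hl_deriv \<phi>)"
    using hl_smooth_smooth_on[OF \<phi>, of 0] hl_smooth_smooth_on[OF \<phi>, of 1] by simp_all
  have d\<phi>: "(\<phi> has_real_derivative hl_deriv \<phi> r) (at r)" if "0 < r" for r
    using hl_smooth_has_vector_derivative[OF \<phi> that, of 0] by (simp add: has_real_derivative_iff_has_vector_derivative)
  have d\<phi>': "(hl_deriv \<phi> has_real_derivative hl_deriv (hl_deriv \<phi>) r) (at r)" if "0 < r" for r
    using hl_smooth_has_vector_derivative[OF \<phi> that, of 1] by (simp add: has_real_derivative_iff_has_vector_derivative)
  have s\<rho>: "smooth_on (- {0}) \<rho>" unfolding \<rho>_def by (rule smooth_on_exp_norm[OF s\<phi> d\<phi> d\<phi>' v(1)])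
  have c\<rho>: "continuous_on UNIV \<rho>"
    unfolding \<rho>_def using hl_smooth_continuous_on[OF \<phi>, of 0]
    by (intro continuous_on_exp continuous_on_norm_compose) simp
  have sv: "smooth_on UNIV (\<lambda>x. dir_deriv b v x \<bullet> v x)" "smooth_on UNIV (H b)" for b
    unfolding H_def by (intro smooth_intros v(1) open_UNIV)+
  have dv0: "dir_deriv b v x = 0" if "R < norm x" for b x
    using that v(2) by (intro dir_deriv_zero_off[of R])
  have Fd: "dir_deriv b (F b) x = \<rho> x * H b x + hl_deriv \<phi> (norm x) / norm x * \<rho> x * ((x \<bullet> b) * (dir_deriv b v x \<bullet> v x))"
    if x: "x \<noteq> 0" for b x
  proof -
    have "dir_deriv b (\<lambda>x. dir_deriv b v x \<bullet> v x) x = H b x"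
      unfolding H_def by (subst dir_deriv_inner) (auto intro!: smooth_on_differentiable[of UNIV] smooth_on_dir_deriv v(1))
    moreover have "dir_deriv b \<rho> x = hl_deriv \<phi> (norm x) / norm x * (x \<bullet> b) * \<rho> x"
      unfolding \<rho>_def by (rule dir_deriv_exp_norm[OF s\<phi> d\<phi> d\<phi>' v(1) x])
    ultimately show ?thesis
      unfolding F_def using x smooth_on_differentiable[OF s\<rho>, of x] smooth_on_differentiable[OF sv(1), of x b]
      by (subst dir_deriv_mult) auto
  qed
  have each: "has_bochner_integral lborel (dir_deriv b (F b)) 0" if b: "b \<in> Basis" for b
  proof -
    obtain L1 where L1: "\<And>x. norm (dir_deriv b v x \<bullet> v x) \<le> L1"
      using bounded_of_compact_support[OF smooth_on_continuous_on[OF sv(1)], of R] v(2) by (metis inner_zero_right)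
    obtain L2 where L2: "\<And>x. norm (H b x) \<le> L2"
      using bounded_of_compact_support[OF smooth_on_continuous_on[OF sv(2)], of R b] v(2) dv0
      unfolding H_def by (metis inner_zero_right add_0)
    have "compact (\<rho> ` cball 0 R)"
      by (intro compact_continuous_image continuous_on_subset[OF c\<rho>]) auto
    then obtain K where K: "\<And>x. x \<in> cball 0 R \<Longrightarrow> \<bar>\<rho> x\<bar> \<le> K"
      using compact_imp_bounded bounded_iff by (metis image_eqI real_norm_def)
    have sF: "smooth_on (- {0}) (F b)"
      unfolding F_def by (intro smooth_on_mult open_off_0 s\<rho> smooth_on_subset[OF sv(1)]) simp
    show ?thesis
    proof (rule has_bochner_integral_dir_deriv[of _ "R + 1" _ "\<bar>K\<bar> * \<bar>L2\<bar> + \<bar>M\<bar> * \<bar>K\<bar> * \<bar>L1\<bar>"])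
      show "continuous_on UNIV (F b)"
        unfolding F_def by (intro continuous_on_mult c\<rho> smooth_on_continuous_on sv)
      show "F b x = 0" if "R + 1 \<le> norm x" for x using that v(2)[of x] by (simp add: F_def)
      show "F b differentiable (at x)" if "x \<noteq> 0" for x
        using that by (intro smooth_on_differentiable[OF sF]) simp
      show "continuous_on (- {0}) (dir_deriv b (F b))"
        by (intro smooth_on_continuous_on smooth_on_dir_deriv sF)
      show "\<bar>dir_deriv b (F b) x\<bar> \<le> \<bar>K\<bar> * \<bar>L2\<bar> + \<bar>M\<bar> * \<bar>K\<bar> * \<bar>L1\<bar>" if x: "x \<noteq> 0" for x
      proof (cases "norm x \<le> R")
        case True
        then have \<rho>K: "\<bar>\<rho> x\<bar> \<le> \<bar>K\<bar>" using K[of x] by fastforce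
        have t: "\<bar>\<rho> x * H b x\<bar> \<le> \<bar>K\<bar> * \<bar>L2\<bar>"
          unfolding abs_mult using \<rho>K order.trans[OF L2[of x] abs_ge_self] by (intro mult_mono) auto
        \<comment> \<open>The quotient |x . b| / |x| is at most 1, so the derivative of the weight
          is bounded off the origin even where it has no continuous extension.\<close>
        have "\<bar>hl_deriv \<phi> (norm x) / norm x * \<rho> x * ((x \<bullet> b) * (dir_deriv b v x \<bullet> v x))\<bar>
            = \<bar>hl_deriv \<phi> (norm x)\<bar> * \<bar>\<rho> x\<bar> * ((\<bar>x \<bullet> b\<bar> / norm x) * \<bar>dir_deriv b v x \<bullet> v x\<bar>)"
          by (simp add: abs_mult)
        also have "\<dots> \<le> \<bar>M\<bar> * \<bar>K\<bar> * (1 * \<bar>L1\<bar>)"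
          using x \<rho>K order.trans[OF M[of "norm x"] abs_ge_self] order.trans[OF L1[of x] abs_ge_self] Basis_le_norm[OF b, of x]
          by (intro mult_mono) (auto simp: divide_le_eq_1)
        finally show ?thesis
          unfolding Fd[OF x] using t by (intro order.trans[OF abs_triangle_ineq] add_mono) simp_all
      next
        case False
        then show ?thesis unfolding Fd[OF x] by (simp add: H_def v(2) dv0)
      qed
    qed
  qed
  have "has_bochner_integral lborel (\<lambda>x. \<Sum>b\<in>Basis. dir_deriv b (F b) x) (\<Sum>b\<in>(Basis::'a set). 0)"
    by (intro has_bochner_integral_sum each)
  then have "has_bochner_integral lborel (\<lambda>x. \<Sum>b\<in>Basis. dir_deriv b (F b) x) 0" by simp
  moreover have "AE x in lborel. (\<Sum>b\<in>Basis. dir_deriv b (F b) x) = \<rho> x * (laplacian v x \<bullet> v x + grad_sq v x)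
    + hl_deriv \<phi> (norm x) / norm x * \<rho> x * (Euler v x \<bullet> v x)"
    using AE_lborel_singleton[of "0::'a"]
  proof eventually_elim
    case (elim x)
    have "(\<Sum>b\<in>Basis. H b x) = laplacian v x \<bullet> v x + grad_sq v x"
      by (simp add: H_def laplacian_def grad_sq_def sum.distrib inner_sum_left)
    moreover have "(\<Sum>b\<in>Basis. (x \<bullet> b) * (dir_deriv b v x \<bullet> v x)) = Euler v x \<bullet> v x"
      by (simp add: Euler_def inner_sum_left)
    ultimately show ?case
      by (simp only: Fd[OF elim] sum.distrib sum_distrib_left[symmetric])
  qed
  moreover have "(\<lambda>x. \<rho> x * (laplacian v x \<bullet> v x + grad_sq v x)
    + hl_deriv \<phi> (norm x) / norm x * \<rho> x * (Euler v x \<bullet> v x)) \<in> borel_measurable lborel"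
  proof -
    have c1: "continuous_on (- {0}) \<rho>" by (rule continuous_on_subset[OF c\<rho>]) simp
    have c2: "continuous_on (- {0}) (\<lambda>x::'a. hl_deriv \<phi> (norm x))"
      by (intro smooth_on_continuous_on smooth_on_norm_compose s\<phi>)
    have "smooth_on (- {0}) v" by (rule smooth_on_subset[OF v(1)]) simp
    then have c3: "continuous_on (- {0}) v" "continuous_on (- {0}) (Euler v)" "continuous_on (- {0}) (grad_sq v)"
      "continuous_on (- {0}) (laplacian v)"
      unfolding laplacian_def[abs_def]
      by (auto intro!: smooth_on_continuous_on smooth_on_Euler smooth_on_grad_sq smooth_on_sum smooth_on_dir_deriv)
    show ?thesis
      by (intro continuous_off_0_borel_measurable continuous_intros c1 c2 c3) auto
  qed
  ultimately show ?thesis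
    unfolding \<rho>_def
    by (subst has_bochner_integral_cong_AE[symmetric, where f = "\<lambda>x. \<Sum>b\<in>Basis. dir_deriv b (F b) x"])
      (auto simp: has_bochner_integral_iff dest: borel_measurable_integrable)
qed

section \<open>The Carleman estimate for fixed parameters\<close>

context
  fixes \<phi> :: "real \<Rightarrow> real" and M E B \<delta> h \<epsilon> R :: real
    and U G :: "real \<times> 'a::euclidean_space \<Rightarrow> real" and v :: "'a \<Rightarrow> complex"
  assumes dim: "DIM('a) \<noteq> 2" and E: "0 < E" and B: "0 \<le> B" and \<delta>: "0 < \<delta>" "\<delta> < 1" and h: "0 < h" and \<epsilon>: "0 \<le> \<epsilon>"
    and \<phi>: "hl_smooth \<phi>" "\<And>r. 0 \<le> r \<Longrightarrow> 0 \<le> hl_deriv \<phi> r" "\<And>r. 0 \<le> r \<Longrightarrow> hl_deriv \<phi> r \<le> M"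
    and U: "U \<in> borel_measurable polar_measure" "AE z in polar_measure. \<bar>U z\<bar> \<le> B"
    and G: "has_radial_derivative (\<lambda>(r, \<omega>). w_wt \<delta> r * (E - U (r, \<omega>) + (hl_deriv \<phi> r)\<^sup>2 - h * hl_deriv (hl_deriv \<phi>) r)) G"
      "AE (r, \<omega>) in polar_measure. G (r, \<omega>) \<ge> 1 / 4 * E * deriv (w_wt \<delta>) r"
    and v: "smooth_on UNIV v" "\<And>x. R < norm x \<Longrightarrow> v x = 0" and R: "1 \<le> R"
begin

text \<open>\<open>conj_v\<close> and \<open>conj_Pv\<close> are the functions g and f of the
  overview.\<close>

definition conj_v :: "'a \<Rightarrow> complex" where
  "conj_v x = exp (\<phi> (norm x) / h) *\<^sub>R v x"

definition conj_Pv :: "'a \<Rightarrow> complex" where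
  "conj_Pv x = exp (\<phi> (norm x) / h) *\<^sub>R (P_op U E h v x - \<i> * of_real \<epsilon> * v x)"

private abbreviation (input) "\<phi>' \<equiv> hl_deriv \<phi>"
private abbreviation (input) "\<phi>'' \<equiv> hl_deriv (hl_deriv \<phi>)"

private lemma smooth_\<phi>: "smooth_on {0<..} \<phi>" "smooth_on {0<..} \<phi>'" "smooth_on {0<..} \<phi>''"
  using hl_smooth_smooth_on[OF \<phi>(1), of 0] hl_smooth_smooth_on[OF \<phi>(1), of 1] hl_smooth_smooth_on[OF \<phi>(1), of 2]
  by (simp_all add: numeral_2_eq_2)

private lemma cont_\<phi>: "continuous_on {0..} \<phi>" "continuous_on {0..} \<phi>'" "continuous_on {0..} \<phi>''"
  using hl_smooth_continuous_on[OF \<phi>(1), of 0] hl_smooth_continuous_on[OF \<phi>(1), of 1] hl_smooth_continuous_on[OF \<phi>(1), of 2]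
  by (simp_all add: numeral_2_eq_2)

private lemma deriv_\<phi>:
  assumes "0 < r"
  shows "(\<phi> has_real_derivative \<phi>' r) (at r)" "(\<phi>' has_real_derivative \<phi>'' r) (at r)"
  using hl_smooth_has_vector_derivative[OF \<phi>(1) assms, of 0] hl_smooth_has_vector_derivative[OF \<phi>(1) assms, of 1]
  by (simp_all add: has_real_derivative_iff_has_vector_derivative)

private lemma bounded_\<phi>: obtains K where "\<And>r. 0 \<le> r \<Longrightarrow> r \<le> S \<Longrightarrow> \<bar>\<phi> r\<bar> \<le> K \<and> \<bar>\<phi>' r\<bar> \<le> K \<and> \<bar>\<phi>'' r\<bar> \<le> K"
proof -
  have "\<exists>K. \<forall>r\<in>{0..S}. \<bar>f r\<bar> \<le> K" if "continuous_on {0..} f" for f :: "real \<Rightarrow> real"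
  proof -
    have "compact (f ` {0..S})"
      by (intro compact_continuous_image continuous_on_subset[OF that]) auto
    then show ?thesis using compact_imp_bounded[of "f ` {0..S}"] unfolding bounded_iff by auto
  qed
  from this[OF cont_\<phi>(1)] this[OF cont_\<phi>(2)] this[OF cont_\<phi>(3)] obtain K1 K2 K3 where
    "\<forall>r\<in>{0..S}. \<bar>\<phi> r\<bar> \<le> K1" "\<forall>r\<in>{0..S}. \<bar>\<phi>' r\<bar> \<le> K2" "\<forall>r\<in>{0..S}. \<bar>\<phi>'' r\<bar> \<le> K3" by blast
  then show ?thesis
    by (intro that[of "max K1 (max K2 K3)"]) (auto simp: le_max_iff_disj)
qed

private lemma scaled_weight:
  "smooth_on {0<..} (\<lambda>r. \<phi> r / h)" "smooth_on {0<..} (\<lambda>r. \<phi>' r / h)"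
  "0 < r \<Longrightarrow> ((\<lambda>r. \<phi> r / h) has_real_derivative \<phi>' r / h) (at r)"
  "0 < r \<Longrightarrow> ((\<lambda>r. \<phi>' r / h) has_real_derivative \<phi>'' r / h) (at r)"
proof -
  show "smooth_on {0<..} (\<lambda>r. \<phi> r / h)" "smooth_on {0<..} (\<lambda>r. \<phi>' r / h)"
    unfolding divide_inverse by (intro smooth_on_mult smooth_on_const smooth_\<phi> open_greaterThan)+
qed (intro DERIV_cdivide deriv_\<phi>; assumption)+

private lemma conj_v_locale: "\<exists>C. compactly_supported_off_0 conj_v R C (real DIM('a))"
proof -
  obtain K where K: "\<And>r. 0 \<le> r \<Longrightarrow> r \<le> R \<Longrightarrow> \<bar>\<phi> r\<bar> \<le> K \<and> \<bar>\<phi>' r\<bar> \<le> K \<and> \<bar>\<phi>'' r\<bar> \<le> K"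
    using bounded_\<phi> by metis
  have "\<phi> r / h \<le> K / h \<and> \<bar>\<phi>' r / h\<bar> \<le> K / h \<and> \<bar>\<phi>'' r / h\<bar> \<le> K / h" if "0 < r" "r \<le> R" for r
  proof -
    have "\<phi> r \<le> K" "\<bar>\<phi>' r\<bar> \<le> K" "\<bar>\<phi>'' r\<bar> \<le> K" using K[of r] that by auto
    then show ?thesis using h by (auto intro!: divide_right_mono simp: abs_divide)
  qed
  from conj_compactly_supported[OF scaled_weight v(1) dim R v(2) this]
  show ?thesis unfolding conj_v_def[abs_def] by simp
qed

text \<open>Two forms of f. The first keeps the Laplacian of the smooth v; it serves the energy
  bound and shows that f is bounded almost everywhere, the singular parts of the Laplacian of g and
  of D g cancelling. The second serves the multiplier argument.\<close>

private lemma conj_Pv_eq: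
  assumes x: "x \<noteq> 0"
  shows "conj_Pv x = - h\<^sup>2 *\<^sub>R (exp (\<phi> (norm x) / h) *\<^sub>R laplacian v x) + (U (polar x) - E) *\<^sub>R conj_v x
      - \<epsilon> *\<^sub>R (\<i> * conj_v x)" (is ?t1)
    and "conj_Pv x = - h\<^sup>2 *\<^sub>R laplacian conj_v x + (2 * h * \<phi>' (norm x)) *\<^sub>R half_deriv conj_v x
      + (h * \<phi>'' (norm x) - (\<phi>' (norm x))\<^sup>2 + U (polar x) - E) *\<^sub>R conj_v x - \<epsilon> *\<^sub>R (\<i> * conj_v x)"
proof -
  show t1: ?t1
    by (simp add: conj_Pv_def conj_v_def P_op_def polar_def scaleR_conv_of_real algebra_simps)
  have L: "exp (\<phi> (norm x) / h) *\<^sub>R laplacian v x = laplacian conj_v x - (2 * (\<phi>' (norm x) / h)) *\<^sub>R half_deriv conj_v x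
    - (\<phi>'' (norm x) / h - (\<phi>' (norm x) / h)\<^sup>2) *\<^sub>R conj_v x"
    using laplacian_conj[OF scaled_weight v(1) x] unfolding conj_v_def[abs_def] by simp
  have c: "h\<^sup>2 * (2 * (\<phi>' (norm x) / h)) = 2 * h * \<phi>' (norm x)"
    "h\<^sup>2 * (\<phi>'' (norm x) / h - (\<phi>' (norm x) / h)\<^sup>2) = h * \<phi>'' (norm x) - (\<phi>' (norm x))\<^sup>2"
    using h by (simp_all add: field_simps power2_eq_square)
  have "- h\<^sup>2 *\<^sub>R (exp (\<phi> (norm x) / h) *\<^sub>R laplacian v x) = - h\<^sup>2 *\<^sub>R laplacian conj_v x
      + (2 * h * \<phi>' (norm x)) *\<^sub>R half_deriv conj_v x + (h * \<phi>'' (norm x) - (\<phi>' (norm x))\<^sup>2) *\<^sub>R conj_v x"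
    unfolding L c[symmetric] by (simp add: scaleR_right_diff_distrib scaleR_minus_left)
  then show "conj_Pv x = - h\<^sup>2 *\<^sub>R laplacian conj_v x + (2 * h * \<phi>' (norm x)) *\<^sub>R half_deriv conj_v x
      + (h * \<phi>'' (norm x) - (\<phi>' (norm x))\<^sup>2 + U (polar x) - E) *\<^sub>R conj_v x - \<epsilon> *\<^sub>R (\<i> * conj_v x)"
    unfolding t1 by (simp add: scaleR_left_distrib scaleR_left_diff_distrib)
qed

text \<open>The inner product on the complex numbers is the real one, so the term - i epsilon g is
  orthogonal to g and drops out of the energy identity.\<close>

private lemma inner_ii_self: "(\<i> * z) \<bullet> z = 0" for z :: complex
  by (simp add: inner_complex_def)

private lemma cont_v: "continuous_on UNIV v" "continuous_on UNIV conj_v" "continuous_on UNIV (laplacian v)"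
  "continuous_on UNIV (\<lambda>x::'a. exp (\<phi> (norm x) / h))"
proof -
  show "continuous_on UNIV v" by (rule smooth_on_continuous_on[OF v(1)])
  moreover show e: "continuous_on UNIV (\<lambda>x::'a. exp (\<phi> (norm x) / h))"
    using h by (intro continuous_on_exp continuous_on_divide continuous_on_norm_compose cont_\<phi> continuous_on_const) auto
  ultimately show "continuous_on UNIV conj_v" unfolding conj_v_def[abs_def] by (intro continuous_on_scaleR)
  show "continuous_on UNIV (laplacian v)"
    unfolding laplacian_def[abs_def]
    by (intro smooth_on_continuous_on smooth_on_sum smooth_on_dir_deriv v(1) open_UNIV)
qed

private lemma measurable_conj: "conj_v \<in> borel_measurable borel" "conj_Pv \<in> borel_measurable borel"
  "(\<lambda>x::'a. U (polar x)) \<in> borel_measurable borel"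
proof -
  show m: "(\<lambda>x::'a. U (polar x)) \<in> borel_measurable borel"
    using borel_measurable_polar[OF U(1)] by simp
  note [measurable] = cont_v[THEN borel_measurable_continuous_onI] this
  show "conj_v \<in> borel_measurable borel" by measurable
  have "conj_Pv = (\<lambda>x. exp (\<phi> (norm x) / h) *\<^sub>R (- of_real (h\<^sup>2) * laplacian v x + of_real (U (polar x) - E) * v x
      - \<i> * of_real \<epsilon> * v x))"
    by (simp add: conj_Pv_def[abs_def] P_op_def polar_def)
  also have "\<dots> \<in> borel_measurable borel" by measurable
  finally show "conj_Pv \<in> borel_measurable borel" .
qed

private lemma conj_v_off: "R < norm x \<Longrightarrow> conj_v x = 0" "R < norm x \<Longrightarrow> conj_Pv x = 0"
proof -
  assume x: "R < norm x"
  then show "conj_v x = 0" by (simp add: conj_v_def v(2))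
  have "laplacian v x = 0"
    unfolding laplacian_def using x v(2)
    by (intro sum.neutral ballI dir_deriv_zero_off[of R]) (auto intro: dir_deriv_zero_off[of R])
  with x show "conj_Pv x = 0" by (simp add: conj_Pv_def P_op_def v(2))
qed

private lemma conj_v_bounded: obtains K where "\<And>x. cmod (conj_v x) \<le> K"
  using bounded_of_compact_support[OF cont_v(2) conj_v_off(1)] by metis

private lemma AE_U: "AE x::'a in lborel. \<bar>U (polar x)\<bar> \<le> B"
  using AE_polar[OF U(2)] by simp

private lemma conj_Pv_bounded: obtains K where "AE x in lborel. cmod (conj_Pv x) \<le> K"
proof -
  obtain K1 where K1: "\<And>x. cmod (conj_v x) \<le> K1" using conj_v_bounded by metis
  have "continuous_on UNIV (\<lambda>x. exp (\<phi> (norm x) / h) *\<^sub>R laplacian v x)"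
    by (intro continuous_intros cont_v)
  moreover have "exp (\<phi> (norm x) / h) *\<^sub>R laplacian v x = 0" if "R < norm x" for x
    unfolding laplacian_def using that v(2)
    by (subst sum.neutral) (auto intro!: dir_deriv_zero_off[of R] intro: dir_deriv_zero_off[of R])
  ultimately obtain K2 where K2: "\<And>x. cmod (exp (\<phi> (norm x) / h) *\<^sub>R laplacian v x) \<le> K2"
    using bounded_of_compact_support[of "\<lambda>x. exp (\<phi> (norm x) / h) *\<^sub>R laplacian v x" R] by metis
  have "AE x in lborel. cmod (conj_Pv x) \<le> h\<^sup>2 * K2 + (\<bar>B\<bar> + E) * K1 + \<epsilon> * K1"
    using AE_U AE_lborel_singleton[of "0::'a"]
  proof eventually_elim
    case (elim x)
    have "cmod (conj_Pv x) \<le> cmod (- h\<^sup>2 *\<^sub>R (exp (\<phi> (norm x) / h) *\<^sub>R laplacian v x))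
        + cmod ((U (polar x) - E) *\<^sub>R conj_v x) + cmod (\<epsilon> *\<^sub>R (\<i> * conj_v x))"
      unfolding conj_Pv_eq(1)[OF elim(2)]
      by (intro order.trans[OF norm_triangle_ineq4] add_mono norm_triangle_ineq order_refl)
    also have "\<dots> = h\<^sup>2 * cmod (exp (\<phi> (norm x) / h) *\<^sub>R laplacian v x) + \<bar>U (polar x) - E\<bar> * cmod (conj_v x)
        + \<epsilon> * cmod (conj_v x)"
      using \<epsilon> by (simp add: norm_mult)
    also have "\<dots> \<le> h\<^sup>2 * K2 + (\<bar>B\<bar> + E) * K1 + \<epsilon> * K1"
      using K1[of x] K2[of x] elim(1) E \<epsilon> by (intro add_mono mult_mono) auto
    finally show ?case .
  qed
  then show ?thesis by (rule that)
qed

private lemma integrable_conj: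
  assumes "continuous_on UNIV (k :: 'a \<Rightarrow> real)"
  shows "integrable lborel (\<lambda>x. k x * (cmod (conj_v x))\<^sup>2)" "integrable lborel (\<lambda>x. k x * (cmod (conj_Pv x))\<^sup>2)"
proof -
  note [measurable] = measurable_conj
  obtain K1 where K1: "\<And>x. cmod (conj_v x) \<le> K1" using conj_v_bounded by metis
  obtain K2 where K2: "AE x in lborel. cmod (conj_Pv x) \<le> K2" using conj_Pv_bounded by metis
  show "integrable lborel (\<lambda>x. k x * (cmod (conj_v x))\<^sup>2)"
  proof (rule integrable_weight[OF assms, of _ "K1\<^sup>2" R])
    show "AE x in lborel. \<bar>(cmod (conj_v x))\<^sup>2\<bar> \<le> K1\<^sup>2"
      using K1 by (intro AE_I2) (simp add: power_mono)
  qed (auto simp: conj_v_off)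
  show "integrable lborel (\<lambda>x. k x * (cmod (conj_Pv x))\<^sup>2)"
  proof (rule integrable_weight[OF assms, of _ "K2\<^sup>2" R])
    show "AE x in lborel. \<bar>(cmod (conj_Pv x))\<^sup>2\<bar> \<le> K2\<^sup>2"
      using K2 by eventually_elim (simp add: power_mono)
  qed (auto simp: conj_v_off)
qed

private lemma integrable_conj_1:
  "integrable lborel (\<lambda>x. (cmod (conj_v x))\<^sup>2)" "integrable lborel (\<lambda>x. (cmod (conj_Pv x))\<^sup>2)"
  using integrable_conj[of "\<lambda>_. 1"] by simp_all

text \<open>The classical energy estimate from pairing f with g, carried out on v because g need not
  be smooth at the origin. D g is first replaced by d_r g under the integral, and h d_r g is then
  compared pointwise with the weighted gradient of v.\<close>

lemma half_deriv_energy: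
  "h\<^sup>2 * (\<integral>x. half_deriv conj_v x \<bullet> half_deriv conj_v x \<partial>lborel) \<le>
    (2 + 4 * (B + E) + 10 * M\<^sup>2) * ((\<integral>x. (cmod (conj_Pv x))\<^sup>2 \<partial>lborel) + (\<integral>x. (cmod (conj_v x))\<^sup>2 \<partial>lborel))"
proof -
  obtain C where "compactly_supported_off_0 conj_v R C (real DIM('a))" using conj_v_locale by blast
  then interpret compactly_supported_off_0 conj_v R C "real DIM('a)" .
  define \<rho> where "\<rho> = (\<lambda>x::'a. exp (\<phi> (norm x) / h))"
  \<comment> \<open>Twice phi/h, since |g|^2 carries the squared weight.\<close>
  define \<psi> where "\<psi> = (\<lambda>r. 2 / h * \<phi> r)"
  have M: "\<bar>\<phi>' r\<bar> \<le> M" if "0 \<le> r" for r using \<phi>(2,3)[OF that] by simp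
  define S where "S = (\<lambda>x. exp (\<psi> (norm x)) * (laplacian v x \<bullet> v x + grad_sq v x)
    + hl_deriv \<psi> (norm x) / norm x * exp (\<psi> (norm x)) * (Euler v x \<bullet> v x))"
  \<comment> \<open>Scaling commutes with the iterated one-sided derivatives. The claim is confined
    to r >= 0, where those derivatives are meaningful, and includes the endpoint 0.\<close>
  have seq: "(hl_deriv ^^ k) \<psi> r = 2 / h * (hl_deriv ^^ k) \<phi> r" if "0 \<le> r" for k r
    using that
  proof (induction k arbitrary: r)
    case 0
    then show ?case by (simp add: \<psi>_def)
  next
    case (Suc k)
    have d: "(hl_deriv ^^ k) \<phi> differentiable (at r within {0..})"
      using \<phi>(1) Suc.prems unfolding hl_smooth_def differentiable_on_def by simp
    have "((hl_deriv ^^ k) \<psi> has_vector_derivative 2 / h * vector_derivative ((hl_deriv ^^ k) \<phi>) (at r within {0..})) (at r within {0..})"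
    proof (rule has_vector_derivative_transform[of r "{0..}"])
      show "((\<lambda>r. 2 / h * (hl_deriv ^^ k) \<phi> r) has_vector_derivative
          2 / h * vector_derivative ((hl_deriv ^^ k) \<phi>) (at r within {0..})) (at r within {0..})"
        by (rule has_vector_derivative_mult_right) (use d in \<open>simp add: vector_derivative_works\<close>)
    qed (use Suc in auto)
    then have "vector_derivative ((hl_deriv ^^ k) \<psi>) (at r within {0..}) =
        2 / h * vector_derivative ((hl_deriv ^^ k) \<phi>) (at r within {0..})"
    proof (rule vector_derivative_within[rotated])
      show "at r within {0..} \<noteq> bot"
      proof
        assume "at r within {0..} = bot"
        moreover have "at_right r \<le> at r within {0..}"
          by (rule at_le) (use Suc.prems in auto)
        ultimately have "at_right r = bot" by (simp add: bot_unique)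
        then show False by simp
      qed
    qed
    then show ?case
      by (simp only: funpow.simps o_apply hl_deriv_def[of "(hl_deriv ^^ k) \<psi>"] hl_deriv_def[of "(hl_deriv ^^ k) \<phi>"])
  qed
  have \<psi>: "hl_smooth \<psi>"
    unfolding hl_smooth_def
  proof
    fix k
    have "(\<lambda>r. 2 / h * (hl_deriv ^^ k) \<phi> r) differentiable_on {0..}"
      using \<phi>(1) unfolding hl_smooth_def by (intro differentiable_on_mult differentiable_on_const) auto
    then show "(hl_deriv ^^ k) \<psi> differentiable_on {0..}"
      unfolding differentiable_on_def
      using seq by (auto intro: differentiable_transform_within[OF _ zero_less_one])
  qed
  have \<psi>': "hl_deriv \<psi> r = 2 / h * \<phi>' r" if "0 \<le> r" for r using seq[OF that, of 1] by simp
  have "\<bar>hl_deriv \<psi> r\<bar> \<le> 2 / h * M" if "0 < r" for r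
    using that h M[of r] by (simp add: \<psi>' abs_mult divide_right_mono)
  from integral_weighted_energy_eq_0[OF \<psi> this v]
  have S: "has_bochner_integral lborel S 0" unfolding S_def .
  have le: "AE x in lborel. h\<^sup>2 * ((Euler conj_v x \<bullet> Euler conj_v x) / (norm x)\<^sup>2) \<le>
      4 * h\<^sup>2 * S x + 2 * (cmod (conj_Pv x))\<^sup>2 + (2 + 4 * (B + E) + 10 * M\<^sup>2) * (cmod (conj_v x))\<^sup>2"
    using AE_U AE_lborel_singleton[of "0::'a"]
  proof eventually_elim
    case (elim x)
    let ?r = "norm x" and ?g = "conj_v x" and ?f = "conj_Pv x"
    \<comment> \<open>h times the radial derivative of g is e + y, where e comes from
      differentiating v and y from differentiating the weight.\<close>
    define e where "e = (h * \<rho> x / ?r) *\<^sub>R Euler v x"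
    define y where "y = \<phi>' ?r *\<^sub>R ?g"
    have r: "0 < ?r" using elim by simp
    have p: "\<bar>\<phi>' ?r\<bar> \<le> M" using M by simp
    have yy: "y \<bullet> y \<le> M\<^sup>2 * (cmod ?g)\<^sup>2"
    proof -
      have "\<bar>\<phi>' ?r\<bar>\<^sup>2 \<le> M\<^sup>2" using p by (intro power_mono) auto
      then have "\<bar>\<phi>' ?r\<bar>\<^sup>2 * (cmod ?g)\<^sup>2 \<le> M\<^sup>2 * (cmod ?g)\<^sup>2" by (intro mult_right_mono) auto
      then show ?thesis by (simp add: y_def dot_square_norm power_mult_distrib)
    qed
    have ee: "e \<bullet> e \<le> (h * \<rho> x)\<^sup>2 * grad_sq v x"
    proof -
      have "e \<bullet> e = (h * \<rho> x / ?r)\<^sup>2 * (Euler v x \<bullet> Euler v x)" by (simp add: e_def power2_eq_square)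
      also have "\<dots> \<le> (h * \<rho> x / ?r)\<^sup>2 * (?r\<^sup>2 * grad_sq v x)"
        by (intro mult_left_mono Euler_sq_le) simp
      finally show ?thesis using r by (simp add: power_divide)
    qed
    have E1: "(h / ?r) *\<^sub>R Euler conj_v x = e + y"
      using Euler_conj[OF scaled_weight v(1) elim(2)] r h
      unfolding conj_v_def[abs_def] e_def y_def \<rho>_def by (simp add: scaleR_right_distrib)
    have "h\<^sup>2 * ((Euler conj_v x \<bullet> Euler conj_v x) / ?r\<^sup>2) = (e + y) \<bullet> (e + y)"
      unfolding E1[symmetric] by (simp add: power2_eq_square)
    also have "\<dots> \<le> 2 * (e \<bullet> e) + 2 * (y \<bullet> y)"
      using inner_ge_zero[of "e - y"]
      unfolding inner_add_left inner_add_right inner_diff_left inner_diff_right inner_commute[of y e] by linarith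
    finally have A: "h\<^sup>2 * ((Euler conj_v x \<bullet> Euler conj_v x) / ?r\<^sup>2)
        \<le> 2 * ((h * \<rho> x)\<^sup>2 * grad_sq v x) + 2 * (M\<^sup>2 * (cmod ?g)\<^sup>2)" using ee yy by linarith
    have \<rho>2: "exp (\<psi> ?r) = (\<rho> x)\<^sup>2"
      using h by (simp add: \<psi>_def \<rho>_def power2_eq_square exp_add[symmetric])
    have fg: "?f \<bullet> ?g = - ((h * \<rho> x)\<^sup>2 * (laplacian v x \<bullet> v x)) + (U (polar x) - E) * (?g \<bullet> ?g)"
      unfolding conj_Pv_eq(1)[OF elim(2)]
      by (simp add: inner_add_left inner_diff_left inner_ii_self)
        (simp add: conj_v_def \<rho>_def power2_eq_square mult_ac)
    have ey: "2 * (e \<bullet> y) = h\<^sup>2 * (hl_deriv \<psi> ?r / ?r * (\<rho> x)\<^sup>2 * (Euler v x \<bullet> v x))"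
    proof -
      have "conj_v x = \<rho> x *\<^sub>R v x" by (simp add: conj_v_def \<rho>_def)
      then show ?thesis
        using h r by (simp add: e_def y_def \<psi>' field_simps power2_eq_square)
    qed
    have "h\<^sup>2 * S x = (h * \<rho> x)\<^sup>2 * (laplacian v x \<bullet> v x) + (h * \<rho> x)\<^sup>2 * grad_sq v x + 2 * (e \<bullet> y)"
      unfolding S_def ey \<rho>2 by (simp add: algebra_simps power_mult_distrib)
    then have hS: "h\<^sup>2 * S x = - (?f \<bullet> ?g) + (U (polar x) - E) * (?g \<bullet> ?g) + (h * \<rho> x)\<^sup>2 * grad_sq v x + 2 * (e \<bullet> y)"
      unfolding fg by simp
    \<comment> \<open>Young's inequality with weight 1/2 on |e|^2: since |e|^2 is at most (h rho)^2
      |grad v|^2, half of that energy can be absorbed on the left.\<close>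
    have "0 \<le> (e + 2 *\<^sub>R y) \<bullet> (e + 2 *\<^sub>R y)" by (rule inner_ge_zero)
    then have t1: "- (2 * (e \<bullet> y)) \<le> 1 / 2 * (e \<bullet> e) + 2 * (y \<bullet> y)"
      unfolding inner_add_left inner_add_right inner_commute[of y e] inner_scaleR_left inner_scaleR_right
      by argo
    have "0 \<le> (?f - ?g) \<bullet> (?f - ?g)" by (rule inner_ge_zero)
    then have t2: "?f \<bullet> ?g \<le> 1 / 2 * (cmod ?f)\<^sup>2 + 1 / 2 * (cmod ?g)\<^sup>2"
      unfolding inner_diff_left inner_diff_right inner_commute[of ?g ?f] dot_square_norm[symmetric] by argo
    have "- (B + E) * (?g \<bullet> ?g) \<le> (U (polar x) - E) * (?g \<bullet> ?g)"
      using elim(1) by (intro mult_right_mono) auto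
    then have t3: "- ((B + E) * (cmod ?g)\<^sup>2) \<le> (U (polar x) - E) * (?g \<bullet> ?g)"
      unfolding mult_minus_left dot_square_norm .
    have "(h * \<rho> x)\<^sup>2 * grad_sq v x \<le> 2 * (h\<^sup>2 * S x) + (cmod ?f)\<^sup>2 + (cmod ?g)\<^sup>2 + 2 * ((B + E) * (cmod ?g)\<^sup>2)
        + 4 * (M\<^sup>2 * (cmod ?g)\<^sup>2)"
      using hS t1 t2 t3 ee yy by linarith
    \<comment> \<open>Twice the last bound, with its coefficient 4, plus the 2 from \<open>A\<close>
      gives the coefficient 10 of M^2.\<close>
    with A have "h\<^sup>2 * ((Euler conj_v x \<bullet> Euler conj_v x) / ?r\<^sup>2) \<le> 4 * (h\<^sup>2 * S x) + 2 * (cmod ?f)\<^sup>2 + 2 * (cmod ?g)\<^sup>2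
        + 4 * ((B + E) * (cmod ?g)\<^sup>2) + 10 * (M\<^sup>2 * (cmod ?g)\<^sup>2)"
      by linarith
    then show ?case by (simp add: distrib_right mult.assoc)
  qed
  let ?K = "2 + 4 * (B + E) + 10 * M\<^sup>2"
  have i: "integrable lborel (\<lambda>x. 4 * h\<^sup>2 * S x + 2 * (cmod (conj_Pv x))\<^sup>2 + ?K * (cmod (conj_v x))\<^sup>2)"
    using S integrable_conj_1 by (intro Bochner_Integration.integrable_add integrable_mult_right) (auto simp: has_bochner_integral_iff)
  have "h\<^sup>2 * (\<integral>x. half_deriv conj_v x \<bullet> half_deriv conj_v x \<partial>lborel)
      \<le> h\<^sup>2 * (\<integral>x. (Euler conj_v x \<bullet> Euler conj_v x) / (norm x)\<^sup>2 \<partial>lborel)"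
    by (intro mult_left_mono integral_half_deriv_sq_le) simp
  also have "\<dots> = (\<integral>x. h\<^sup>2 * ((Euler conj_v x \<bullet> Euler conj_v x) / (norm x)\<^sup>2) \<partial>lborel)"
    by (rule integral_mult_right_zero[symmetric])
  also have "\<dots> \<le> (\<integral>x. 4 * h\<^sup>2 * S x + 2 * (cmod (conj_Pv x))\<^sup>2 + ?K * (cmod (conj_v x))\<^sup>2 \<partial>lborel)"
    by (intro integral_mono_AE le i integrable_mult_right integrable_radial_sq)
  also have "\<dots> = 2 * (\<integral>x. (cmod (conj_Pv x))\<^sup>2 \<partial>lborel) + ?K * (\<integral>x. (cmod (conj_v x))\<^sup>2 \<partial>lborel)"
    using S integrable_conj_1 by (simp add: has_bochner_integral_iff)
  also have "\<dots> \<le> ?K * ((\<integral>x. (cmod (conj_Pv x))\<^sup>2 \<partial>lborel) + (\<integral>x. (cmod (conj_v x))\<^sup>2 \<partial>lborel))"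
  proof -
    have "2 \<le> ?K" using E B by simp
    then have "2 * (\<integral>x. (cmod (conj_Pv x))\<^sup>2 \<partial>lborel) \<le> ?K * (\<integral>x. (cmod (conj_Pv x))\<^sup>2 \<partial>lborel)"
      by (intro mult_right_mono integral_nonneg_AE) auto
    then show ?thesis unfolding distrib_left by linarith
  qed
  finally show ?thesis .
qed

text \<open>The gain h^2 w' |D g|^2 from the Laplacian is spent exactly on the source term: 2 |f| |D
  g| <= h^2 w' |D g|^2 + |f|^2 / (h^2 w'). What remains is the gain from the effective potential,
  against f and the epsilon terms.\<close>

lemma carleman_integrated:
  defines "D \<equiv> half_deriv conj_v"
  shows "E / 4 * (\<integral>x. dw_wt \<delta> (norm x) * (cmod (conj_v x))\<^sup>2 \<partial>lborel) \<le>
    2 / (\<delta> * h\<^sup>2) * (\<integral>x. (m_wt \<delta> (norm x))\<^sup>2 * (cmod (conj_Pv x))\<^sup>2 \<partial>lborel)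
    + \<epsilon> / h * (\<integral>x. (cmod (conj_v x))\<^sup>2 \<partial>lborel) + \<epsilon> * h * (\<integral>x. D x \<bullet> D x \<partial>lborel)"
proof -
  obtain C where "compactly_supported_off_0 conj_v R C (real DIM('a))" using conj_v_locale by blast
  then interpret compactly_supported_off_0 conj_v R C "real DIM('a)" .
  define Q where "Q = (\<lambda>(r, \<omega>). w_wt \<delta> r * (E - U (r, \<omega>) + (\<phi>' r)\<^sup>2 - h * \<phi>'' r))"
  have QG: "has_radial_derivative Q G" using G(1) unfolding Q_def .
  have M: "\<bar>\<phi>' r\<bar> \<le> M" if "0 \<le> r" for r using \<phi>(2,3)[OF that] by simp
  obtain BQ where BQ: "AE z in polar_measure. \<bar>Q z\<bar> \<le> BQ"
    using QG by (auto simp: has_radial_derivative_def Linfty_def)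
  obtain K where K: "\<And>r. 0 \<le> r \<Longrightarrow> r \<le> 1 \<Longrightarrow> \<bar>\<phi> r\<bar> \<le> K \<and> \<bar>\<phi>' r\<bar> \<le> K \<and> \<bar>\<phi>'' r\<bar> \<le> K"
    using bounded_\<phi> by metis
  have K0: "0 \<le> K" using K[of 0] abs_ge_zero[of "\<phi> 0"] by linarith
  \<comment> \<open>For r <= 1 the linear bound comes from w <= delta r and the boundedness of phi''
    on [0, 1]; for r > 1 the essential bound of Q may simply be multiplied by r.\<close>
  define KQ where "KQ = \<bar>BQ\<bar> + \<delta> * (E + B + M\<^sup>2 + h * K)"
  have Q: "AE z in polar_measure. \<bar>Q z\<bar> \<le> KQ * fst z"
    using BQ U(2) AE_space
  proof eventually_elim
    case (elim z)
    obtain r \<omega> where z: "z = (r, \<omega>)" "0 < r" using elim(3) by (cases z) (auto simp: space_polar_measure)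
    have pos: "0 \<le> \<delta> * (E + B + M\<^sup>2 + h * K)" using \<delta> E B h K0 by simp
    show ?case
    proof (cases "r \<le> 1")
      case True
      have "\<bar>\<phi>' r\<bar>\<^sup>2 \<le> M\<^sup>2" using M[of r] z by (intro power_mono) auto
      moreover have "\<bar>h * \<phi>'' r\<bar> \<le> h * K" using K[of r] z True h by (simp add: abs_mult)
      ultimately have "\<bar>E - U (r, \<omega>) + (\<phi>' r)\<^sup>2 - h * \<phi>'' r\<bar> \<le> E + B + M\<^sup>2 + h * K"
        using elim(2) E zero_le_power2[of "\<phi>' r"] unfolding z power2_abs by linarith
      then have "\<bar>Q z\<bar> \<le> (\<delta> * r) * (E + B + M\<^sup>2 + h * K)"
        unfolding Q_def z using w_wt_bounds[OF \<delta>(1) z(2)] \<delta> z(2)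
        by (simp add: abs_mult) (intro mult_mono, auto)
      also have "\<dots> = \<delta> * (E + B + M\<^sup>2 + h * K) * r" by (simp add: mult_ac)
      also have "\<dots> \<le> KQ * r" unfolding KQ_def using z by (intro mult_right_mono) auto
      finally show ?thesis by (simp add: z)
    next
      case False
      have "\<bar>Q z\<bar> \<le> \<bar>BQ\<bar> * 1" using elim(1) by simp
      also have "\<dots> \<le> KQ * r" unfolding KQ_def using False pos by (intro mult_mono) auto
      finally show ?thesis by (simp add: z)
    qed
  qed
  note pair = radial_derivative_pairing[OF QG Q, folded D_def]
  note w = w_wt_bounds[OF \<delta>(1)]
  note mult = radial_multiplier_inequality[OF smooth_on_w_wt[of \<delta>] DERIV_w_wt[OF less_imp_le] w(1) w(2) w(3) w(4) w(6), folded D_def]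
  define P where "P = (\<lambda>x. 2 * w_wt \<delta> (norm x) * (laplacian conj_v x \<bullet> D x))"
  define W where "W = (\<lambda>x. dw_wt \<delta> (norm x) * (D x \<bullet> D x))"
  define N where "N = (\<lambda>x. Q (polar x) * (2 * (conj_v x \<bullet> D x)))"
  define F where "F = (\<lambda>x. (m_wt \<delta> (norm x))\<^sup>2 * (cmod (conj_Pv x))\<^sup>2)"
  have F: "integrable lborel F"
    unfolding F_def by (intro integrable_conj continuous_intros continuous_on_m_wt)
  have DD: "integrable lborel (\<lambda>x. D x \<bullet> D x)" unfolding D_def by (rule integrable_half_deriv_sq)
  have point: "AE x in lborel. - h\<^sup>2 * P x - N x \<le>
      h\<^sup>2 * W x + 2 / (\<delta> * h\<^sup>2) * F x + \<epsilon> / h * (cmod (conj_v x))\<^sup>2 + \<epsilon> * h * (D x \<bullet> D x)"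
    using AE_lborel_singleton[of "0::'a"]
  proof eventually_elim
    case (elim x)
    let ?w = "w_wt \<delta> (norm x)" and ?w' = "dw_wt \<delta> (norm x)" and ?g = "conj_v x" and ?f = "conj_Pv x"
    let ?d = "norm (D x)"
    have r: "0 < norm x" using elim by simp
    have fD: "?f \<bullet> D x = - h\<^sup>2 * (laplacian conj_v x \<bullet> D x) + 2 * h * \<phi>' (norm x) * (D x \<bullet> D x)
        + (h * \<phi>'' (norm x) - (\<phi>' (norm x))\<^sup>2 + U (polar x) - E) * (?g \<bullet> D x) - \<epsilon> * ((\<i> * ?g) \<bullet> D x)"
      unfolding conj_Pv_eq(2)[OF elim] by (simp add: inner_add_left inner_diff_left D_def)
    \<comment> \<open>Solved for the second order and potential terms, the formula for f leaves f
      itself, a first order term of favourable sign and the term in epsilon.\<close>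
    have eq: "- h\<^sup>2 * P x - N x = 2 * (?w * (?f \<bullet> D x)) - 4 * (h * \<phi>' (norm x) * ?w * (D x \<bullet> D x))
        + 2 * \<epsilon> * (?w * ((\<i> * ?g) \<bullet> D x))"
      unfolding fD P_def N_def Q_def polar_def by (simp add: algebra_simps)
    have "0 \<le> h * \<phi>' (norm x) * ?w * (D x \<bullet> D x)" using h \<phi>(2)[of "norm x"] w(1)[OF r] by simp
    moreover have "?w * (?f \<bullet> D x) \<le> cmod ?f * ?d"
    proof -
      have "?w * (?f \<bullet> D x) \<le> 1 * \<bar>?f \<bullet> D x\<bar>"
        by (rule order.trans[OF mult_left_mono[OF abs_ge_self w(1)[OF r]] mult_right_mono[OF w(2)[OF r] abs_ge_zero]])
      then show ?thesis using Cauchy_Schwarz_ineq2[of ?f "D x"] by simp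
    qed
    moreover have "2 * (cmod ?f * ?d) \<le> h\<^sup>2 * W x + 2 / (\<delta> * h\<^sup>2) * F x"
    proof -
      \<comment> \<open>k dominates 1 / w'; this is where the weight m enters.\<close>
      define k where "k = 2 / \<delta> * (m_wt \<delta> (norm x))\<^sup>2"
      have w': "0 < ?w'" by (rule w(5)[OF r])
      have "1 \<le> k * ?w'"
        using m_wt_dw_wt[OF \<delta>, of "norm x"] \<delta> by (simp add: k_def field_simps)
      then have "1 / ?w' \<le> k" using w' by (simp add: divide_le_eq)
      then have "(cmod ?f / h)\<^sup>2 * (1 / ?w') \<le> (cmod ?f / h)\<^sup>2 * k" by (intro mult_left_mono) auto
      moreover have "2 * (cmod ?f * ?d) \<le> h\<^sup>2 * ?w' * ?d\<^sup>2 + (cmod ?f / h)\<^sup>2 * (1 / ?w')"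
      proof -
        have "0 \<le> (h\<^sup>2 * ?w' * ?d - cmod ?f)\<^sup>2 / (h\<^sup>2 * ?w')" using w' h by simp
        also have "\<dots> = h\<^sup>2 * ?w' * ?d\<^sup>2 + (cmod ?f / h)\<^sup>2 * (1 / ?w') - 2 * (cmod ?f * ?d)"
          using w' h by (simp add: power2_eq_square field_simps)
        finally show ?thesis by simp
      qed
      moreover have "(cmod ?f / h)\<^sup>2 * k = 2 / (\<delta> * h\<^sup>2) * F x"
        by (simp add: k_def F_def power_divide mult_ac)
      moreover have "h\<^sup>2 * ?w' * ?d\<^sup>2 = h\<^sup>2 * W x" by (simp add: W_def dot_square_norm)
      ultimately show ?thesis by linarith
    qed
    moreover have "2 * \<epsilon> * (?w * ((\<i> * ?g) \<bullet> D x)) \<le> \<epsilon> / h * (cmod ?g)\<^sup>2 + \<epsilon> * h * (D x \<bullet> D x)"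
    proof -
      have "?w * ((\<i> * ?g) \<bullet> D x) \<le> 1 * \<bar>(\<i> * ?g) \<bullet> D x\<bar>"
        by (rule order.trans[OF mult_left_mono[OF abs_ge_self w(1)[OF r]] mult_right_mono[OF w(2)[OF r] abs_ge_zero]])
      also have "\<dots> \<le> cmod ?g * ?d" using Cauchy_Schwarz_ineq2[of "\<i> * ?g" "D x"] by (simp add: norm_mult)
      finally have "2 * \<epsilon> * (?w * ((\<i> * ?g) \<bullet> D x)) \<le> 2 * \<epsilon> * (cmod ?g * ?d)"
        using \<epsilon> by (intro mult_left_mono) auto
      also have "\<dots> \<le> \<epsilon> / h * (cmod ?g)\<^sup>2 + \<epsilon> * h * ?d\<^sup>2"
      proof -
        \<comment> \<open>The square is balanced in h so that epsilon h |D g|^2 is epsilon / h times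
          h^2 |D g|^2, the quantity bounded by the energy estimate.\<close>
        have "0 \<le> \<epsilon> / h * (cmod ?g - h * ?d)\<^sup>2" using \<epsilon> h by simp
        also have "\<dots> = \<epsilon> / h * (cmod ?g)\<^sup>2 + \<epsilon> * h * ?d\<^sup>2 - 2 * \<epsilon> * (cmod ?g * ?d)"
          using h by (simp add: power2_eq_square field_simps)
        finally show ?thesis by simp
      qed
      finally show ?thesis by (simp add: dot_square_norm)
    qed
    ultimately show ?case unfolding eq by linarith
  qed
  have gi: "integrable lborel (\<lambda>x. (cmod (conj_v x))\<^sup>2)" by (rule integrable_conj_1)
  have Pi: "integrable lborel P" unfolding P_def by (rule mult(1))
  have Wi: "integrable lborel W" unfolding W_def by (rule mult(2))
  have Ni: "integrable lborel N" unfolding N_def by (rule pair(1))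
  have "(\<integral>x. - h\<^sup>2 * P x - N x \<partial>lborel) \<le>
      (\<integral>x. h\<^sup>2 * W x + 2 / (\<delta> * h\<^sup>2) * F x + \<epsilon> / h * (cmod (conj_v x))\<^sup>2 + \<epsilon> * h * (D x \<bullet> D x) \<partial>lborel)"
    by (rule integral_mono_AE[OF _ _ point])
      (intro Bochner_Integration.integrable_diff Bochner_Integration.integrable_add integrable_mult_right Pi Wi Ni F gi DD)+
  also have "\<dots> = h\<^sup>2 * (\<integral>x. W x \<partial>lborel) + 2 / (\<delta> * h\<^sup>2) * (\<integral>x. F x \<partial>lborel)
      + \<epsilon> / h * (\<integral>x. (cmod (conj_v x))\<^sup>2 \<partial>lborel) + \<epsilon> * h * (\<integral>x. D x \<bullet> D x \<partial>lborel)"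
    by (simp only: Bochner_Integration.integral_add Bochner_Integration.integrable_add integrable_mult_right
        Wi F gi DD integral_mult_right_zero)
  finally have I: "(\<integral>x. - h\<^sup>2 * P x - N x \<partial>lborel) \<le> \<dots>" .
  have "(\<integral>x. - h\<^sup>2 * P x - N x \<partial>lborel) = - h\<^sup>2 * (\<integral>x. P x \<partial>lborel) - (\<integral>x. N x \<partial>lborel)"
    by (simp only: Bochner_Integration.integral_diff integrable_mult_right Pi Ni integral_mult_right_zero)
  moreover have "h\<^sup>2 * (\<integral>x. P x \<partial>lborel) \<le> h\<^sup>2 * (- (\<integral>x. W x \<partial>lborel))"
    unfolding P_def W_def by (intro mult_left_mono mult(3)) simp_all
  moreover have "(\<integral>x. N x \<partial>lborel) = - (\<integral>x. G (polar x) * (conj_v x \<bullet> conj_v x) \<partial>lborel)"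
    unfolding N_def by (rule pair(3))
  moreover have "(\<integral>x. E / 4 * (dw_wt \<delta> (norm x) * (cmod (conj_v x))\<^sup>2) \<partial>lborel)
      \<le> (\<integral>x. G (polar x) * (conj_v x \<bullet> conj_v x) \<partial>lborel)"
  proof (rule integral_mono_AE)
    show "integrable lborel (\<lambda>x. E / 4 * (dw_wt \<delta> (norm x) * (cmod (conj_v x))\<^sup>2))"
      by (intro integrable_mult_right integrable_conj continuous_on_dw_wt)
    show "AE x in lborel. E / 4 * (dw_wt \<delta> (norm x) * (cmod (conj_v x))\<^sup>2) \<le> G (polar x) * (conj_v x \<bullet> conj_v x)"
      using AE_polar[OF G(2)]
    proof eventually_elim
      case (elim x)
      have "deriv (w_wt \<delta>) (norm x) = dw_wt \<delta> (norm x)"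
        by (rule DERIV_imp_deriv[OF DERIV_w_wt]) simp
      then have "E / 4 * dw_wt \<delta> (norm x) * (cmod (conj_v x))\<^sup>2 \<le> G (polar x) * (cmod (conj_v x))\<^sup>2"
        using elim by (intro mult_right_mono) (auto simp: polar_def)
      then show ?case by (simp add: dot_square_norm)
    qed
  qed (rule pair(2))
  moreover have "(\<integral>x. E / 4 * (dw_wt \<delta> (norm x) * (cmod (conj_v x))\<^sup>2) \<partial>lborel) =
      E / 4 * (\<integral>x. dw_wt \<delta> (norm x) * (cmod (conj_v x))\<^sup>2 \<partial>lborel)"
    by (rule integral_mult_right_zero)
  ultimately show ?thesis
    using I unfolding F_def by linarith
qed

text \<open>C does not involve h, epsilon or v. Its summand 1 serves the case epsilon > h; 8 / (E
  delta) inverts the product of E / 4 with the factor delta / 2 comparing m^(-2) and w'; and h0^2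
  turns the norm of f from the energy bound into one divided by h^2.\<close>

lemma carleman_fixed_parameters:
  fixes h0 :: real
  assumes h0: "h \<le> h0"
  defines "K \<equiv> 2 + 4 * (B + E) + 10 * M\<^sup>2"
  defines "C \<equiv> 1 + 8 / (E * \<delta>) * (2 / \<delta> + K * h0\<^sup>2 + 1 + K)"
  shows "(L2_norm (\<lambda>x. of_real (inverse (m_wt \<delta> (norm x)) * exp (\<phi> (norm x) / h)) * v x))\<^sup>2
      \<le> C / h\<^sup>2 * (L2_norm (\<lambda>x. of_real (m_wt \<delta> (norm x) * exp (\<phi> (norm x) / h)) *
             (P_op U E h v x - \<i> * of_real \<epsilon> * v x)))\<^sup>2
        + C * \<epsilon> / h * (L2_norm (\<lambda>x. of_real (exp (\<phi> (norm x) / h)) * v x))\<^sup>2"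
proof -
  define A where "A = (\<integral>x. (inverse (m_wt \<delta> (norm x)))\<^sup>2 * (cmod (conj_v x))\<^sup>2 \<partial>lborel)"
  define F where "F = (\<integral>x. (m_wt \<delta> (norm x))\<^sup>2 * (cmod (conj_Pv x))\<^sup>2 \<partial>lborel)"
  define F0 where "F0 = (\<integral>x. (cmod (conj_Pv x))\<^sup>2 \<partial>lborel)"
  define U0 where "U0 = (\<integral>x. (cmod (conj_v x))\<^sup>2 \<partial>lborel)"
  have m: "1 \<le> m_wt \<delta> (norm x)" for x :: 'a by (rule m_wt_ge_1[OF \<delta>(1)])
  have norms: "(L2_norm (\<lambda>x. of_real (inverse (m_wt \<delta> (norm x)) * exp (\<phi> (norm x) / h)) * v x))\<^sup>2 = A"
    "(L2_norm (\<lambda>x. of_real (m_wt \<delta> (norm x) * exp (\<phi> (norm x) / h)) * (P_op U E h v x - \<i> * of_real \<epsilon> * v x)))\<^sup>2 = F"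
    "(L2_norm (\<lambda>x. of_real (exp (\<phi> (norm x) / h)) * v x))\<^sup>2 = U0"
    unfolding L2_norm_sq A_def F_def U0_def conj_v_def conj_Pv_def
    by (simp_all add: norm_mult norm_inverse power_inverse power_mult_distrib mult.assoc)
  have nonneg: "0 \<le> F" "0 \<le> F0" "0 \<le> U0" unfolding F_def F0_def U0_def by (intro integral_nonneg_AE; simp)+
  have K: "2 \<le> K" unfolding K_def using B E by simp
  have Fm: "integrable lborel (\<lambda>x. (m_wt \<delta> (norm x))\<^sup>2 * (cmod (conj_Pv x))\<^sup>2)"
    by (intro integrable_conj continuous_intros continuous_on_m_wt)
  have F0F: "F0 \<le> F"
    unfolding F_def F0_def
  proof (rule integral_mono[OF integrable_conj_1(2) Fm])
    fix x :: 'a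
    have "1 \<le> (m_wt \<delta> (norm x))\<^sup>2" using m[of x] by (rule one_le_power)
    from mult_right_mono[OF this, of "(cmod (conj_Pv x))\<^sup>2"]
    show "(cmod (conj_Pv x))\<^sup>2 \<le> (m_wt \<delta> (norm x))\<^sup>2 * (cmod (conj_Pv x))\<^sup>2" by simp
  qed
  have ci: "continuous_on UNIV (\<lambda>x::'a. (inverse (m_wt \<delta> (norm x)))\<^sup>2)"
    using m by (intro continuous_intros continuous_on_m_wt) (metis not_one_le_zero)
  have C: "1 \<le> C" unfolding C_def using E \<delta> K by simp
  have "A \<le> C / h\<^sup>2 * F + C * \<epsilon> / h * U0"
  proof (cases "\<epsilon> \<le> h")
    case False
    have "A \<le> U0"
      unfolding A_def U0_def
    proof (rule integral_mono[OF integrable_conj(1)[OF ci] integrable_conj_1(1)])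
      fix x :: 'a
      have "(inverse (m_wt \<delta> (norm x)))\<^sup>2 \<le> 1"
        using m[of x] by (intro power_le_one) (auto simp: inverse_le_1_iff)
      from mult_right_mono[OF this, of "(cmod (conj_v x))\<^sup>2"]
      show "(inverse (m_wt \<delta> (norm x)))\<^sup>2 * (cmod (conj_v x))\<^sup>2 \<le> (cmod (conj_v x))\<^sup>2" by simp
    qed
    also have "\<dots> = 1 * 1 * U0" by simp
    also have "\<dots> \<le> C * (\<epsilon> / h) * U0"
      using C False h nonneg by (intro mult_right_mono mult_mono) auto
    finally show ?thesis
      using C nonneg by (simp add: add_increasing)
  next
    case True
    let ?D2 = "\<integral>x. half_deriv conj_v x \<bullet> half_deriv conj_v x \<partial>lborel"
    let ?W = "\<integral>x. dw_wt \<delta> (norm x) * (cmod (conj_v x))\<^sup>2 \<partial>lborel"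
    have e: "0 \<le> \<epsilon> / h" "\<epsilon> / h \<le> 1" using True \<epsilon> h by auto
    have hh: "1 \<le> h0\<^sup>2 / h\<^sup>2" using h0 h by (simp add: power_mono)
    have "h\<^sup>2 * ?D2 \<le> K * (F0 + U0)"
      using half_deriv_energy unfolding K_def F0_def U0_def .
    then have "\<epsilon> / h * (h\<^sup>2 * ?D2) \<le> \<epsilon> / h * (K * (F0 + U0))"
      using e by (intro mult_left_mono) auto
    moreover have "\<epsilon> / h * (h\<^sup>2 * ?D2) = \<epsilon> * h * ?D2" using h by (simp add: power2_eq_square)
    moreover have "\<epsilon> / h * (K * (F0 + U0)) = K * (\<epsilon> / h * F0) + K * (\<epsilon> / h) * U0"
      by (simp add: distrib_left mult_ac)
    moreover have "\<epsilon> / h * F0 \<le> h0\<^sup>2 / h\<^sup>2 * F"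
      using e hh F0F nonneg by (intro mult_mono) auto
    then have "K * (\<epsilon> / h * F0) \<le> K * (h0\<^sup>2 / h\<^sup>2 * F)" using K by (intro mult_left_mono) auto
    moreover have "E / 4 * ?W \<le> 2 / (\<delta> * h\<^sup>2) * F + \<epsilon> / h * U0 + \<epsilon> * h * ?D2"
      using carleman_integrated unfolding F_def U0_def .
    ultimately have "E / 4 * ?W \<le> 2 / (\<delta> * h\<^sup>2) * F + K * (h0\<^sup>2 / h\<^sup>2 * F) + (\<epsilon> / h * U0 + K * (\<epsilon> / h) * U0)"
      by linarith
    also have "\<dots> = (2 / \<delta> + K * h0\<^sup>2) / h\<^sup>2 * F + (1 + K) * (\<epsilon> / h) * U0"
      using h by (simp add: field_simps)
    also have "\<dots> \<le> (2 / \<delta> + K * h0\<^sup>2 + 1 + K) / h\<^sup>2 * F + (2 / \<delta> + K * h0\<^sup>2 + 1 + K) * (\<epsilon> / h) * U0"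
    proof -
      have "0 \<le> 2 / \<delta>" "0 \<le> K * h0\<^sup>2" using \<delta> K by auto
      then have "2 / \<delta> + K * h0\<^sup>2 \<le> 2 / \<delta> + K * h0\<^sup>2 + 1 + K" "1 + K \<le> 2 / \<delta> + K * h0\<^sup>2 + 1 + K"
        using K by linarith+
      then show ?thesis
        by (intro add_mono[OF mult_right_mono[OF divide_right_mono] mult_right_mono[OF mult_right_mono]])
          (use e nonneg in auto)
    qed
    finally have W: "E / 4 * ?W \<le> (2 / \<delta> + K * h0\<^sup>2 + 1 + K) / h\<^sup>2 * F + (2 / \<delta> + K * h0\<^sup>2 + 1 + K) * (\<epsilon> / h) * U0" .
    have "\<delta> / 2 * A = (\<integral>x. \<delta> / 2 * ((inverse (m_wt \<delta> (norm x)))\<^sup>2 * (cmod (conj_v x))\<^sup>2) \<partial>lborel)"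
      unfolding A_def by (rule integral_mult_right_zero[symmetric])
    also have "\<dots> \<le> ?W"
    proof (rule integral_mono)
      show "integrable lborel (\<lambda>x. \<delta> / 2 * ((inverse (m_wt \<delta> (norm x)))\<^sup>2 * (cmod (conj_v x))\<^sup>2))"
        by (intro integrable_mult_right integrable_conj ci)
      show "integrable lborel (\<lambda>x. dw_wt \<delta> (norm x) * (cmod (conj_v x))\<^sup>2)"
        by (intro integrable_conj continuous_on_dw_wt)
      fix x :: 'a
      have "\<delta> / 2 * (inverse (m_wt \<delta> (norm x)))\<^sup>2 \<le> dw_wt \<delta> (norm x)"
        using m_wt_dw_wt[OF \<delta>, of "norm x"] m[of x] by (simp add: field_simps power_inverse)
      from mult_right_mono[OF this, of "(cmod (conj_v x))\<^sup>2"]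
      show "\<delta> / 2 * ((inverse (m_wt \<delta> (norm x)))\<^sup>2 * (cmod (conj_v x))\<^sup>2) \<le> dw_wt \<delta> (norm x) * (cmod (conj_v x))\<^sup>2"
        by (simp add: mult.assoc)
    qed
    finally have "E / 4 * (\<delta> / 2 * A) \<le> E / 4 * ?W" using E by (intro mult_left_mono) auto
    from order.trans[OF this W]
    have "E * \<delta> / 8 * A \<le> (2 / \<delta> + K * h0\<^sup>2 + 1 + K) * (F / h\<^sup>2 + \<epsilon> / h * U0)"
      by (simp add: distrib_left)
    then have "8 / (E * \<delta>) * (E * \<delta> / 8 * A) \<le>
        8 / (E * \<delta>) * ((2 / \<delta> + K * h0\<^sup>2 + 1 + K) * (F / h\<^sup>2 + \<epsilon> / h * U0))"
      using E \<delta> by (intro mult_left_mono) auto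
    moreover have "8 / (E * \<delta>) * (E * \<delta> / 8 * A) = A" using E \<delta> by simp
    ultimately have "A \<le> 8 / (E * \<delta>) * (2 / \<delta> + K * h0\<^sup>2 + 1 + K) * (F / h\<^sup>2 + \<epsilon> / h * U0)"
      by (simp only: mult.assoc)
    also have "\<dots> \<le> C * (F / h\<^sup>2 + \<epsilon> / h * U0)"
    proof (rule mult_right_mono)
      show "0 \<le> F / h\<^sup>2 + \<epsilon> / h * U0"
        using nonneg e \<epsilon> h by (intro add_nonneg_nonneg mult_nonneg_nonneg divide_nonneg_nonneg) auto
    qed (simp add: C_def)
    finally show ?thesis by (simp add: distrib_left)
  qed
  then show ?thesis unfolding norms .
qed

end

theorem lemma2p2:
  fixes V :: "real \<Rightarrow> real \<times> 'a::euclidean_space \<Rightarrow> real"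
    and \<phi> :: "real \<Rightarrow> real"
    and E \<delta>0 \<delta> h0 R0 :: real
  assumes dim: "DIM('a) \<noteq> 2"
    and E: "E > 0"
    and \<delta>0: "0 < \<delta>0" "\<delta>0 < 1"
    and V: "\<And>h. h > 0 \<Longrightarrow>
        (AE (r, \<omega>) in polar_measure. V h (r, \<omega>) \<le> (1 + r) powr (- \<delta>0)) \<and>
        (\<exists>W. has_radial_derivative (V h) W \<and>
             (AE (r, \<omega>) in polar_measure. W (r, \<omega>) \<le> (1 + r) powr (- 1 - \<delta>0)))"
    and \<delta>: "0 < \<delta>" "\<delta> < \<delta>0"
    and h0: "h0 > 0"
    and V_unif: "\<exists>B. \<forall>h\<in>{0<..h0}. AE (r, \<omega>) in polar_measure. \<bar>V h (r, \<omega>)\<bar> \<le> B"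
    and R0: "R0 > 0"
    and \<phi>: "hl_smooth \<phi>" "\<And>r. r \<ge> 0 \<Longrightarrow> hl_deriv \<phi> r \<ge> 0"
        "closure {r. r \<ge> 0 \<and> hl_deriv \<phi> r \<noteq> 0} = {0..R0}"
    and main: "\<And>h. h \<in> {0<..h0} \<Longrightarrow>
        \<exists>G. has_radial_derivative
              (\<lambda>(r, \<omega>). w_wt \<delta> r *
                 (E - V h (r, \<omega>) + (hl_deriv \<phi> r)\<^sup>2 - h * hl_deriv (hl_deriv \<phi>) r)) G \<and>
            (AE (r, \<omega>) in polar_measure. G (r, \<omega>) \<ge> 1 / 4 * E * deriv (w_wt \<delta>) r)"
  shows "\<exists>C>0. \<forall>v::'a \<Rightarrow> complex. \<forall>\<epsilon> h. v \<in> Cc_infinity \<longrightarrow> \<epsilon> \<ge> 0 \<longrightarrow> h \<in> {0<..h0} \<longrightarrow>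
      (L2_norm (\<lambda>x. of_real (inverse (m_wt \<delta> (norm x)) * exp (\<phi> (norm x) / h)) * v x))\<^sup>2
      \<le> C / h\<^sup>2 *
          (L2_norm (\<lambda>x. of_real (m_wt \<delta> (norm x) * exp (\<phi> (norm x) / h)) *
             (P_op (V h) E h v x - \<i> * of_real \<epsilon> * v x)))\<^sup>2
        + C * \<epsilon> / h * (L2_norm (\<lambda>x. of_real (exp (\<phi> (norm x) / h)) * v x))\<^sup>2"
proof -
  \<comment> \<open>Beyond R0 the derivative of phi vanishes, so its bound on the compact interval
    [0, R0] holds on the whole half-line.\<close>
  have p0: "hl_deriv \<phi> r = 0" if "R0 < r" for r
  proof (rule ccontr)
    assume "hl_deriv \<phi> r \<noteq> 0"
    then have "r \<in> {r. r \<ge> 0 \<and> hl_deriv \<phi> r \<noteq> 0}" using that R0 by simp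
    then have "r \<in> closure {r. r \<ge> 0 \<and> hl_deriv \<phi> r \<noteq> 0}"
      by (rule subsetD[OF closure_subset])
    then have "r \<in> {0..R0}" unfolding \<phi>(3) .
    then show False using that by simp
  qed
  have c: "continuous_on {0..} (hl_deriv \<phi>)"
    using hl_smooth_continuous_on[OF \<phi>(1), of 1] by simp
  have "compact (hl_deriv \<phi> ` {0..R0})"
    by (intro compact_continuous_image continuous_on_subset[OF c]) auto
  then obtain M0 where M0: "\<forall>r\<in>{0..R0}. \<bar>hl_deriv \<phi> r\<bar> \<le> M0"
    using compact_imp_bounded[of "hl_deriv \<phi> ` {0..R0}"] unfolding bounded_iff by auto
  define M where "M = max M0 0"
  have M: "hl_deriv \<phi> r \<le> M" if "0 \<le> r" for r
  proof (cases "r \<le> R0")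
    case True
    with M0 that have "\<bar>hl_deriv \<phi> r\<bar> \<le> M0" by auto
    then show ?thesis unfolding M_def by linarith
  next
    case False
    then show ?thesis using p0[of r] by (simp add: M_def)
  qed
  \<comment> \<open>One bound for all h in (0, h0] makes the constant independent of h; it enters C
    through K. The maximum with 0 below makes B nonnegative.\<close>
  obtain B0 where B0: "\<forall>h\<in>{0<..h0}. AE (r, \<omega>) in polar_measure. \<bar>V h (r, \<omega> :: 'a)\<bar> \<le> B0"
    using V_unif by blast
  define B where "B = max B0 0"
  have B: "0 \<le> B" "AE z in polar_measure. \<bar>V h z\<bar> \<le> B" if "h \<in> {0<..h0}" for h
  proof -
    show "0 \<le> B" by (simp add: B_def)
    have "AE z in polar_measure. \<bar>V h z\<bar> \<le> B0"
      using B0[rule_format, OF that] by (simp add: case_prod_beta')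
    then show "AE z in polar_measure. \<bar>V h z\<bar> \<le> B"
      by eventually_elim (simp add: B_def)
  qed
  define K where "K = 2 + 4 * (B + E) + 10 * M\<^sup>2"
  define C where "C = 1 + 8 / (E * \<delta>) * (2 / \<delta> + K * h0\<^sup>2 + 1 + K)"
  have "0 \<le> K" using E by (simp add: K_def B_def)
  then have "0 < C" using E \<delta> by (simp add: C_def add_pos_nonneg)
  moreover have "(L2_norm (\<lambda>x. of_real (inverse (m_wt \<delta> (norm x)) * exp (\<phi> (norm x) / h)) * v x))\<^sup>2
      \<le> C / h\<^sup>2 *
          (L2_norm (\<lambda>x. of_real (m_wt \<delta> (norm x) * exp (\<phi> (norm x) / h)) *
             (P_op (V h) E h v x - \<i> * of_real \<epsilon> * v x)))\<^sup>2
        + C * \<epsilon> / h * (L2_norm (\<lambda>x. of_real (exp (\<phi> (norm x) / h)) * v x))\<^sup>2"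
    if v: "v \<in> Cc_infinity" and \<epsilon>: "\<epsilon> \<ge> 0" and h: "h \<in> {0<..h0}" for v :: "'a \<Rightarrow> complex" and \<epsilon> h
  proof -
    obtain W where "has_radial_derivative (V h) W" using V[of h] h by auto
    then have meas: "V h \<in> borel_measurable polar_measure"
      by (simp add: has_radial_derivative_def Linfty_def)
    have sv: "smooth_on UNIV v" using v by (simp add: Cc_infinity_def smooth_eq_smooth_on_UNIV)
    have "bounded (supp v)" using v by (simp add: Cc_infinity_def compact_imp_bounded)
    then obtain R1 where R1: "\<And>x. x \<in> supp v \<Longrightarrow> norm x \<le> R1" unfolding bounded_iff by blast
    \<comment> \<open>The radius is taken to be at least 1, as the estimates for fixed parameters
      assume.\<close>
    have v0: "v x = 0" if "max R1 1 < norm x" for x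
    proof (rule ccontr)
      assume "v x \<noteq> 0"
      then have "x \<in> supp v" unfolding supp_def by (intro subsetD[OF closure_subset]) simp
      then show False using R1[of x] that by simp
    qed
    obtain G where G: "has_radial_derivative (\<lambda>(r, \<omega>). w_wt \<delta> r *
          (E - V h (r, \<omega>) + (hl_deriv \<phi> r)\<^sup>2 - h * hl_deriv (hl_deriv \<phi>) r)) G"
      "AE (r, \<omega>) in polar_measure. G (r, \<omega>) \<ge> 1 / 4 * E * deriv (w_wt \<delta>) r"
      using main[OF h] by blast
    have "\<delta> < 1" "0 < h" "h \<le> h0" using \<delta> \<delta>0 h by auto
    from carleman_fixed_parameters[OF dim E B(1)[OF h] \<delta>(1) this(1,2) \<epsilon> \<phi>(1,2) M meas B(2)[OF h] G sv v0 max.cobounded2 this(3)]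
    show ?thesis unfolding C_def K_def .
  qed
  ultimately show ?thesis by blast
qed

end
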